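(* Let $G$ be a complex Lie group with (bi-invariant) complex structure $J$ and Lie algebra $(\mathfrak g,[\cdot,\cdot])$, and let $\mathfrak z$ be the center of $\mathfrak g$. Let $g$ be a left-invariant Hermitian metric on $G$ (Hermitian with respect to $J$), let $\Gamma\subset G$ be a lattice and $M=G/\Gamma$; denote also by $g$, $J$ the induced structures on $M$. Let $J^-$ be the left-invariant almost complex structure (on $G$, and induced on $M$) determined on $\mathfrak g$ by $J^-(X)=J(X)$ if $X\in\mathfrak z$ and $J^-(X)=-J(X)$ if $X\in\mathfrak z^{\perp}$, where $\mathfrak z^\perp$ is the $g$-orthogonal complement of $\mathfrak z$ in $\mathfrak g$. Then the following are equivalent: 1. the curvature tensor of $g$ satisfies the second Gray identity $({\rm G}_2)$ with respect to $J$; 2. the curvature tensor of every left-invariant Hermitian metric on $M=G/\Gamma$ (Hermitian with respect to $J$) satisfies the second Gray identity $({\rm G}_2)$ with respect to $J$; 3. $g$ is quasi-Kähler with respect to $J^-$; 4. the Lie group $G$ is $2$-step nilpotent. Moreover, if one of these conditions holds, then $g$ is Chern-flat with respect to $J$ and with respect to $J^-$.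
   Context: Left-invariant tensors on $M$ are those induced by left-invariant tensors on $G$, equivalently by tensors on $\mathfrak g$ (the quotient by $\Gamma$ is understood on the side for which left-invariant tensors descend). Since $G$ is a complex Lie group, $[JX,Y]=J[X,Y]$ for all $X,Y\in\mathfrak g$. "$2$-step nilpotent" means $[\mathfrak g,[\mathfrak g,\mathfrak g]]=0$ (the abelian case is allowed). An almost Hermitian structure $(g,J)$ on a manifold consists of a Riemannian metric $g$ and an almost complex structure $J$ that is a $g$-isometry; extend $g$ and its Riemannian curvature $R$ complex-multilinearly. Second Gray identity $({\rm G}_2)$ with respect to $J$: $R(Z_1,Z_2,Z_3,Z_4)=R(\overline Z_1,Z_2,Z_3,Z_4)=0$ for all vector fields $Z_1,\dots,Z_4$ of type $(1,0)$ with respect to $J$; equivalently $R(X,Y,Z,W)-R(JX,JY,Z,W)=R(JX,Y,JZ,W)+R(JX,Y,Z,JW)$ for all real vector fields. Quasi-Kähler: with $\omega(\cdot,\cdot)=g(\cdot,J\cdot)$, $(g,J)$ is quasi-Kähler if $\overline\partial\omega=0$ (the $(1,2)$-part of $d\omega$ with respect to $J$ vanishes); equivalently $D_{\overline Z_1}Z_2$ is of type $(1,0)$ for all $(1,0)$-vector fields $Z_1,Z_2$, where $D$ is the Levi-Civita connection of $g$. Chern connection: the unique connection $\nabla$ with $\nabla J=0$, $\nabla g=0$ whose torsion has everywhere vanishing $(1,1)$-part. The metric $g$ is Chern-flat with respect to $J$ if the holonomy group of the Chern connection of $(g,J)$ (on $M$) is trivial. *)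

theory Defs
  imports "HOL-Analysis.Analysis" "HOL-Algebra.Coset"
begin

section \<open>Smooth and holomorphic maps between open sets of Euclidean spaces\<close>

text \<open>Both notions are meant for open \<open>S\<close>. On a finite-dimensional domain, \<open>f\<close> is of class
  \<open>C^(k+1)\<close> iff it is differentiable and all its directional derivatives are of class \<open>C^k\<close>.\<close>

primrec k_smooth_on ::
    "nat \<Rightarrow> 'e::euclidean_space set \<Rightarrow> ('e \<Rightarrow> 'f::real_normed_vector) \<Rightarrow> bool" where
  "k_smooth_on 0 S f \<longleftrightarrow> continuous_on S f"
| "k_smooth_on (Suc k) S f \<longleftrightarrow>
     (\<forall>x\<in>S. f differentiable (at x)) \<and>
     (\<forall>v. k_smooth_on k S (\<lambda>x. frechet_derivative f (at x) v))"

definition smooth_on :: "'e::euclidean_space set \<Rightarrow> ('e \<Rightarrow> 'f::real_normed_vector) \<Rightarrow> bool" where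
  "smooth_on S f \<longleftrightarrow> (\<forall>k. k_smooth_on k S f)"

text \<open>Holomorphic maps in several variables: smooth maps whose differential intertwines the
  multiplications by the imaginary unit, \<open>I1\<close> on the domain and \<open>I2\<close> on the codomain
  (the Cauchy-Riemann equations).\<close>

definition holo_on :: "('e \<Rightarrow> 'e) \<Rightarrow> ('f \<Rightarrow> 'f) \<Rightarrow>
    'e::euclidean_space set \<Rightarrow> ('e \<Rightarrow> 'f::real_normed_vector) \<Rightarrow> bool" where
  "holo_on I1 I2 S f \<longleftrightarrow> smooth_on S f \<and>
     (\<forall>x\<in>S. \<forall>v. frechet_derivative f (at x) (I1 v) = I2 (frechet_derivative f (at x) v))"

definition mult_i :: "complex^'n \<Rightarrow> complex^'n" where
  "mult_i v = \<i> *s v"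


section \<open>Manifolds given by an atlas\<close>

type_synonym ('p, 'e) chart = "'p set \<times> ('p \<Rightarrow> 'e)"

definition pts :: "('p, 'e) chart set \<Rightarrow> 'p set" where
  "pts A = (\<Union>(U, \<phi>)\<in>A. U)"

text \<open>Here the topology of the manifold is that of the type \<open>'a\<close>.\<close>

definition complex_atlas :: "('a::topological_space, complex^'n) chart set \<Rightarrow> bool" where
  "complex_atlas A \<longleftrightarrow>
     pts A = UNIV \<and>
     (\<forall>(U, \<phi>)\<in>A. open U \<and> open (\<phi> ` U) \<and> inj_on \<phi> U \<and>
        homeomorphism U (\<phi> ` U) \<phi> (inv_into U \<phi>)) \<and>
     (\<forall>(U, \<phi>)\<in>A. \<forall>(V, \<psi>)\<in>A. holo_on mult_i mult_i (\<phi> ` (U \<inter> V)) (\<psi> \<circ> inv_into U \<phi>))"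

text \<open>Real functions that are smooth in a neighbourhood of \<open>p\<close>. They are total functions whose
  values away from \<open>p\<close> are arbitrary, so they represent the germs at \<open>p\<close> of smooth functions.\<close>

definition germs :: "('p, 'e::euclidean_space) chart set \<Rightarrow> 'p \<Rightarrow> ('p \<Rightarrow> real) set" where
  "germs A p = {f. \<exists>(U, \<phi>)\<in>A. p \<in> U \<and>
     (\<exists>N. open N \<and> \<phi> p \<in> N \<and> N \<subseteq> \<phi> ` U \<and> smooth_on N (f \<circ> inv_into U \<phi>))}"

definition smooth_funs :: "('p, 'e::euclidean_space) chart set \<Rightarrow> ('p \<Rightarrow> real) set" where
  "smooth_funs A = {f. \<forall>p\<in>pts A. f \<in> germs A p}"

text \<open>A tangent vector is a directional derivative acting on germs; as a function on all of
  \<open>'p \<Rightarrow> real\<close> it is set to \<open>0\<close> off \<open>germs A p\<close>, so that tangent vectors at the same point are equal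
  iff they agree on germs, and vector space operations are pointwise.\<close>

type_synonym 'p tvec = "('p \<Rightarrow> real) \<Rightarrow> real"

definition coord_vec ::
    "('p, 'e::euclidean_space) chart set \<Rightarrow> ('p, 'e) chart \<Rightarrow> 'p \<Rightarrow> 'e \<Rightarrow> 'p tvec" where
  "coord_vec A c p u = (\<lambda>f. if f \<in> germs A p
     then frechet_derivative (f \<circ> inv_into (fst c) (snd c)) (at (snd c p)) u else 0)"

definition tangent_space :: "('p, 'e::euclidean_space) chart set \<Rightarrow> 'p \<Rightarrow> 'p tvec set" where
  "tangent_space A p = {coord_vec A c p u | c u. c \<in> A \<and> p \<in> fst c}"

text \<open>The differential at \<open>p\<close> of a map \<open>F\<close> from the manifold with atlas \<open>A\<close> to the one with
  atlas \<open>B\<close> depends on \<open>A\<close> only through its argument, a tangent vector at \<open>p\<close>.\<close>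

definition differential :: "('q, 'f::euclidean_space) chart set \<Rightarrow> ('p \<Rightarrow> 'q) \<Rightarrow> 'p \<Rightarrow>
    'p tvec \<Rightarrow> 'q tvec" where
  "differential B F p v = (\<lambda>f. if f \<in> germs B (F p) then v (f \<circ> F) else 0)"

text \<open>Vector fields are set to \<open>0\<close> off the manifold.\<close>

type_synonym 'p field = "'p \<Rightarrow> 'p tvec"

definition vfields :: "('p, 'e::euclidean_space) chart set \<Rightarrow> 'p field set" where
  "vfields A = {X. (\<forall>p\<in>pts A. X p \<in> tangent_space A p) \<and>
     (\<forall>p. p \<notin> pts A \<longrightarrow> X p = (\<lambda>f. 0)) \<and>
     (\<forall>p\<in>pts A. \<forall>f\<in>germs A p. (\<lambda>q. X q f) \<in> germs A p)}"

definition zero_field :: "'p field" where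
  "zero_field = (\<lambda>p f. 0)"

definition bracket :: "('p, 'e::euclidean_space) chart set \<Rightarrow> 'p field \<Rightarrow> 'p field \<Rightarrow> 'p field" where
  "bracket A X Y = (\<lambda>p f. if f \<in> germs A p
     then X p (\<lambda>q. Y q f) - Y p (\<lambda>q. X q f) else 0)"

type_synonym 'p endo = "'p \<Rightarrow> 'p tvec \<Rightarrow> 'p tvec"

definition app :: "('p, 'e::euclidean_space) chart set \<Rightarrow> 'p endo \<Rightarrow> 'p field \<Rightarrow> 'p field" where
  "app A J X = (\<lambda>p. if p \<in> pts A then J p (X p) else (\<lambda>f. 0))"

definition complex_structure :: "('p, complex^'n) chart set \<Rightarrow> 'p endo" where
  "complex_structure A p v = (THE w. \<exists>c\<in>A. \<exists>u. p \<in> fst c \<and>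
     v = coord_vec A c p u \<and> w = coord_vec A c p (mult_i u))"


section \<open>Riemannian and almost Hermitian geometry\<close>

type_synonym 'p metr = "'p \<Rightarrow> 'p tvec \<Rightarrow> 'p tvec \<Rightarrow> real"

definition riemannian :: "('p, 'e::euclidean_space) chart set \<Rightarrow> 'p metr \<Rightarrow> bool" where
  "riemannian A g \<longleftrightarrow>
     (\<forall>p\<in>pts A. \<forall>v\<in>tangent_space A p. \<forall>w\<in>tangent_space A p.
        g p v w = g p w v \<and>
        (\<forall>u\<in>tangent_space A p. \<forall>a b. g p (\<lambda>f. a * v f + b * w f) u = a * g p v u + b * g p w u) \<and>
        (v \<noteq> (\<lambda>f. 0) \<longrightarrow> g p v v > 0)) \<and>
     (\<forall>X\<in>vfields A. \<forall>Y\<in>vfields A. (\<lambda>p. g p (X p) (Y p)) \<in> smooth_funs A)"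

definition isometric_endo ::
    "('p, 'e::euclidean_space) chart set \<Rightarrow> 'p metr \<Rightarrow> 'p endo \<Rightarrow> bool" where
  "isometric_endo A g J \<longleftrightarrow> (\<forall>p\<in>pts A. \<forall>v\<in>tangent_space A p. \<forall>w\<in>tangent_space A p.
     g p (J p v) (J p w) = g p v w)"

type_synonym 'p conn = "'p field \<Rightarrow> 'p field \<Rightarrow> 'p field"

text \<open>\<open>D X Y\<close> is the covariant derivative of \<open>Y\<close> in direction \<open>X\<close>. It is set to zero unless both
  arguments are vector fields, which makes the connections defined by \<open>THE\<close> below unique.\<close>

definition affine_connection :: "('p, 'e::euclidean_space) chart set \<Rightarrow> 'p conn \<Rightarrow> bool" where
  "affine_connection A D \<longleftrightarrow>
     (\<forall>X Y. \<not> (X \<in> vfields A \<and> Y \<in> vfields A) \<longrightarrow> D X Y = zero_field) \<and>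
     (\<forall>X\<in>vfields A. \<forall>Y\<in>vfields A. D X Y \<in> vfields A) \<and>
     (\<forall>X\<in>vfields A. \<forall>X'\<in>vfields A. \<forall>Y\<in>vfields A. \<forall>a\<in>smooth_funs A. \<forall>b\<in>smooth_funs A.
        D (\<lambda>p f. a p * X p f + b p * X' p f) Y = (\<lambda>p f. a p * D X Y p f + b p * D X' Y p f)) \<and>
     (\<forall>X\<in>vfields A. \<forall>Y\<in>vfields A. \<forall>Y'\<in>vfields A.
        D X (\<lambda>p f. Y p f + Y' p f) = (\<lambda>p f. D X Y p f + D X Y' p f)) \<and>
     (\<forall>X\<in>vfields A. \<forall>Y\<in>vfields A. \<forall>a\<in>smooth_funs A.
        D X (\<lambda>p f. a p * Y p f) = (\<lambda>p f. X p a * Y p f + a p * D X Y p f))"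

definition torsion :: "('p, 'e::euclidean_space) chart set \<Rightarrow> 'p conn \<Rightarrow>
    'p field \<Rightarrow> 'p field \<Rightarrow> 'p field" where
  "torsion A D X Y = (\<lambda>p f. D X Y p f - D Y X p f - bracket A X Y p f)"

definition metric_connection ::
    "('p, 'e::euclidean_space) chart set \<Rightarrow> 'p metr \<Rightarrow> 'p conn \<Rightarrow> bool" where
  "metric_connection A g D \<longleftrightarrow>
     (\<forall>X\<in>vfields A. \<forall>Y\<in>vfields A. \<forall>Z\<in>vfields A. \<forall>p\<in>pts A.
        X p (\<lambda>q. g q (Y q) (Z q)) = g p (D X Y p) (Z p) + g p (Y p) (D X Z p))"

definition levi_civita :: "('p, 'e::euclidean_space) chart set \<Rightarrow> 'p metr \<Rightarrow> 'p conn" where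
  "levi_civita A g = (THE D. affine_connection A D \<and> metric_connection A g D \<and>
     (\<forall>X\<in>vfields A. \<forall>Y\<in>vfields A. torsion A D X Y = zero_field))"

definition curvature_op :: "('p, 'e::euclidean_space) chart set \<Rightarrow> 'p conn \<Rightarrow>
    'p field \<Rightarrow> 'p field \<Rightarrow> 'p field \<Rightarrow> 'p field" where
  "curvature_op A D X Y Z =
     (\<lambda>p f. D X (D Y Z) p f - D Y (D X Z) p f - D (bracket A X Y) Z p f)"

definition riemann_tensor :: "('p, 'e::euclidean_space) chart set \<Rightarrow> 'p metr \<Rightarrow>
    'p field \<Rightarrow> 'p field \<Rightarrow> 'p field \<Rightarrow> 'p field \<Rightarrow> 'p \<Rightarrow> real" where
  "riemann_tensor A g X Y Z W p = g p (curvature_op A (levi_civita A g) X Y Z p) (W p)"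

definition fundamental_form :: "'p metr \<Rightarrow> 'p endo \<Rightarrow> 'p field \<Rightarrow> 'p field \<Rightarrow> 'p \<Rightarrow> real" where
  "fundamental_form g J X Y p = g p (X p) (J p (Y p))"

definition ext_deriv2 :: "('p, 'e::euclidean_space) chart set \<Rightarrow>
    ('p field \<Rightarrow> 'p field \<Rightarrow> 'p \<Rightarrow> real) \<Rightarrow>
    'p field \<Rightarrow> 'p field \<Rightarrow> 'p field \<Rightarrow> 'p \<Rightarrow> real" where
  "ext_deriv2 A \<omega> X Y Z p =
     X p (\<omega> Y Z) - Y p (\<omega> X Z) + Z p (\<omega> X Y)
     - \<omega> (bracket A X Y) Z p + \<omega> (bracket A X Z) Y p - \<omega> (bracket A Y Z) X p"


subsection \<open>Complexification and types\<close>

text \<open>The pair \<open>(X, Y)\<close> stands for the complex vector field \<open>X + \<i> Y\<close>.\<close>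

type_synonym 'p cfield = "'p field \<times> 'p field"

definition part :: "nat \<Rightarrow> 'p cfield \<Rightarrow> 'p field" where
  "part k Z = (if k = 0 then fst Z else snd Z)"

definition conj_field :: "'p cfield \<Rightarrow> 'p cfield" where
  "conj_field Z = (fst Z, \<lambda>p f. - snd Z p f)"

text \<open>Type \<open>(1,0)\<close>: \<open>J Z = \<i> Z\<close>, that is \<open>J X = - Y\<close> and \<open>J Y = X\<close> for \<open>Z = X + \<i> Y\<close>.\<close>

definition type10 :: "('p, 'e::euclidean_space) chart set \<Rightarrow> 'p endo \<Rightarrow> 'p cfield set" where
  "type10 A J = {Z. fst Z \<in> vfields A \<and> snd Z \<in> vfields A \<and>
     app A J (fst Z) = (\<lambda>p f. - snd Z p f) \<and> app A J (snd Z) = fst Z}"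

text \<open>Complex-multilinear extensions of real-multilinear maps.\<close>

definition cext2 :: "('p field \<Rightarrow> 'p field \<Rightarrow> real) \<Rightarrow> 'p cfield \<Rightarrow> 'p cfield \<Rightarrow> complex" where
  "cext2 T Z1 Z2 = (\<Sum>a<2. \<Sum>b<2. \<i> ^ (a + b) * complex_of_real (T (part a Z1) (part b Z2)))"

definition cext3 :: "('p field \<Rightarrow> 'p field \<Rightarrow> 'p field \<Rightarrow> real) \<Rightarrow>
    'p cfield \<Rightarrow> 'p cfield \<Rightarrow> 'p cfield \<Rightarrow> complex" where
  "cext3 T Z1 Z2 Z3 = (\<Sum>a<2. \<Sum>b<2. \<Sum>c<2. \<i> ^ (a + b + c) *
     complex_of_real (T (part a Z1) (part b Z2) (part c Z3)))"

definition cext4 :: "('p field \<Rightarrow> 'p field \<Rightarrow> 'p field \<Rightarrow> 'p field \<Rightarrow> real) \<Rightarrow>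
    'p cfield \<Rightarrow> 'p cfield \<Rightarrow> 'p cfield \<Rightarrow> 'p cfield \<Rightarrow> complex" where
  "cext4 T Z1 Z2 Z3 Z4 = (\<Sum>a<2. \<Sum>b<2. \<Sum>c<2. \<Sum>d<2. \<i> ^ (a + b + c + d) *
     complex_of_real (T (part a Z1) (part b Z2) (part c Z3) (part d Z4)))"

definition second_gray :: "('p, 'e::euclidean_space) chart set \<Rightarrow> 'p metr \<Rightarrow> 'p endo \<Rightarrow> bool" where
  "second_gray A g J \<longleftrightarrow>
     (\<forall>Z1\<in>type10 A J. \<forall>Z2\<in>type10 A J. \<forall>Z3\<in>type10 A J. \<forall>Z4\<in>type10 A J. \<forall>p\<in>pts A.
        cext4 (\<lambda>X Y Z W. riemann_tensor A g X Y Z W p) Z1 Z2 Z3 Z4 = 0 \<and>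
        cext4 (\<lambda>X Y Z W. riemann_tensor A g X Y Z W p) (conj_field Z1) Z2 Z3 Z4 = 0)"

definition quasi_kaehler :: "('p, 'e::euclidean_space) chart set \<Rightarrow> 'p metr \<Rightarrow> 'p endo \<Rightarrow> bool" where
  "quasi_kaehler A g J \<longleftrightarrow>
     (\<forall>Z1\<in>type10 A J. \<forall>Z2\<in>type10 A J. \<forall>Z3\<in>type10 A J. \<forall>p\<in>pts A.
        cext3 (\<lambda>X Y Z. ext_deriv2 A (fundamental_form g J) X Y Z p)
          Z1 (conj_field Z2) (conj_field Z3) = 0)"

definition chern_connection ::
    "('p, 'e::euclidean_space) chart set \<Rightarrow> 'p metr \<Rightarrow> 'p endo \<Rightarrow> 'p conn" where
  "chern_connection A g J = (THE D. affine_connection A D \<and> metric_connection A g D \<and>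
     (\<forall>X\<in>vfields A. \<forall>Y\<in>vfields A. D X (app A J Y) = app A J (D X Y)) \<and>
     (\<forall>Z\<in>type10 A J. \<forall>W\<in>type10 A J. \<forall>p f.
        cext2 (\<lambda>X Y. torsion A D X Y p f) Z (conj_field W) = 0))"


subsection \<open>Parallel transport and holonomy\<close>

definition smooth_curve :: "('p, 'e::euclidean_space) chart set \<Rightarrow> (real \<Rightarrow> 'p) \<Rightarrow> bool" where
  "smooth_curve A c \<longleftrightarrow> (\<forall>t\<in>{0..1}. \<exists>(U, \<phi>)\<in>A. \<exists>N. open N \<and> t \<in> N \<and> c ` N \<subseteq> U \<and>
     smooth_on N (\<phi> \<circ> c))"

definition velocity :: "('p, 'e::euclidean_space) chart set \<Rightarrow> (real \<Rightarrow> 'p) \<Rightarrow> real \<Rightarrow> 'p tvec" where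
  "velocity A c t = (\<lambda>f. if f \<in> germs A (c t) then deriv (f \<circ> c) t else 0)"

definition cov_deriv_at :: "('p, 'e::euclidean_space) chart set \<Rightarrow> 'p conn \<Rightarrow>
    'p \<Rightarrow> 'p tvec \<Rightarrow> 'p field \<Rightarrow> 'p tvec" where
  "cov_deriv_at A D p v Y = (THE w. \<exists>X\<in>vfields A. X p = v \<and> w = D X Y p)"

text \<open>Every smooth vector field along a smooth curve \<open>c\<close> is a finite sum of terms \<open>h(t) Y(c(t))\<close> with
  \<open>h\<close> a smooth function of \<open>t\<close> and \<open>Y\<close> a vector field on the manifold; the covariant derivative
  along \<open>c\<close> of such a term is \<open>h'(t) Y(c(t)) + h(t) (D_(c'(t)) Y)(c(t))\<close>.\<close>

definition parallel_along :: "('p, 'e::euclidean_space) chart set \<Rightarrow> 'p conn \<Rightarrow>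
    (real \<Rightarrow> 'p) \<Rightarrow> (real \<Rightarrow> 'p tvec) \<Rightarrow> bool" where
  "parallel_along A D c V \<longleftrightarrow>
     (\<exists>m (h :: nat \<Rightarrow> real \<Rightarrow> real) (Y :: nat \<Rightarrow> 'p field) S. open S \<and> {0..1} \<subseteq> S \<and>
        (\<forall>i<m. smooth_on S (h i) \<and> Y i \<in> vfields A) \<and>
        (\<forall>t\<in>{0..1}. \<forall>f.
           V t f = (\<Sum>i<m. h i t * Y i (c t) f) \<and>
           (\<Sum>i<m. deriv (h i) t * Y i (c t) f
              + h i t * cov_deriv_at A D (c t) (velocity A c t) (Y i) f) = 0))"

text \<open>A piecewise smooth path is a list of consecutive smooth curves defined near \<open>{0..1}\<close>.\<close>

primrec smooth_path ::
    "('p, 'e::euclidean_space) chart set \<Rightarrow> (real \<Rightarrow> 'p) list \<Rightarrow> 'p \<Rightarrow> 'p \<Rightarrow> bool" where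
  "smooth_path A [] p q \<longleftrightarrow> p = q"
| "smooth_path A (c # cs) p q \<longleftrightarrow> smooth_curve A c \<and> c 0 = p \<and> smooth_path A cs (c 1) q"

primrec transport :: "('p, 'e::euclidean_space) chart set \<Rightarrow> 'p conn \<Rightarrow>
    (real \<Rightarrow> 'p) list \<Rightarrow> 'p tvec \<Rightarrow> 'p tvec \<Rightarrow> bool" where
  "transport A D [] v w \<longleftrightarrow> v = w"
| "transport A D (c # cs) v w \<longleftrightarrow>
     (\<exists>V. parallel_along A D c V \<and> V 0 = v \<and> transport A D cs (V 1) w)"

definition holonomy :: "('p, 'e::euclidean_space) chart set \<Rightarrow> 'p conn \<Rightarrow> 'p \<Rightarrow>
    ('p tvec \<Rightarrow> 'p tvec) set" where
  "holonomy A D p = {P \<in> extensional (tangent_space A p).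
     \<exists>cs. smooth_path A cs p p \<and> (\<forall>v\<in>tangent_space A p. transport A D cs v (P v))}"

definition chern_flat :: "('p, 'e::euclidean_space) chart set \<Rightarrow> 'p metr \<Rightarrow> 'p endo \<Rightarrow> bool" where
  "chern_flat A g J \<longleftrightarrow>
     (\<forall>p\<in>pts A. holonomy A (chern_connection A g J) p = {restrict (\<lambda>v. v) (tangent_space A p)})"


section \<open>Complex Lie groups and left-invariant structures\<close>

text \<open>Multiplication and inversion are continuous (this is the openness of the domains of their
  coordinate expressions) and holomorphic.\<close>

definition complex_lie_group ::
    "('a::topological_space, 'b) monoid_scheme \<Rightarrow> ('a, complex^'n) chart set \<Rightarrow> bool" where
  "complex_lie_group G A \<longleftrightarrow>
     group G \<and> carrier G = UNIV \<and> complex_atlas A \<and>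
     (\<forall>(U, \<phi>)\<in>A. \<forall>(V, \<psi>)\<in>A. \<forall>(W, \<theta>)\<in>A.
        (let N = {(x, y). x \<in> \<phi> ` U \<and> y \<in> \<psi> ` V \<and> inv_into U \<phi> x \<otimes>\<^bsub>G\<^esub> inv_into V \<psi> y \<in> W}
        in open N \<and> holo_on (map_prod mult_i mult_i) mult_i N
             (\<lambda>(x, y). \<theta> (inv_into U \<phi> x \<otimes>\<^bsub>G\<^esub> inv_into V \<psi> y)))) \<and>
     (\<forall>(U, \<phi>)\<in>A. \<forall>(V, \<psi>)\<in>A.
        (let N = {x. x \<in> \<phi> ` U \<and> inv\<^bsub>G\<^esub> (inv_into U \<phi> x) \<in> V}
        in open N \<and> holo_on mult_i mult_i N (\<lambda>x. \<psi> (inv\<^bsub>G\<^esub> (inv_into U \<phi> x)))))"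

abbreviation left_diff :: "('a, 'b) monoid_scheme \<Rightarrow> ('a, 'e::euclidean_space) chart set \<Rightarrow>
    'a \<Rightarrow> 'a \<Rightarrow> 'a tvec \<Rightarrow> 'a tvec" where
  "left_diff G A a b \<equiv> differential A (\<lambda>x. a \<otimes>\<^bsub>G\<^esub> x) b"

definition lie_algebra ::
    "('a, 'b) monoid_scheme \<Rightarrow> ('a, 'e::euclidean_space) chart set \<Rightarrow> 'a field set" where
  "lie_algebra G A = {X\<in>vfields A. \<forall>a b. left_diff G A a b (X b) = X (a \<otimes>\<^bsub>G\<^esub> b)}"

definition lie_center ::
    "('a, 'b) monoid_scheme \<Rightarrow> ('a, 'e::euclidean_space) chart set \<Rightarrow> 'a field set" where
  "lie_center G A = {X\<in>lie_algebra G A. \<forall>Y\<in>lie_algebra G A. bracket A X Y = zero_field}"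

definition two_step_nilpotent ::
    "('a, 'b) monoid_scheme \<Rightarrow> ('a, 'e::euclidean_space) chart set \<Rightarrow> bool" where
  "two_step_nilpotent G A \<longleftrightarrow>
     (\<forall>X\<in>lie_algebra G A. \<forall>Y\<in>lie_algebra G A. \<forall>Z\<in>lie_algebra G A.
        bracket A X (bracket A Y Z) = zero_field)"

definition left_invariant_hermitian ::
    "('a, 'b) monoid_scheme \<Rightarrow> ('a, complex^'n) chart set \<Rightarrow> 'a metr \<Rightarrow> bool" where
  "left_invariant_hermitian G A g \<longleftrightarrow>
     riemannian A g \<and> isometric_endo A g (complex_structure A) \<and>
     (\<forall>a b. \<forall>v\<in>tangent_space A b. \<forall>w\<in>tangent_space A b.
        g (a \<otimes>\<^bsub>G\<^esub> b) (left_diff G A a b v) (left_diff G A a b w) = g b v w)"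

definition center_perp :: "('a, 'b) monoid_scheme \<Rightarrow> ('a, 'e::euclidean_space) chart set \<Rightarrow>
    'a metr \<Rightarrow> 'a field set" where
  "center_perp G A g = {Y\<in>lie_algebra G A. \<forall>X\<in>lie_center G A.
     g \<one>\<^bsub>G\<^esub> (X \<one>\<^bsub>G\<^esub>) (Y \<one>\<^bsub>G\<^esub>) = 0}"

definition J_minus :: "('a, 'b) monoid_scheme \<Rightarrow> ('a, complex^'n) chart set \<Rightarrow>
    'a metr \<Rightarrow> 'a endo" where
  "J_minus G A g a v = (THE w. \<exists>X\<in>lie_center G A. \<exists>Y\<in>center_perp G A g.
     v = (\<lambda>f. X a f + Y a f) \<and>
     w = (\<lambda>f. complex_structure A a (X a) f - complex_structure A a (Y a) f))"


section \<open>Quotients by lattices\<close>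

text \<open>Left-invariant tensors descend to the space \<open>rcosets\<^bsub>G\<^esub> \<Gamma>\<close> of cosets \<open>\<Gamma>a\<close>, on which \<open>G\<close> acts from
  the right. A lattice is a discrete subgroup such that this space, with the quotient topology,
  carries a nonzero finite \<open>G\<close>-invariant Borel measure.\<close>

definition lattice_in :: "('a::topological_space, 'b) monoid_scheme \<Rightarrow> 'a set \<Rightarrow> bool" where
  "lattice_in G \<Gamma> \<longleftrightarrow>
     subgroup \<Gamma> G \<and>
     (\<exists>N. open N \<and> N \<inter> \<Gamma> = {\<one>\<^bsub>G\<^esub>}) \<and>
     (\<exists>\<mu> :: 'a set measure.
        sets \<mu> = sigma_sets (rcosets\<^bsub>G\<^esub> \<Gamma>) {S. S \<subseteq> rcosets\<^bsub>G\<^esub> \<Gamma> \<and> open (\<Union>S)} \<and>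
        emeasure \<mu> (space \<mu>) \<noteq> 0 \<and> emeasure \<mu> (space \<mu>) \<noteq> \<infinity> \<and>
        (\<forall>a. \<forall>S\<in>sets \<mu>. emeasure \<mu> ((\<lambda>C. C #>\<^bsub>G\<^esub> a) ` S) = emeasure \<mu> S))"

definition coset_proj :: "('a, 'b) monoid_scheme \<Rightarrow> 'a set \<Rightarrow> 'a \<Rightarrow> 'a set" where
  "coset_proj G \<Gamma> a = \<Gamma> #>\<^bsub>G\<^esub> a"

definition quot_atlas :: "('a::topological_space, 'b) monoid_scheme \<Rightarrow> 'a set \<Rightarrow>
    ('a, 'e) chart set \<Rightarrow> ('a set, 'e) chart set" where
  "quot_atlas G \<Gamma> A = {(coset_proj G \<Gamma> ` V, \<phi> \<circ> inv_into V (coset_proj G \<Gamma>)) | V U \<phi>.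
     (U, \<phi>) \<in> A \<and> open V \<and> V \<subseteq> U \<and> inj_on (coset_proj G \<Gamma>) V}"

text \<open>Tensors induced on the quotient by left-invariant ones.\<close>

definition quot_metric :: "('a::topological_space, 'b) monoid_scheme \<Rightarrow> 'a set \<Rightarrow>
    ('a, 'e::euclidean_space) chart set \<Rightarrow> 'a metr \<Rightarrow> 'a set metr" where
  "quot_metric G \<Gamma> A g C v w = (THE r. \<exists>a\<in>C. \<exists>v'\<in>tangent_space A a. \<exists>w'\<in>tangent_space A a.
     v = differential (quot_atlas G \<Gamma> A) (coset_proj G \<Gamma>) a v' \<and>
     w = differential (quot_atlas G \<Gamma> A) (coset_proj G \<Gamma>) a w' \<and> r = g a v' w')"

definition quot_endo :: "('a::topological_space, 'b) monoid_scheme \<Rightarrow> 'a set \<Rightarrow>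
    ('a, 'e::euclidean_space) chart set \<Rightarrow> 'a endo \<Rightarrow> 'a set endo" where
  "quot_endo G \<Gamma> A J C v = (THE w. \<exists>a\<in>C. \<exists>v'\<in>tangent_space A a.
     v = differential (quot_atlas G \<Gamma> A) (coset_proj G \<Gamma>) a v' \<and>
     w = differential (quot_atlas G \<Gamma> A) (coset_proj G \<Gamma>) a (J a v'))"

end

theory Submission
  imports Defs
begin

text \<open>The left-invariant fields give \<open>M\<close> a global frame \<open>E u\<close> with constant structure coefficients,
  \<open>[E u, E v] = E [u, v]\<close>, in which \<open>g\<close>, \<open>J\<close> and \<open>J\<^sup>-\<close> are constant and \<open>[J u, v] = J [u, v]\<close>. So every
  connection is differentiation of coefficients plus a bilinear term, and everything is decided in
  the Lie algebra. For \<open>Z\<^sub>i\<close> of type \<open>(1,0)\<close> and \<open>W\<close> of type \<open>(0,1)\<close> the Koszul formula yields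
  \<open>R(Z\<^sub>1, Z\<^sub>2, Z\<^sub>3, Z\<^sub>4) = 0\<close> and, with the Jacobi identity,
  \<open>R(W, Z\<^sub>2, Z\<^sub>3, Z\<^sub>4) = - g(W, [Z\<^sub>2, [Z\<^sub>3, Z\<^sub>4]]) / 4\<close>, so the second Gray identity says that \<open>G\<close> is two-step
  nilpotent. The \<open>(1,2)\<close>-part of \<open>d\<omega>\<close> for \<open>J\<^sup>-\<close> only sees the components of brackets orthogonal to the
  centre, so it vanishes iff all brackets are central. Finally the flat connection making the frame
  parallel is the Chern connection of both \<open>J\<close> and \<open>J\<^sup>-\<close>: its torsion is minus the bracket, which
  has no \<open>(1,1)\<close>-part for either structure.\<close>

section \<open>Calculus of smooth maps\<close>

text \<open>Tangent vectors are operators on germs and connections act on global fields, so that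
  tensoriality would normally call for cutoff functions. The global frame avoids them: every field
  is a finite combination of frame fields with smooth coefficients, and an affine connection is
  determined by its values on frame fields. The smoothness of the coefficients is obtained by
  pairing a field with left-invariant ones under the metric.

  On the quotient no transition map is ever computed. A function is smooth there iff its pull-back
  to the group is, and every germ on the group is locally such a pull-back.

  A bracket ignores central components, so inside a bracket \<open>J\<^sup>-\<close> acts as
  \<open>- J\<close>: modulo the centre it exchanges the two types. Outside a bracket it
  distinguishes central from non-central values, and this is how it detects whether brackets are
  central.\<close>

abbreviation der :: "('e::euclidean_space \<Rightarrow> 'f::real_normed_vector) \<Rightarrow> 'e \<Rightarrow> 'e \<Rightarrow> 'f" where
  "der f x \<equiv> frechet_derivative f (at x)"

lemma frechet_derivative_eqI:
  "(f has_derivative f') (at x) \<Longrightarrow> der f x = f'"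
  by (simp add: frechet_derivative_at[symmetric])

section \<open>Closure properties of maps of class \<open>C^k\<close>\<close>

lemma k_smooth_on_subset: "k_smooth_on k S f \<Longrightarrow> T \<subseteq> S \<Longrightarrow> k_smooth_on k T f"
  by (induction k arbitrary: f) (auto intro: continuous_on_subset)

lemma k_smooth_on_SucD: "k_smooth_on (Suc k) S f \<Longrightarrow> k_smooth_on k S f"
proof (induction k arbitrary: f)
  case 0
  then show ?case
    by (auto intro!: differentiable_imp_continuous_on differentiable_at_imp_differentiable_on)
qed auto

text \<open>\<open>frechet_derivative\<close> at a point of \<open>S\<close> sees a full
  neighbourhood, so equality on \<open>S\<close> passes to the derivatives because \<open>S\<close>
  is open.\<close>

lemma k_smooth_on_cong:
  assumes "open S" "\<And>x. x \<in> S \<Longrightarrow> f x = g x" "k_smooth_on k S f"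
  shows "k_smooth_on k S g"
  using assms(2,3)
proof (induction k arbitrary: f g)
  case 0
  then show ?case by (simp cong: continuous_on_cong)
next
  case (Suc k)
  have *: "(g has_derivative der f x) (at x)" if "x \<in> S" for x
    using has_derivative_transform_within_open[OF _ assms(1) that] Suc.prems that
    by (metis frechet_derivative_works k_smooth_on.simps(2))
  have "k_smooth_on k S (\<lambda>x. der g x v)" for v
    by (rule Suc.IH[of "\<lambda>x. der f x v"])
      (use Suc.prems in \<open>auto simp: frechet_derivative_eqI[OF *]\<close>)
  then show ?case using * by (auto simp: differentiable_def)
qed

lemma k_smooth_on_const: "k_smooth_on k S (\<lambda>x. c)"
  by (induction k arbitrary: c) auto

lemma k_smooth_on_bounded_linear:
  assumes "open S" "bounded_linear L" "k_smooth_on k S f"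
  shows "k_smooth_on k S (\<lambda>x. L (f x))"
  using assms(3)
proof (induction k arbitrary: f)
  case 0
  then show ?case using bounded_linear.continuous_on[OF assms(2)] by auto
next
  case (Suc k)
  have *: "((\<lambda>x. L (f x)) has_derivative (\<lambda>v. L (der f x v))) (at x)"
    if "x \<in> S" for x
    using bounded_linear.has_derivative[OF assms(2)] Suc.prems that
    by (metis frechet_derivative_works k_smooth_on.simps(2))
  have "k_smooth_on k S (\<lambda>x. der (\<lambda>x. L (f x)) x v)" for v
    by (rule k_smooth_on_cong[OF assms(1) _ Suc.IH[of "\<lambda>x. der f x v"]])
      (use Suc.prems in \<open>auto simp: frechet_derivative_eqI[OF *]\<close>)
  then show ?case using * by (auto simp: differentiable_def)
qed

lemma k_smooth_on_add:
  assumes "open S" "k_smooth_on k S f" "k_smooth_on k S g"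
  shows "k_smooth_on k S (\<lambda>x. f x + g x)"
  using assms(2,3)
proof (induction k arbitrary: f g)
  case 0
  then show ?case by (auto intro: continuous_intros)
next
  case (Suc k)
  have *: "((\<lambda>x. f x + g x) has_derivative
      (\<lambda>v. der f x v + der g x v)) (at x)"
    if "x \<in> S" for x
    using has_derivative_add Suc.prems that
    by (metis frechet_derivative_works k_smooth_on.simps(2))
  have "k_smooth_on k S (\<lambda>x. der (\<lambda>x. f x + g x) x v)" for v
    by (rule k_smooth_on_cong[OF assms(1) _ Suc.IH[of "\<lambda>x. der f x v"
            "\<lambda>x. der g x v"]])
      (use Suc.prems in \<open>auto simp: frechet_derivative_eqI[OF *]\<close>)
  then show ?case using * by (auto simp: differentiable_def)
qed

lemma k_smooth_on_sum:
  assumes "open S" "\<And>i. i \<in> I \<Longrightarrow> k_smooth_on k S (f i)"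
  shows "k_smooth_on k S (\<lambda>x. \<Sum>i\<in>I. f i x)"
  using assms(2)
  by (induction I rule: infinite_finite_induct)
    (auto simp: k_smooth_on_const intro!: k_smooth_on_add[OF assms(1)])

text \<open>The Leibniz rule gives two terms of the same shape, so the induction keeps both factors
  general; the factor that is not differentiated is lowered by one order with
  \<open>k_smooth_on_SucD\<close>.\<close>

lemma k_smooth_on_bilinear:
  assumes "open S" "bounded_bilinear B" "k_smooth_on k S f" "k_smooth_on k S g"
  shows "k_smooth_on k S (\<lambda>x. B (f x) (g x))"
  using assms(3,4)
proof (induction k arbitrary: f g)
  case 0
  then show ?case using bounded_bilinear.continuous_on[OF assms(2)] by auto
next
  case (Suc k)
  have *: "((\<lambda>x. B (f x) (g x)) has_derivative
      (\<lambda>v. B (f x) (der g x v) + B (der f x v) (g x))) (at x)"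
    if "x \<in> S" for x
    by (rule bounded_bilinear.FDERIV[OF assms(2)])
      (use Suc.prems that in \<open>auto simp: frechet_derivative_works[symmetric]\<close>)
  have "k_smooth_on k S (\<lambda>x. der (\<lambda>x. B (f x) (g x)) x v)" for v
    by (rule k_smooth_on_cong[OF assms(1) _
          k_smooth_on_add[OF assms(1) Suc.IH[of f "\<lambda>x. der g x v"]
            Suc.IH[of "\<lambda>x. der f x v" g]]])
      (use Suc.prems Suc.prems[THEN k_smooth_on_SucD] in \<open>auto simp: frechet_derivative_eqI[OF *]\<close>)
  then show ?case using * by (auto simp: differentiable_def)
qed

lemma frechet_derivative_compose_eq:
  assumes "f differentiable at (g x)" "g differentiable at x"
  shows "der (\<lambda>x. f (g x)) x v =
    der f (g x) (der g x v)"
  using frechet_derivative_compose[OF assms(2,1)] by (auto simp: o_def fun_eq_iff)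

lemma linear_eq_sum_Basis:
  fixes f :: "'e::euclidean_space \<Rightarrow> 'f::real_vector"
  assumes "linear f"
  shows "f v = (\<Sum>b\<in>Basis. (v \<bullet> b) *\<^sub>R f b)"
proof -
  have "f v = f (\<Sum>b\<in>Basis. (v \<bullet> b) *\<^sub>R b)" by (simp add: euclidean_representation)
  also have "\<dots> = (\<Sum>b\<in>Basis. (v \<bullet> b) *\<^sub>R f b)"
    using assms by (simp add: linear_sum linear_cmul)
  finally show ?thesis .
qed

lemma bilinear_eq_sum_Basis:
  fixes B :: "'e::euclidean_space \<Rightarrow> 'f::euclidean_space \<Rightarrow> real"
  assumes "bilinear B"
  shows "B y z = (\<Sum>a\<in>Basis. \<Sum>b\<in>Basis. ((y \<bullet> a) * (z \<bullet> b)) * B a b)"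
proof -
  have "B y z = (\<Sum>a\<in>Basis. (y \<bullet> a) * B a z)"
    using linear_eq_sum_Basis[of "\<lambda>y. B y z" y] assms by (simp add: bilinear_def)
  also have "\<dots> = (\<Sum>a\<in>Basis. (y \<bullet> a) * (\<Sum>b\<in>Basis. (z \<bullet> b) * B a b))"
    using linear_eq_sum_Basis[of "B _" z] assms by (simp add: bilinear_def)
  finally show ?thesis by (simp add: sum_distrib_left mult_ac)
qed

lemma bilinear_inner:
  fixes B :: "'e::real_vector \<Rightarrow> 'f::real_vector \<Rightarrow> 'g::real_inner"
  assumes B: "bilinear B"
  shows "bilinear (\<lambda>u w. B u w \<bullet> b)"
  unfolding bilinear_def
  by (auto intro!: linearI simp: inner_add_left bilinear_ladd[OF B] bilinear_radd[OF B]
      bilinear_lmul[OF B] bilinear_rmul[OF B])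

text \<open>Smoothness is phrased through derivatives in fixed directions, while the chain rule has
  the moving direction \<open>der g x v\<close>. Expanding it in the basis leaves a sum of products
  to which the induction hypothesis and the bilinear rule apply.\<close>

lemma k_smooth_on_compose:
  fixes g :: "'e::euclidean_space \<Rightarrow> 'f::euclidean_space"
  assumes "open S" "open T" "g ` S \<subseteq> T" "k_smooth_on k S g" "k_smooth_on k T f"
  shows "k_smooth_on k S (\<lambda>x. f (g x))"
  using assms(4,5)
proof (induction k arbitrary: f)
  case 0
  then show ?case using assms(3) continuous_on_compose2 by auto
next
  case (Suc k)
  have d: "f differentiable at (g x)" "g differentiable at x" if "x \<in> S" for x
    using that Suc.prems assms(3) by auto
  have *: "der (\<lambda>x. f (g x)) x v =
      (\<Sum>b\<in>Basis. (der g x v \<bullet> b) *\<^sub>R der f (g x) b)"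
    if "x \<in> S" for x v
    using frechet_derivative_compose_eq[OF d[OF that]] linear_frechet_derivative[OF d(1)[OF that]]
    by (metis linear_eq_sum_Basis)
  have smooth_df: "k_smooth_on k S (\<lambda>x. der f (g x) b)" for b
    by (rule Suc.IH[of "\<lambda>y. der f y b"])
      (use Suc.prems(2) Suc.prems(1)[THEN k_smooth_on_SucD] in auto)
  have "k_smooth_on k S (\<lambda>x. der (\<lambda>x. f (g x)) x v)" for v
    by (rule k_smooth_on_cong[OF assms(1) *[symmetric]], assumption)
      (use Suc.prems smooth_df in
        \<open>auto intro!: k_smooth_on_sum[OF assms(1)]
         k_smooth_on_bilinear[OF assms(1) bounded_bilinear_scaleR]
         k_smooth_on_bounded_linear[OF assms(1) bounded_linear_inner_left]\<close>)
  then show ?case using d by (auto intro: differentiable_compose)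
qed

section \<open>The same closure properties for smooth maps\<close>

lemma smooth_on_subset: "smooth_on S f \<Longrightarrow> T \<subseteq> S \<Longrightarrow> smooth_on T f"
  unfolding smooth_on_def using k_smooth_on_subset by blast

lemma smooth_on_cong:
  "open S \<Longrightarrow> (\<And>x. x \<in> S \<Longrightarrow> f x = g x) \<Longrightarrow> smooth_on S f \<Longrightarrow> smooth_on S g"
  unfolding smooth_on_def using k_smooth_on_cong by blast

lemma smooth_on_const: "smooth_on S (\<lambda>x. c)"
  by (simp add: smooth_on_def k_smooth_on_const)

lemma smooth_on_bounded_linear:
  "open S \<Longrightarrow> bounded_linear L \<Longrightarrow> smooth_on S f \<Longrightarrow> smooth_on S (\<lambda>x. L (f x))"
  by (simp add: smooth_on_def k_smooth_on_bounded_linear)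

lemma smooth_on_add:
  "open S \<Longrightarrow> smooth_on S f \<Longrightarrow> smooth_on S g \<Longrightarrow> smooth_on S (\<lambda>x. f x + g x)"
  by (simp add: smooth_on_def k_smooth_on_add)

lemma smooth_on_sum:
  "open S \<Longrightarrow> (\<And>i. i \<in> I \<Longrightarrow> smooth_on S (f i)) \<Longrightarrow> smooth_on S (\<lambda>x. \<Sum>i\<in>I. f i x)"
  by (simp add: smooth_on_def k_smooth_on_sum)

lemma smooth_on_bilinear:
  "open S \<Longrightarrow> bounded_bilinear B \<Longrightarrow> smooth_on S f \<Longrightarrow> smooth_on S g \<Longrightarrow>
    smooth_on S (\<lambda>x. B (f x) (g x))"
  by (simp add: smooth_on_def k_smooth_on_bilinear)

lemma smooth_on_compose:
  fixes g :: "'e::euclidean_space \<Rightarrow> 'f::euclidean_space"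
  shows "smooth_on T f \<Longrightarrow> smooth_on S g \<Longrightarrow> open S \<Longrightarrow> open T \<Longrightarrow> g ` S \<subseteq> T \<Longrightarrow>
    smooth_on S (\<lambda>x. f (g x))"
  by (simp add: smooth_on_def k_smooth_on_compose)

lemma smooth_on_frechet_derivative:
  "smooth_on S f \<Longrightarrow> smooth_on S (\<lambda>x. der f x v)"
  unfolding smooth_on_def by (metis k_smooth_on.simps(2))

lemma smooth_on_differentiable: "smooth_on S f \<Longrightarrow> x \<in> S \<Longrightarrow> f differentiable at x"
  unfolding smooth_on_def by (metis k_smooth_on.simps(2))

lemma smooth_on_continuous: "smooth_on S f \<Longrightarrow> continuous_on S f"
  unfolding smooth_on_def by (metis k_smooth_on.simps(1))

lemma smooth_on_id: "smooth_on S (\<lambda>x::'e::euclidean_space. x)"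
proof -
  have "k_smooth_on k S (\<lambda>x::'e. x)" for k
    by (cases k) (auto simp: k_smooth_on_const)
  then show ?thesis by (simp add: smooth_on_def)
qed

lemma smooth_on_Pair:
  fixes f :: "'e::euclidean_space \<Rightarrow> 'f::real_normed_vector" and g :: "'e \<Rightarrow> 'g::real_normed_vector"
  assumes "open S" "smooth_on S f" "smooth_on S g"
  shows "smooth_on S (\<lambda>x. (f x, g x))"
proof -
  have "smooth_on S (\<lambda>x. (f x, 0) + (0, g x))"
    by (intro smooth_on_add assms(1)
        smooth_on_bounded_linear[OF assms(1) _ assms(2)] smooth_on_bounded_linear[OF assms(1) _ assms(3)]
        bounded_linear_intros bounded_linear_Pair bounded_linear_zero bounded_linear_ident)
  then show ?thesis by simp
qed

lemma smooth_on_frechet_derivative_apply: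
  fixes f :: "'e::euclidean_space \<Rightarrow> 'f::real_normed_vector" and v :: "'e \<Rightarrow> 'e"
  assumes "open S" "smooth_on S f" "smooth_on S v"
  shows "smooth_on S (\<lambda>x. der f x (v x))"
proof -
  have "smooth_on S (\<lambda>x. \<Sum>b\<in>Basis. (v x \<bullet> b) *\<^sub>R der f x b)"
    by (intro smooth_on_sum smooth_on_bilinear[OF assms(1) bounded_bilinear_scaleR] assms
        smooth_on_bounded_linear[OF assms(1) bounded_linear_inner_left] smooth_on_frechet_derivative)
  then show ?thesis
    by (rule smooth_on_cong[OF assms(1), rotated])
      (metis assms(2) linear_eq_sum_Basis linear_frechet_derivative smooth_on_differentiable)
qed

section \<open>Symmetry of second derivatives\<close>

lemma frechet_derivative_bounded_linear:
  assumes "bounded_linear L" "f differentiable at x"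
  shows "der (\<lambda>y. L (f y)) x v = L (der f x v)"
  using bounded_linear.has_derivative[OF assms(1)] assms(2)
  by (metis frechet_derivative_eqI frechet_derivative_works)

lemma has_real_derivative_along_line:
  fixes f :: "'e::euclidean_space \<Rightarrow> real"
  assumes "f differentiable at (y + t *\<^sub>R v)"
  shows "((\<lambda>t. f (y + t *\<^sub>R v)) has_real_derivative der f (y + t *\<^sub>R v) v) (at t)"
proof -
  have 1: "((\<lambda>t. y + t *\<^sub>R v) has_derivative (\<lambda>s. s *\<^sub>R v)) (at t)"
    by (auto intro!: derivative_eq_intros)
  have 2: "(f has_derivative der f (y + t *\<^sub>R v)) (at (y + t *\<^sub>R v))"
    using assms frechet_derivative_works by blast
  have "((\<lambda>t. f (y + t *\<^sub>R v)) has_derivative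
      (\<lambda>s. der f (y + t *\<^sub>R v) (s *\<^sub>R v))) (at t)"
    using has_derivative_compose[OF 1 2] by (simp add: o_def)
  then show ?thesis
    using linear_frechet_derivative[OF assms]
    by (simp add: has_field_derivative_def linear_cmul mult_commute_abs)
qed

text \<open>The mean value theorem is applied twice, along \<open>v\<close> to the increment in
  \<open>w\<close> and then along \<open>w\<close> to the derivative in direction \<open>v\<close>,
  so the intermediate point stays in the parallelogram spanned by \<open>s *\<^sub>R v\<close> and
  \<open>s *\<^sub>R w\<close>.\<close>

lemma second_difference_eq:
  fixes f :: "'e::euclidean_space \<Rightarrow> real"
  assumes S: "ball x r \<subseteq> S" "smooth_on S f" and s: "0 < s" "s * (norm v + norm w) < r"
  shows "\<exists>\<xi>. dist x \<xi> \<le> s * (norm v + norm w) \<and>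
    f (x + s *\<^sub>R v + s *\<^sub>R w) - f (x + s *\<^sub>R w) - (f (x + s *\<^sub>R v) - f x) =
      s * s * der (\<lambda>y. der f y v) \<xi> w"
proof -
  define d where "d y = der f y v" for y
  have near: "dist x (x + t *\<^sub>R v + t' *\<^sub>R w) \<le> s * (norm v + norm w)"
    if "0 \<le> t" "t \<le> s" "0 \<le> t'" "t' \<le> s" for t t'
  proof -
    have "dist x (x + t *\<^sub>R v + t' *\<^sub>R w) = norm (t *\<^sub>R v + t' *\<^sub>R w)"
      by (metis add.assoc add_diff_cancel_left' dist_commute dist_norm)
    also have "\<dots> \<le> t * norm v + t' * norm w"
      using norm_triangle_ineq[of "t *\<^sub>R v" "t' *\<^sub>R w"] that by simp
    also have "\<dots> \<le> s * (norm v + norm w)"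
      using that by (simp add: distrib_left add_mono mult_right_mono)
    finally show ?thesis .
  qed
  have inS: "x + t *\<^sub>R v + t' *\<^sub>R w \<in> S" if "0 \<le> t" "t \<le> s" "0 \<le> t'" "t' \<le> s" for t t'
    using near[OF that] s S(1) by (meson le_less_trans mem_ball subsetD)
  have df: "f differentiable at y" "d differentiable at y" if "y \<in> S" for y
    using that S smooth_on_differentiable smooth_on_frechet_derivative unfolding d_def by blast+
  have "\<exists>t>0. t < s \<and> (f (x + s *\<^sub>R w + s *\<^sub>R v) - f (x + s *\<^sub>R v)) - (f (x + s *\<^sub>R w + 0 *\<^sub>R v) - f (x + 0 *\<^sub>R v))
     = (s - 0) * (d (x + s *\<^sub>R w + t *\<^sub>R v) - d (x + t *\<^sub>R v))"
  proof (rule MVT2[OF s(1)])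
    fix t assume t: "0 \<le> t" "t \<le> s"
    have "x + s *\<^sub>R w + t *\<^sub>R v \<in> S" "x + t *\<^sub>R v \<in> S"
      using inS[OF t, of s] inS[OF t, of 0] s by (auto simp: algebra_simps)
    then show "((\<lambda>t. f (x + s *\<^sub>R w + t *\<^sub>R v) - f (x + t *\<^sub>R v)) has_real_derivative
        d (x + s *\<^sub>R w + t *\<^sub>R v) - d (x + t *\<^sub>R v)) (at t)"
      unfolding d_def by (intro DERIV_diff has_real_derivative_along_line df(1))
  qed
  then obtain t where t: "0 < t" "t < s" and
    e1: "f (x + s *\<^sub>R w + s *\<^sub>R v) - f (x + s *\<^sub>R v) - (f (x + s *\<^sub>R w) - f x) =
      s * (d (x + s *\<^sub>R w + t *\<^sub>R v) - d (x + t *\<^sub>R v))" by auto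
  have "\<exists>t'>0. t' < s \<and> d (x + t *\<^sub>R v + s *\<^sub>R w) - d (x + t *\<^sub>R v + 0 *\<^sub>R w) =
     (s - 0) * der d (x + t *\<^sub>R v + t' *\<^sub>R w) w"
    by (rule MVT2[OF s(1)], rule has_real_derivative_along_line, rule df(2), rule inS) (use t in auto)
  then obtain t' where t': "0 < t'" "t' < s" and
    e2: "d (x + t *\<^sub>R v + s *\<^sub>R w) - d (x + t *\<^sub>R v) =
      s * der d (x + t *\<^sub>R v + t' *\<^sub>R w) w" by auto
  have "f (x + s *\<^sub>R v + s *\<^sub>R w) - f (x + s *\<^sub>R w) - (f (x + s *\<^sub>R v) - f x) =
      s * s * der d (x + t *\<^sub>R v + t' *\<^sub>R w) w"
    using e1 e2 by (simp add: algebra_simps)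
  then show ?thesis using near[of t t'] t t' unfolding d_def[abs_def] by auto
qed

text \<open>The second difference over a small parallelogram is symmetric in \<open>v\<close> and
  \<open>w\<close>. Up to the factor \<open>s * s\<close> it equals both mixed derivatives at nearby
  points, and continuity carries their equality to \<open>x\<close>.\<close>

lemma symmetric_second_derivative_real:
  fixes f :: "'e::euclidean_space \<Rightarrow> real"
  assumes S: "open S" "smooth_on S f" "x \<in> S"
  shows "der (\<lambda>y. der f y v) x w =
    der (\<lambda>y. der f y w) x v"
proof -
  define D where "D v w y = der (\<lambda>y. der f y v) y w" for v w y
  have cont: "isCont (D v w) x" for v w
    using smooth_on_continuous[OF smooth_on_frechet_derivative[OF smooth_on_frechet_derivative[OF S(2)]]]
      S(1,3) unfolding D_def[abs_def] by (simp add: continuous_on_eq_continuous_at)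
  have le: "\<bar>D v w x - D w v x\<bar> < e" if e: "e > 0" for e
  proof -
    obtain r where r: "r > 0" "ball x r \<subseteq> S" using S by (meson openE)
    obtain d1 where d1: "d1 > 0" "\<And>y. dist y x < d1 \<Longrightarrow> dist (D v w y) (D v w x) < e/2"
      using cont[of v w, unfolded continuous_at_eps_delta, rule_format, of "e/2"] e
      by (auto simp: dist_norm)
    obtain d2 where d2: "d2 > 0" "\<And>y. dist y x < d2 \<Longrightarrow> dist (D w v y) (D w v x) < e/2"
      using cont[of w v, unfolded continuous_at_eps_delta, rule_format, of "e/2"] e
      by (auto simp: dist_norm)
    define m where "m = Min {r, d1, d2}"
    have m: "m > 0" "m \<le> r" "m \<le> d1" "m \<le> d2" using r d1 d2 by (auto simp: m_def)
    \<comment> \<open>The summand 1 keeps \<open>q\<close> positive when \<open>v\<close> and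
      \<open>w\<close> both vanish; the choice \<open>s = m / (2 * q)\<close> then keeps the
      parallelogram within distance \<open>m / 2\<close> of \<open>x\<close>.\<close>
    define q where "q = norm v + norm w + 1"
    have p: "q > 0" unfolding q_def by (smt (verit) norm_ge_zero)
    define s where "s = m / (2 * q)"
    have s0: "s > 0" using m p by (simp add: s_def)
    have "s * (norm v + norm w) \<le> s * q" using s0 by (simp add: q_def)
    also have "\<dots> = m / 2" using p by (simp add: s_def)
    also have "\<dots> < m" using m by simp
    finally have sm: "s * (norm v + norm w) < m" .
    obtain a where a: "dist x a \<le> s * (norm v + norm w)"
      "f (x + s *\<^sub>R v + s *\<^sub>R w) - f (x + s *\<^sub>R w) - (f (x + s *\<^sub>R v) - f x) = s * s * D v w a"
      using second_difference_eq[OF r(2) S(2) s0, of v w] sm m unfolding D_def by auto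
    obtain b where b: "dist x b \<le> s * (norm v + norm w)"
      "f (x + s *\<^sub>R w + s *\<^sub>R v) - f (x + s *\<^sub>R v) - (f (x + s *\<^sub>R w) - f x) = s * s * D w v b"
      using second_difference_eq[OF r(2) S(2) s0, of w v] sm m unfolding D_def
      by (auto simp: add.commute)
    have swap: "x + s *\<^sub>R w + s *\<^sub>R v = x + s *\<^sub>R v + s *\<^sub>R w" by (simp add: algebra_simps)
    have "s * s * D v w a = s * s * D w v b" using a(2) b(2)[unfolded swap] by linarith
    then have "D v w a = D w v b" using s0 by simp
    moreover have "dist (D v w a) (D v w x) < e/2"
      by (rule d1(2)) (use a(1) sm m in \<open>simp add: dist_commute\<close>)
    moreover have "dist (D w v b) (D w v x) < e/2"
      by (rule d2(2)) (use b(1) sm m in \<open>simp add: dist_commute\<close>)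
    ultimately show ?thesis unfolding dist_real_def by linarith
  qed
  have "\<bar>D v w x - D w v x\<bar> = 0"
    using le by (meson abs_ge_zero antisym not_le order_less_irrefl)
  then show ?thesis by (simp add: D_def)
qed

lemma symmetric_second_derivative:
  fixes f :: "'e::euclidean_space \<Rightarrow> 'f::euclidean_space"
  assumes S: "open S" "smooth_on S f" "x \<in> S"
  shows "der (\<lambda>y. der f y v) x w =
    der (\<lambda>y. der f y w) x v"
proof (rule euclidean_eqI)
  fix b :: 'f assume "b \<in> Basis"
  have *: "der (\<lambda>y. der f y v) x w \<bullet> b =
      der (\<lambda>y. der (\<lambda>y. f y \<bullet> b) y v) x w" for v w
  proof -
    have "der (\<lambda>y. der f y v) x w \<bullet> b =
        der (\<lambda>y. der f y v \<bullet> b) x w"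
      by (rule frechet_derivative_bounded_linear[symmetric, OF bounded_linear_inner_left])
        (use S smooth_on_differentiable smooth_on_frechet_derivative in blast)
    also have "der (\<lambda>y. der f y v \<bullet> b) x =
        der (\<lambda>y. der (\<lambda>y. f y \<bullet> b) y v) x"
    proof (rule frechet_derivative_transform_within_open[OF _ S(1,3)])
      show "(\<lambda>y. der f y v \<bullet> b) differentiable at x"
        by (rule smooth_on_differentiable[OF smooth_on_bounded_linear[OF S(1)
                bounded_linear_inner_left smooth_on_frechet_derivative[OF S(2)]] S(3)])
      show "der f y v \<bullet> b = der (\<lambda>y. f y \<bullet> b) y v"
        if "y \<in> S" for y
        by (rule frechet_derivative_bounded_linear[symmetric, OF bounded_linear_inner_left])
          (use S that smooth_on_differentiable in blast)
    qed
    finally show ?thesis .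
  qed
  show "der (\<lambda>y. der f y v) x w \<bullet> b =
      der (\<lambda>y. der f y w) x v \<bullet> b"
    unfolding * by (rule symmetric_second_derivative_real[OF S(1) _ S(3)])
      (rule smooth_on_bounded_linear[OF S(1) bounded_linear_inner_left S(2)])
qed

section \<open>The Lie algebra of a complex Lie group with a Hermitian inner product\<close>

text \<open>The Riesz theorem for a form other than the Euclidean product. The operator
  \<open>T\<close> carries \<open>h\<close> to the Euclidean product and is injective by positivity,
  hence onto by finite dimension.\<close>

lemma bilinear_form_representation:
  fixes h :: "'e::euclidean_space \<Rightarrow> 'e \<Rightarrow> real"
  assumes h: "bilinear h" "\<And>x. x \<noteq> 0 \<Longrightarrow> h x x > 0" and f: "linear f"
  shows "\<exists>w. \<forall>z. h w z = f z"
proof -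
  define T where "T w = (\<Sum>b\<in>Basis. h w b *\<^sub>R b)" for w
  have hl: "linear (\<lambda>w. h w b)" "linear (h w)" for b w using h(1) by (auto simp: bilinear_def)
  have T: "linear T"
    unfolding T_def
    by (rule linearI) (simp_all add: bilinear_ladd[OF h(1)] bilinear_lmul[OF h(1)] scaleR_add_left
        sum.distrib scaleR_sum_right)
  have Tb: "T w \<bullet> b = h w b" if "b \<in> Basis" for w b
    using that by (simp add: T_def)
  have rep: "h w z = T w \<bullet> z" for w z
    using linear_eq_sum_Basis[OF hl(2), of w z] Tb
    by (subst euclidean_inner) (simp add: mult.commute)
  have "inj T"
    unfolding linear_injective_0[OF T] using h(2) rep by (metis inner_zero_left less_irrefl)
  then have "surj T" using T linear_injective_imp_surjective by blast
  then obtain w where w: "T w = (\<Sum>b\<in>Basis. f b *\<^sub>R b)" by (metis surjD)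
  have "h w z = f z" for z
    unfolding rep w using linear_eq_sum_Basis[OF f, of z]
    by (simp add: inner_sum_left mult.commute inner_commute[of z])
  then show ?thesis by blast
qed

text \<open>With \<open>h s z = B s \<bullet> z\<close>, the \<open>h\<close>-orthogonal complement
  of \<open>S\<close> is the Euclidean complement of the image of \<open>S\<close> under the
  injective map \<open>B\<close>. So the dimension count for Euclidean complements applies, and
  positivity makes the sum direct.\<close>

lemma bilinear_form_orthogonal_decomposition:
  fixes h :: "'e::euclidean_space \<Rightarrow> 'e \<Rightarrow> real"
  assumes h: "bilinear h" "\<And>x. x \<noteq> 0 \<Longrightarrow> h x x > 0" and S: "subspace S"
  shows "\<exists>s\<in>S. \<forall>t\<in>S. h t (v - s) = 0"
proof -
  have "\<exists>u. \<forall>z. h u z = v \<bullet> z" for v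
    by (rule bilinear_form_representation[OF h]) (auto intro: linearI simp: inner_add_right)
  have ex: "\<exists>b. \<forall>z. h s z = b \<bullet> z" for s
  proof -
    have "linear (h s)" using h(1) by (auto simp: bilinear_def)
    then have "h s z = (\<Sum>b\<in>Basis. h s b *\<^sub>R b) \<bullet> z" for z
      using linear_eq_sum_Basis[of "h s" z]
      by (simp add: inner_sum_left mult.commute inner_commute[of z])
    then show ?thesis by blast
  qed
  then obtain B where B: "\<And>s z. h s z = B s \<bullet> z" by metis
  have Bl: "linear B"
    by (rule linearI; rule vector_eq_rdot[THEN iffD1])
      (auto simp: inner_add_left B[symmetric] bilinear_ladd[OF h(1)] bilinear_lmul[OF h(1)])
  have "inj B"
    unfolding linear_injective_0[OF Bl] using h(2) B by (metis inner_zero_left less_irrefl)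
  then have dB: "dim (B ` S) = dim S" using dim_image_eq[OF Bl] by (metis inj_on_subset subset_UNIV)
  define P where "P = {y. \<forall>x\<in>B ` S. orthogonal x y}"
  have sP: "subspace P" unfolding P_def using subspace_orthogonal_to_vectors .
  have "dim {y \<in> UNIV. \<forall>x \<in> B ` S. orthogonal x y} + dim (B ` S) = dim (UNIV :: 'e set)"
    by (rule dim_subspace_orthogonal_to_vectors)
      (use linear_subspace_image[OF Bl S] subspace_UNIV in auto)
  then have dP: "dim P + dim S = dim (UNIV :: 'e set)" by (simp add: P_def dB)
  have "S \<inter> P = {0}"
  proof -
    have "x = 0" if "x \<in> S" "x \<in> P" for x
      using that h(2)[of x] B[of x x] by (auto simp: P_def orthogonal_def)
    then show ?thesis using subspace_0[OF S] subspace_0[OF sP] by auto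
  qed
  then have "dim {x + y |x y. x \<in> S \<and> y \<in> P} = dim (UNIV :: 'e set)"
    using dim_sums_Int[OF S sP] dP by simp
  then have "{x + y |x y. x \<in> S \<and> y \<in> P} = UNIV"
    by (intro subspace_dim_equal subspace_sums S sP subspace_UNIV) auto
  then have "v \<in> {x + y |x y. x \<in> S \<and> y \<in> P}"
    by simp
  then obtain x y where "v = x + y" "x \<in> S" "y \<in> P" by auto
  then show ?thesis by (intro bexI[of _ x]) (auto simp: P_def orthogonal_def B)
qed

text \<open>The complex-multilinear extension at a single point: \<open>(x, y)\<close> stands for \<open>x + \<i> y\<close>.\<close>

definition sel :: "nat \<Rightarrow> 'e \<times> 'e \<Rightarrow> 'e" where
  "sel k P = (if k = 0 then fst P else snd P)"

definition ext3 :: "('e \<Rightarrow> 'e \<Rightarrow> 'e \<Rightarrow> real) \<Rightarrow> 'e \<times> 'e \<Rightarrow> 'e \<times> 'e \<Rightarrow> 'e \<times> 'e \<Rightarrow> complex" where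
  "ext3 T P Q R = (\<Sum>a<2. \<Sum>b<2. \<Sum>c<2. \<i> ^ (a + b + c) *
     complex_of_real (T (sel a P) (sel b Q) (sel c R)))"

definition ext4 :: "('e \<Rightarrow> 'e \<Rightarrow> 'e \<Rightarrow> 'e \<Rightarrow> real) \<Rightarrow>
    'e \<times> 'e \<Rightarrow> 'e \<times> 'e \<Rightarrow> 'e \<times> 'e \<Rightarrow> 'e \<times> 'e \<Rightarrow> complex" where
  "ext4 T P Q R S = (\<Sum>a<2. \<Sum>b<2. \<Sum>c<2. \<Sum>d<2. \<i> ^ (a + b + c + d) *
     complex_of_real (T (sel a P) (sel b Q) (sel c R) (sel d S)))"

lemma sum_lessThan_2: "(\<Sum>a<2. f a) = f 0 + f (1::nat)"
  by (simp add: numeral_2_eq_2)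

text \<open>A term with k imaginary entries carries the factor i^k: even k contributes to the real
  part, odd k to the imaginary part.\<close>

lemma ext4_eq:
  "ext4 T (x, x') (y, y') (z, z') (w, w') =
     Complex (T x y z w - T x' y' z w - T x' y z' w - T x' y z w' - T x y' z' w - T x y' z w'
        - T x y z' w' + T x' y' z' w')
      (T x' y z w + T x y' z w + T x y z' w + T x y z w'
        - T x' y' z' w - T x' y' z w' - T x' y z' w' - T x y' z' w')"
  unfolding ext4_def sum_lessThan_2 sel_def
  by (simp add: complex_eq_iff eval_nat_numeral)

lemma ext3_eq:
  "ext3 T (x, x') (y, y') (z, z') =
     Complex (T x y z - T x' y' z - T x' y z' - T x y' z')
       (T x' y z + T x y' z + T x y z' - T x' y' z')"
  unfolding ext3_def sum_lessThan_2 sel_def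
  by (simp add: complex_eq_iff eval_nat_numeral)

text \<open>The finite-dimensional model of the Lie algebra. The form \<open>h\<close> is the
  invariant metric at the unit, whereas the Euclidean product of the type only supplies
  coordinates.\<close>

locale metric_complex_lie_algebra =
  fixes c :: "'e::euclidean_space \<Rightarrow> 'e \<Rightarrow> 'e" and J :: "'e \<Rightarrow> 'e" and h :: "'e \<Rightarrow> 'e \<Rightarrow> real"
  assumes c_bilinear: "bilinear c"
    and c_skew: "c x y = - c y x"
    and jacobi: "c x (c y z) = c (c x y) z + c y (c x z)"
    and J_linear: "linear J"
    and J_J [simp]: "J (J x) = - x"
    and c_J [simp]: "c (J x) y = J (c x y)"
    and h_bilinear: "bilinear h"
    and h_sym: "h x y = h y x"
    and h_pos: "x \<noteq> 0 \<Longrightarrow> h x x > 0"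
    and h_J_J [simp]: "h (J x) (J y) = h x y"
begin

lemmas c_simps [simp] = bilinear_ladd[OF c_bilinear] bilinear_radd[OF c_bilinear]
  bilinear_lsub[OF c_bilinear] bilinear_rsub[OF c_bilinear]
  bilinear_lneg[OF c_bilinear] bilinear_rneg[OF c_bilinear]
  bilinear_lmul[OF c_bilinear] bilinear_rmul[OF c_bilinear]
  bilinear_lzero[OF c_bilinear] bilinear_rzero[OF c_bilinear]

lemmas h_simps [simp] = bilinear_ladd[OF h_bilinear] bilinear_radd[OF h_bilinear]
  bilinear_lsub[OF h_bilinear] bilinear_rsub[OF h_bilinear]
  bilinear_lneg[OF h_bilinear] bilinear_rneg[OF h_bilinear]
  bilinear_lmul[OF h_bilinear] bilinear_rmul[OF h_bilinear]
  bilinear_lzero[OF h_bilinear] bilinear_rzero[OF h_bilinear]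

lemmas J_simps [simp] = linear_add[OF J_linear] linear_diff[OF J_linear]
  linear_neg[OF J_linear] linear_cmul[OF J_linear] linear_0[OF J_linear]

lemma c_J' [simp]: "c x (J y) = J (c x y)"
  by (metis c_J c_skew linear_neg[OF J_linear])

lemma h_J_left: "h (J x) y = - h x (J y)"
  using h_J_J[of "J x" y] by simp

lemma h_eqI: "(\<And>z. h x z = h y z) \<Longrightarrow> x = y"
  using h_pos[of "x - y"] by force

text \<open>\<open>adj x\<close> is the \<open>h\<close>-adjoint of \<open>c x\<close>, that is of
  ad(\<open>x\<close>). With it the Koszul formula, normally tested against a third vector, becomes
  an equation between vectors.\<close>

definition adj :: "'e \<Rightarrow> 'e \<Rightarrow> 'e" where
  "adj x y = (SOME w. \<forall>z. h w z = h y (c x z))"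

lemma h_adj: "h (adj x y) z = h y (c x z)"
proof -
  have "linear (\<lambda>z. h y (c x z))" by (rule linearI) auto
  then have "\<exists>w. \<forall>z. h w z = h y (c x z)"
    using bilinear_form_representation[OF h_bilinear h_pos] by blast
  from someI_ex[OF this] show ?thesis unfolding adj_def by blast
qed

lemma adj_bilinear: "bilinear adj"
  unfolding bilinear_def by (auto intro!: linearI h_eqI simp: h_adj)

lemmas adj_simps [simp] = bilinear_ladd[OF adj_bilinear] bilinear_radd[OF adj_bilinear]
  bilinear_lsub[OF adj_bilinear] bilinear_rsub[OF adj_bilinear]
  bilinear_lneg[OF adj_bilinear] bilinear_rneg[OF adj_bilinear]
  bilinear_lmul[OF adj_bilinear] bilinear_rmul[OF adj_bilinear]

text \<open>\<open>J\<close> is \<open>h\<close>-skew and \<open>c x\<close> commutes with it, so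
  taking adjoints is conjugate linear in \<open>x\<close> while each adjoint stays complex linear.
  On complexified vectors this makes \<open>adj\<close> vanish on two arguments of type
  (1,0).\<close>

lemma adj_J [simp]: "adj (J x) y = - J (adj x y)"
  by (rule h_eqI) (simp add: h_adj h_J_left)

lemma adj_J' [simp]: "adj x (J y) = J (adj x y)"
  by (rule h_eqI) (simp add: h_adj h_J_left)

text \<open>The Levi-Civita connection on left-invariant fields, given by the Koszul formula.\<close>

definition gam :: "'e \<Rightarrow> 'e \<Rightarrow> 'e" where
  "gam x y = (1/2) *\<^sub>R (c x y - adj y x - adj x y)"

lemma gam_bilinear: "bilinear gam"
  unfolding bilinear_def gam_def by (auto intro!: linearI simp: algebra_simps)

lemma gam_skew: "h (gam x y) z = - h y (gam x z)"
proof -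
  have "h y (adj z x) = h x (c z y)" "h y (adj x z) = h z (c x y)"
    by (metis h_adj h_sym)+
  moreover have "h x (c z y) = - h x (c y z)" by (subst c_skew) simp
  ultimately show ?thesis using h_sym[of "c x y" z] by (simp add: gam_def h_adj field_simps)
qed

lemma gam_torsion_free: "gam x y - gam y x = c x y"
proof -
  have "gam x y - gam y x = (1/2) *\<^sub>R (c x y - c y x)"
    by (simp add: gam_def algebra_simps)
  also have "c x y - c y x = 2 *\<^sub>R c x y" by (subst (2) c_skew) (simp add: scaleR_2)
  finally show ?thesis by simp
qed

text \<open>The difference \<open>T\<close> of two candidates is symmetric in its two arguments, and
  \<open>h (T x y) z\<close> is skew in \<open>y\<close> and \<open>z\<close>; alternating the two
  rules, three times each, returns to the start with the sign changed.\<close>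

lemma gam_unique:
  assumes skew: "\<And>x y z. h (S x y) z + h y (S x z) = 0"
    and tors: "\<And>x y. S x y - S y x = c x y"
  shows "S x y = gam x y"
proof -
  define T where "T x y = S x y - gam x y" for x y
  have T: "T x y = T y x" "h (T x y) z = - h (T x z) y" for x y z
  proof -
    show "T x y = T y x" unfolding T_def using tors[of x y] gam_torsion_free[of x y]
      by (metis diff_eq_eq diff_add_eq diff_diff_eq2 add.commute)
    show "h (T x y) z = - h (T x z) y"
      using skew[of x y z] gam_skew[of x y z] h_sym[of y "S x z"] h_sym[of y "gam x z"]
      by (simp add: T_def)
  qed
  have "h (T x y) z = - h (T x y) z" for z
    by (metis T minus_minus)
  then have "h (T x y) z = h 0 z" for z by (smt (verit) h_simps(9))
  then have "T x y = 0" by (rule h_eqI)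
  then show ?thesis by (simp add: T_def)
qed

section \<open>The curvature of a left-invariant metric\<close>

definition curv :: "'e \<Rightarrow> 'e \<Rightarrow> 'e \<Rightarrow> 'e \<Rightarrow> real" where
  "curv x y z w = h (gam x (gam y z) - gam y (gam x z) - gam (c x y) z) w"

text \<open>\<open>gam_skew\<close> moves the outer \<open>gam\<close> onto \<open>w\<close>, so
  that no adjoint is nested in another; the factor 4 clears the halves in
  \<open>gam\<close>.\<close>

lemma curv_eq:
  "4 * curv x y z w =
     h (c x z - adj z x - adj x z) (c y w - adj w y - adj y w)
   - h (c y z - adj z y - adj y z) (c x w - adj w x - adj x w)
   - 2 * h (c (c x y) z - adj z (c x y) - adj (c x y) z) w"
proof -
  have "curv x y z w = h (gam x z) (gam y w) - h (gam y z) (gam x w) - h (gam (c x y) z) w"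
    by (simp add: curv_def gam_skew)
  then show ?thesis by (simp add: gam_def algebra_simps)
qed

text \<open>The pair \<open>(x, - J x)\<close> is the general vector of type (1,0). The complexified
  \<open>adj\<close> vanishes on two such vectors, so \<open>gam\<close> takes them to half their
  bracket, again of type (1,0), and \<open>h\<close> vanishes on pairs of type (1,0). The proof
  carries out this cancellation on the real terms.\<close>

lemma curv_ext4_10:
  "ext4 curv (x, - J x) (y, - J y) (z, - J z) (w, - J w) = 0"
proof -
  have "4 * Re (ext4 curv (x, - J x) (y, - J y) (z, - J z) (w, - J w)) = 0"
    unfolding ext4_eq by (simp only: complex.sel ring_distribs curv_eq) (simp add: h_adj h_J_left)
  moreover have "4 * Im (ext4 curv (x, - J x) (y, - J y) (z, - J z) (w, - J w)) = 0"
    unfolding ext4_eq by (simp only: complex.sel ring_distribs curv_eq) (simp add: h_adj h_J_left)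
  ultimately show ?thesis by (simp add: complex_eq_iff)
qed

text \<open>Together with \<open>h_c_J_adj\<close> this brings every pairing of a bracket with an
  adjoint into one form, a left-nested bracket against a single vector, in which terms can
  cancel.\<close>

lemma h_c_adj: "h (c x y) (adj z w) = - h w (c (c x y) z)"
  using c_skew[of z "c x y"] by (simp add: h_sym[of "c x y"] h_adj)

lemma h_c_J_adj: "h (c x y) (J (adj z w)) = h w (J (c (c x y) z))"
  using h_c_adj[of "J x" y z w] by (simp add: h_J_left)

text \<open>Write W, Z2, Z3, Z4 for the four arguments; W is of type (0,1), so its brackets with the
  others vanish. What survives is -1/4 times the pairing of W with [Z3,[Z2,Z4]] + [[Z2,Z3],Z4],
  which the Jacobi identity merges into [Z2,[Z3,Z4]]. With v = \<open>c y (c z w)\<close> this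
  bracket is 4 (v - i J v), and pairing it with x + i J x contributes another 2, whence the constant
  - 2.\<close>

lemma curv_ext4_01:
  "ext4 curv (x, J x) (y, - J y) (z, - J z) (w, - J w) =
    Complex (- 2 * h x (c y (c z w))) (- 2 * h (J x) (c y (c z w)))"
proof -
  have "4 * Re (ext4 curv (x, J x) (y, - J y) (z, - J z) (w, - J w)) = - 8 * h x (c y (c z w))"
    unfolding ext4_eq jacobi[of y z w]
    by (simp only: complex.sel ring_distribs curv_eq) (simp add: h_adj h_J_left h_c_adj h_c_J_adj)
  moreover have "4 * Im (ext4 curv (x, J x) (y, - J y) (z, - J z) (w, - J w)) =
      - 8 * h (J x) (c y (c z w))"
    unfolding ext4_eq jacobi[of y z w]
    by (simp only: complex.sel ring_distribs curv_eq) (simp add: h_adj h_J_left h_c_adj h_c_J_adj)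
  ultimately show ?thesis by (simp add: complex_eq_iff)
qed


text \<open>Rigidity of the Chern connection: the difference of two of them is a tensor \<open>S\<close> that is
  \<open>I\<close>-linear and \<open>h\<close>-skew in its second argument; vanishing of the \<open>(1,1)\<close>-part of the torsion
  makes it \<open>I\<close>-linear in its first argument as well, and then it is zero.\<close>

lemma chern_rigidity:
  assumes I: "\<And>x. I (I x) = - x" "\<And>x y. h (I x) (I y) = h x y"
    and S: "bilinear S" "\<And>x y z. h (S x y) z + h y (S x z) = 0" "\<And>x y. S x (I y) = I (S x y)"
    and lin: "linear I"
    and tors: "\<And>x y. S x y - S y x + (S (I x) (I y) - S (I y) (I x)) = 0"
      "\<And>x y. S x (I y) - S (I y) x - (S (I x) y - S y (I x)) = 0"
  shows "S x y = 0"
proof -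
  note [simp] = I S(3) linear_add[OF lin] linear_diff[OF lin] linear_neg[OF lin]
    bilinear_lneg[OF S(1)] bilinear_rneg[OF S(1)]
  have hI: "h (I x) y = - h x (I y)" for x y using I(2)[of "I x" y] by simp
  \<comment> \<open>\<open>Q\<close> is twice the part of \<open>S\<close> that is conjugate linear
    in the first slot. It is linear in the second slot and symmetric by \<open>tors(1)\<close>,
    which forces it to vanish.\<close>
  define Q where "Q x y = S x y + I (S (I x) y)" for x y
  have sym: "Q x y = Q y x" for x y
    using tors(1)[of x y] by (simp add: Q_def algebra_simps)
  have "Q (I x) y = - I (Q x y)" "Q x (I y) = I (Q x y)" for x y
    by (simp_all add: Q_def)
  then have "I (Q x y) = - I (Q x y)" for x y
    using sym by metis
  then have "2 *\<^sub>R I (Q x y) = 0" for x y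
    by (metis scaleR_2 add.right_inverse)
  then have "I (I (Q x y)) = 0" for x y
    using linear_0[OF lin] by simp
  then have "I (S (I x) y) = - S x y" for x y
    by (simp add: Q_def eq_neg_iff_add_eq_0 add.commute)
  then have SI: "S (I x) y = I (S x y)" for x y
    by (metis I(1) linear_neg[OF lin] minus_minus)
  \<comment> \<open>By linearity in the first slot, skew-symmetry at \<open>I x\<close> gives a
    relation that differs by a sign from skew-symmetry at \<open>x\<close> with \<open>I z\<close>
    in place of \<open>z\<close>; both together make the pairing vanish.\<close>
  have "h (S (I x) y) z + h y (S (I x) z) = 0" for z
    by (rule S(2))
  then have "h y (S x (I z)) = h (S x y) (I z)" for z
    by (simp add: SI hI)
  then have "h (S x y) (I z) = 0" for z
    using S(2)[of x y "I z"] by simp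
  from this[of "- I (S x y)"] have "h (S x y) (S x y) = 0" by simp
  then show ?thesis using h_pos by force
qed

section \<open>The centre, its orthogonal projection and the structure
  \<open>J\<^sup>-\<close>\<close>

definition centre :: "'e set" where
  "centre = {x. \<forall>y. c x y = 0}"

lemma subspace_centre: "subspace centre"
  by (auto simp: subspace_def centre_def)

definition cproj :: "'e \<Rightarrow> 'e" where
  "cproj x = (SOME s. s \<in> centre \<and> (\<forall>t\<in>centre. h t (x - s) = 0))"

lemma cproj: "cproj x \<in> centre" "t \<in> centre \<Longrightarrow> h t (x - cproj x) = 0"
proof -
  have "\<exists>s. s \<in> centre \<and> (\<forall>t\<in>centre. h t (x - s) = 0)"
    using bilinear_form_orthogonal_decomposition[OF h_bilinear h_pos subspace_centre] by blast
  from someI_ex[OF this] show "cproj x \<in> centre" "t \<in> centre \<Longrightarrow> h t (x - cproj x) = 0"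
    unfolding cproj_def by blast+
qed

lemma cproj_unique:
  assumes "s \<in> centre" "\<And>t. t \<in> centre \<Longrightarrow> h t (x - s) = 0"
  shows "cproj x = s"
proof -
  have "cproj x - s \<in> centre" using assms(1) cproj(1) subspace_centre subspace_diff by blast
  then have "h (cproj x - s) (x - s - (x - cproj x)) = 0"
    using assms(2) cproj(2) by (metis diff_0_right h_simps(4))
  then show ?thesis using h_pos[of "cproj x - s"] by force
qed

lemma J_centre: "x \<in> centre \<Longrightarrow> J x \<in> centre"
  by (simp add: centre_def)

lemma cproj_linear: "linear cproj"
proof (rule linearI)
  show "cproj (x + y) = cproj x + cproj y" for x y
  proof (rule cproj_unique)
    show "cproj x + cproj y \<in> centre" using cproj(1) subspace_add subspace_centre by blast
    show "h t (x + y - (cproj x + cproj y)) = 0" if "t \<in> centre" for t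
      using cproj(2)[OF that, of x] cproj(2)[OF that, of y] by simp
  qed
  show "cproj (r *\<^sub>R x) = r *\<^sub>R cproj x" for r x
  proof (rule cproj_unique)
    show "r *\<^sub>R cproj x \<in> centre" using cproj(1) subspace_scale subspace_centre by blast
    show "h t (r *\<^sub>R x - r *\<^sub>R cproj x) = 0" if "t \<in> centre" for t
      using cproj(2)[OF that, of x] by simp
  qed
qed

text \<open>The centre is \<open>J\<close>-stable and \<open>J\<close> is an isometry, so the
  orthogonal complement is \<open>J\<close>-stable too.\<close>

lemma cproj_J: "cproj (J x) = J (cproj x)"
proof (rule cproj_unique)
  show "J (cproj x) \<in> centre" using cproj(1) J_centre by blast
  show "h t (J x - J (cproj x)) = 0" if "t \<in> centre" for t
    using cproj(2)[OF J_centre[OF that], of x] by (simp add: h_J_left)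
qed

lemma cproj_centre: "x \<in> centre \<Longrightarrow> cproj x = x"
  by (rule cproj_unique) auto

lemma cproj_cproj: "cproj (cproj x) = cproj x"
  by (simp add: cproj_centre cproj(1))

lemma c_cproj [simp]: "c (cproj x) y = 0"
  using cproj(1) by (simp add: centre_def)

lemma h_cproj_left: "h (cproj x) y = h (cproj x) (cproj y)"
  using cproj(2)[OF cproj(1), of x y] by simp

text \<open>\<open>J\<^sup>-\<close> as a single formula, which spares the case distinction between
  the centre and its complement.\<close>

definition Kminus :: "'e \<Rightarrow> 'e" where
  "Kminus x = J (cproj x) - J (x - cproj x)"

lemma Kminus_linear: "linear Kminus"
  unfolding Kminus_def
  by (rule linearI) (simp_all add: linear_add[OF cproj_linear] linear_cmul[OF cproj_linear] algebra_simps)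

lemma cproj_Kminus: "cproj (Kminus x) = J (cproj x)"
  by (simp add: Kminus_def cproj_cproj cproj_J linear_diff[OF cproj_linear]
      flip: linear_diff[OF J_linear])

lemma Kminus_Kminus: "Kminus (Kminus x) = - x"
proof -
  have "Kminus (Kminus x) = J (cproj (Kminus x)) - J (Kminus x - cproj (Kminus x))"
    by (rule Kminus_def)
  then show ?thesis unfolding cproj_Kminus by (simp add: Kminus_def)
qed

lemma Kminus_isometric: "h (Kminus x) (Kminus y) = h x y"
proof -
  have "h (cproj x) y = h (cproj x) (cproj y)" "h x (cproj y) = h (cproj x) (cproj y)"
    using h_cproj_left h_sym by metis+
  then show ?thesis by (simp add: Kminus_def)
qed

text \<open>A bracket does not see the central component, and on the complement
  \<open>Kminus\<close> is \<open>- J\<close>. So modulo the centre the types for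
  \<open>Kminus\<close> are opposite to those for \<open>J\<close>.\<close>

lemma c_Kminus: "c (Kminus x) y = - J (c x y)"
  by (simp add: Kminus_def)

lemma c_Kminus': "c x (Kminus y) = - J (c x y)"
  using c_Kminus[of y x] c_skew by (metis J_simps(3))

text \<open>The exterior derivative of the form \<open>h(x, K y)\<close> on left-invariant fields, where no derivatives occur.\<close>

definition dform :: "('e \<Rightarrow> 'e) \<Rightarrow> 'e \<Rightarrow> 'e \<Rightarrow> 'e \<Rightarrow> real" where
  "dform K x y z = - h (c x y) (K z) + h (c x z) (K y) - h (c y z) (K x)"

text \<open>Modulo the centre the first argument is of type (0,1) and the other two are of type
  (1,0) for \<open>J\<close>, so the mixed brackets vanish and only the term with
  \<open>c y z\<close> survives. \<open>J\<close> and \<open>Kminus\<close> agree on the centre,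
  which makes the central component of \<open>x\<close> drop out.\<close>

lemma dform_ext3:
  "ext3 (dform Kminus) (x, - Kminus x) (y, Kminus y) (z, Kminus z) =
     Complex (4 * h (c y z) (J (x - cproj x))) (- 4 * h (J (c y z)) (J (x - cproj x)))"
  using Kminus_linear
  by (simp add: ext3_eq dform_def c_Kminus c_Kminus' Kminus_Kminus linear_neg h_J_left complex_eq_iff)
    (simp add: Kminus_def h_J_left)

lemma dform_ext3_zero_iff:
  "(\<forall>x y z. ext3 (dform Kminus) (x, - Kminus x) (y, Kminus y) (z, Kminus z) = 0) \<longleftrightarrow>
    (\<forall>x y z. c x (c y z) = 0)"
proof (intro iffI allI)
  fix x y z assume *: "\<forall>x y z. ext3 (dform Kminus) (x, - Kminus x) (y, Kminus y) (z, Kminus z) = 0"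
  define b where "b = c y z"
  \<comment> \<open>The test vector \<open>- J (b - cproj b)\<close> is orthogonal to the centre and
    \<open>J\<close> sends it to \<open>b - cproj b\<close>, so the real part in
    \<open>dform_ext3\<close> becomes a multiple of the squared norm of
    \<open>b - cproj b\<close>.\<close>
  have "cproj (- J (b - cproj b)) = 0"
    by (simp add: linear_neg[OF cproj_linear] linear_diff[OF cproj_linear] cproj_J cproj_cproj)
  then have "h b (b - cproj b) = 0"
    using *[rule_format, of "- J (b - cproj b)" y z]
    by (simp add: dform_ext3 complex_eq_iff b_def[symmetric] del: h_simps)
  then have "h (b - cproj b) (b - cproj b) = 0"
    using cproj(2)[OF cproj(1), of b b] by simp
  then have "b = cproj b" using h_pos[of "b - cproj b"] by force
  then have "b \<in> centre" using cproj(1) by metis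
  then show "c x (c y z) = 0" using c_skew[of x b] by (simp add: b_def centre_def)
next
  fix x y z assume *: "\<forall>x y z. c x (c y z) = 0"
  then have "c y z \<in> centre" by (simp add: centre_def c_skew[of "c y z"])
  then have "J (c y z) \<in> centre" "J (J (c y z)) \<in> centre" using J_centre by blast+
  from this[THEN cproj(2), of x] show "ext3 (dform Kminus) (x, - Kminus x) (y, Kminus y) (z, Kminus z) = 0"
    by (simp add: dform_ext3 complex_eq_iff h_J_left)
qed

lemma curv_ext4_zero_iff:
  "(\<forall>x y z w. ext4 curv (x, J x) (y, - J y) (z, - J z) (w, - J w) = 0) \<longleftrightarrow>
    (\<forall>x y z. c x (c y z) = 0)"
proof (intro iffI allI)
  fix y z w assume *: "\<forall>x y z w. ext4 curv (x, J x) (y, - J y) (z, - J z) (w, - J w) = 0"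
  \<comment> \<open>The first argument is chosen to be the double bracket itself, so the real part
    is - 2 times its squared norm.\<close>
  have "h (c y (c z w)) (c y (c z w)) = 0"
    using *[rule_format, of "c y (c z w)" y z w] by (simp add: curv_ext4_01 complex_eq_iff)
  then show "c y (c z w) = 0" using h_pos by force
qed (simp add: curv_ext4_01 complex_eq_iff)

end

section \<open>Manifolds with a global frame of constant structure coefficients\<close>

text \<open>\<open>germ_chart\<close> says that smoothness of a germ does not depend on the chart.
  It stands in for compatibility of transition maps, and can be verified for the quotient atlas
  without computing any.\<close>

locale smooth_charts =
  fixes A :: "('p, 'e::euclidean_space) chart set"
  assumes chart_open: "(U, \<phi>) \<in> A \<Longrightarrow> open (\<phi> ` U)"
    and chart_inj: "(U, \<phi>) \<in> A \<Longrightarrow> inj_on \<phi> U"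
    and germ_chart: "(U, \<phi>) \<in> A \<Longrightarrow> p \<in> U \<Longrightarrow> f \<in> germs A p \<Longrightarrow>
      \<exists>N. open N \<and> \<phi> p \<in> N \<and> N \<subseteq> \<phi> ` U \<and> smooth_on N (f \<circ> inv_into U \<phi>)"
begin

section \<open>Germs and smooth functions\<close>

lemma germsI:
  "(U, \<phi>) \<in> A \<Longrightarrow> p \<in> U \<Longrightarrow> open N \<Longrightarrow> \<phi> p \<in> N \<Longrightarrow> N \<subseteq> \<phi> ` U \<Longrightarrow>
    smooth_on N (f \<circ> inv_into U \<phi>) \<Longrightarrow> f \<in> germs A p"
  by (auto simp: germs_def)

lemma pts_chart: "p \<in> pts A \<Longrightarrow> \<exists>U \<phi>. (U, \<phi>) \<in> A \<and> p \<in> U"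
  by (auto simp: pts_def)

lemma chart_pts: "(U, \<phi>) \<in> A \<Longrightarrow> U \<subseteq> pts A"
  by (auto simp: pts_def)

lemma germs_pts: "f \<in> germs A p \<Longrightarrow> p \<in> pts A"
  by (auto simp: germs_def pts_def)

lemma germs_const: "p \<in> pts A \<Longrightarrow> (\<lambda>q. r) \<in> germs A p"
  using pts_chart[of p] by (force intro!: germsI[OF _ _ chart_open] simp: o_def smooth_on_const)

lemma germs_two:
  assumes "f \<in> germs A p" "g \<in> germs A p"
  obtains U \<phi> N where "(U, \<phi>) \<in> A" "p \<in> U" "open N" "\<phi> p \<in> N" "N \<subseteq> \<phi> ` U"
    "smooth_on N (f \<circ> inv_into U \<phi>)" "smooth_on N (g \<circ> inv_into U \<phi>)"
proof -
  obtain U \<phi> where c: "(U, \<phi>) \<in> A" "p \<in> U" using assms germs_pts pts_chart by blast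
  obtain N where N: "open N \<and> \<phi> p \<in> N \<and> N \<subseteq> \<phi> ` U \<and> smooth_on N (f \<circ> inv_into U \<phi>)"
    using germ_chart[OF c assms(1)] by blast
  obtain N' where N': "open N' \<and> \<phi> p \<in> N' \<and> N' \<subseteq> \<phi> ` U \<and> smooth_on N' (g \<circ> inv_into U \<phi>)"
    using germ_chart[OF c assms(2)] by blast
  show thesis
    by (rule that[OF c, of "N \<inter> N'"]) (use N N' smooth_on_subset in \<open>auto intro: smooth_on_subset\<close>)
qed

lemma germs_add: "f \<in> germs A p \<Longrightarrow> g \<in> germs A p \<Longrightarrow> (\<lambda>q. f q + g q) \<in> germs A p"
  by (erule (1) germs_two, rule germsI) (auto simp: o_def intro: smooth_on_add)

lemma germs_mult: "f \<in> germs A p \<Longrightarrow> g \<in> germs A p \<Longrightarrow> (\<lambda>q. f q * g q) \<in> germs A p"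
  by (erule (1) germs_two, rule germsI)
    (auto simp: o_def intro: smooth_on_bilinear[OF _ bounded_bilinear_mult])

lemma germs_cmult: "f \<in> germs A p \<Longrightarrow> (\<lambda>q. r * f q) \<in> germs A p"
  using germs_mult[OF germs_const] germs_pts by blast

lemma germs_sum: "p \<in> pts A \<Longrightarrow> (\<And>i. i \<in> I \<Longrightarrow> f i \<in> germs A p) \<Longrightarrow> (\<lambda>q. \<Sum>i\<in>I. f i q) \<in> germs A p"
  by (induction I rule: infinite_finite_induct) (auto simp: germs_const intro: germs_add)

lemma germs_cong:
  assumes "f \<in> germs A p" "\<And>q. q \<in> pts A \<Longrightarrow> f q = g q"
  shows "g \<in> germs A p"
proof -
  obtain U \<phi> N where c: "(U, \<phi>) \<in> A" "p \<in> U" "open N" "\<phi> p \<in> N" "N \<subseteq> \<phi> ` U"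
    "smooth_on N (f \<circ> inv_into U \<phi>)" using germs_two[OF assms(1) assms(1)] by metis
  have "inv_into U \<phi> x \<in> pts A" if "x \<in> N" for x
    using that c(5) chart_pts[OF c(1)] inv_into_into by (metis subsetD)
  then have "smooth_on N (g \<circ> inv_into U \<phi>)"
    by (intro smooth_on_cong[OF c(3) _ c(6)]) (auto simp: assms(2))
  then show ?thesis using c germsI by blast
qed

lemma smooth_funs_germs: "f \<in> smooth_funs A \<Longrightarrow> p \<in> pts A \<Longrightarrow> f \<in> germs A p"
  by (simp add: smooth_funs_def)

lemma smooth_funs_const: "(\<lambda>q. r) \<in> smooth_funs A"
  by (simp add: smooth_funs_def germs_const)

lemma smooth_funs_add: "f \<in> smooth_funs A \<Longrightarrow> g \<in> smooth_funs A \<Longrightarrow> (\<lambda>q. f q + g q) \<in> smooth_funs A"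
  by (simp add: smooth_funs_def germs_add)

lemma smooth_funs_mult: "f \<in> smooth_funs A \<Longrightarrow> g \<in> smooth_funs A \<Longrightarrow> (\<lambda>q. f q * g q) \<in> smooth_funs A"
  by (simp add: smooth_funs_def germs_mult)

lemma smooth_funs_sum: "(\<And>i. i \<in> I \<Longrightarrow> f i \<in> smooth_funs A) \<Longrightarrow> (\<lambda>q. \<Sum>i\<in>I. f i q) \<in> smooth_funs A"
  by (simp add: smooth_funs_def germs_sum)

section \<open>Tangent vectors as derivations of germs\<close>

lemma tangent_spaceE:
  assumes "v \<in> tangent_space A p"
  obtains \<iota> :: "'e \<Rightarrow> 'p" and x u where "\<iota> x = p"
    "\<And>f. f \<in> germs A p \<Longrightarrow> (f \<circ> \<iota>) differentiable (at x)"
    "\<And>f. f \<in> germs A p \<Longrightarrow> v f = der (f \<circ> \<iota>) x u"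
    "\<And>f. f \<notin> germs A p \<Longrightarrow> v f = 0" "p \<in> pts A"
proof -
  obtain U \<phi> u where c: "(U, \<phi>) \<in> A" "p \<in> U" "v = coord_vec A (U, \<phi>) p u"
    using assms by (auto simp: tangent_space_def)
  have "(f \<circ> inv_into U \<phi>) differentiable (at (\<phi> p))" if f: "f \<in> germs A p" for f
    using germ_chart[OF c(1,2) f] smooth_on_differentiable by blast
  moreover have "inv_into U \<phi> (\<phi> p) = p" using chart_inj[OF c(1)] c(2) by simp
  ultimately show thesis
    using c chart_pts[OF c(1)] by (intro that[of "inv_into U \<phi>" "\<phi> p" u]) (auto simp: coord_vec_def)
qed

lemma tangent_add:
  assumes "v \<in> tangent_space A p" "f \<in> germs A p" "g \<in> germs A p"
  shows "v (\<lambda>q. f q + g q) = v f + v g"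
proof -
  obtain \<iota> :: "'e \<Rightarrow> 'p" and x u where *: "\<iota> x = p"
    "\<And>f. f \<in> germs A p \<Longrightarrow> (f \<circ> \<iota>) differentiable (at x)"
    "\<And>f. f \<in> germs A p \<Longrightarrow> v f = der (f \<circ> \<iota>) x u"
    using tangent_spaceE[OF assms(1)] by metis
  have "((\<lambda>q. f q + g q) \<circ> \<iota> has_derivative
     (\<lambda>u. der (f \<circ> \<iota>) x u + der (g \<circ> \<iota>) x u)) (at x)"
    unfolding o_def by (intro has_derivative_add)
      (use *(2)[OF assms(2)] *(2)[OF assms(3)] in \<open>auto simp: frechet_derivative_works o_def\<close>)
  then show ?thesis
    by (simp add: *(3) germs_add assms frechet_derivative_eqI)
qed

lemma tangent_mult:
  assumes "v \<in> tangent_space A p" "f \<in> germs A p" "g \<in> germs A p"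
  shows "v (\<lambda>q. f q * g q) = v f * g p + f p * v g"
proof -
  obtain \<iota> :: "'e \<Rightarrow> 'p" and x u where *: "\<iota> x = p"
    "\<And>f. f \<in> germs A p \<Longrightarrow> (f \<circ> \<iota>) differentiable (at x)"
    "\<And>f. f \<in> germs A p \<Longrightarrow> v f = der (f \<circ> \<iota>) x u"
    using tangent_spaceE[OF assms(1)] by metis
  have "((\<lambda>q. f q * g q) \<circ> \<iota> has_derivative
     (\<lambda>u. (f \<circ> \<iota>) x * der (g \<circ> \<iota>) x u + der (f \<circ> \<iota>) x u * (g \<circ> \<iota>) x)) (at x)"
    using has_derivative_mult[OF *(2)[OF assms(2), unfolded frechet_derivative_works]
       *(2)[OF assms(3), unfolded frechet_derivative_works]]
    by (simp add: o_def)
  then show ?thesis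
    by (simp add: *(1,3) germs_mult assms frechet_derivative_eqI)
qed

lemma tangent_const:
  assumes "v \<in> tangent_space A p"
  shows "v (\<lambda>q. r) = 0"
proof -
  obtain \<iota> :: "'e \<Rightarrow> 'p" and x u where *: "p \<in> pts A"
    "\<And>f. f \<in> germs A p \<Longrightarrow> v f = der (f \<circ> \<iota>) x u"
    using tangent_spaceE[OF assms(1)] by metis
  then show ?thesis by (simp add: germs_const o_def)
qed

lemma tangent_cmult:
  assumes "v \<in> tangent_space A p" "f \<in> germs A p"
  shows "v (\<lambda>q. r * f q) = r * v f"
  using tangent_mult[OF assms(1) germs_const assms(2)] germs_pts[OF assms(2)]
  by (simp add: tangent_const[OF assms(1)])

lemma tangent_diff:
  assumes "v \<in> tangent_space A p" "f \<in> germs A p" "g \<in> germs A p"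
  shows "v (\<lambda>q. f q - g q) = v f - v g"
  using tangent_add[OF assms(1,2) germs_cmult[OF assms(3), of "-1"]]
    tangent_cmult[OF assms(1,3), of "-1"] by simp

lemma tangent_sum:
  assumes "v \<in> tangent_space A p" "p \<in> pts A" "\<And>i. i \<in> I \<Longrightarrow> f i \<in> germs A p"
  shows "v (\<lambda>q. \<Sum>i\<in>I. f i q) = (\<Sum>i\<in>I. v (f i))"
  using assms(3)
  by (induction I rule: infinite_finite_induct)
    (auto simp: tangent_const[OF assms(1)] tangent_add[OF assms(1)] germs_sum assms(2))

text \<open>Functions are total on the type, while the formulas in a frame hold at points of
  \<open>pts A\<close> only; this allows such formulas to be substituted under a tangent
  vector.\<close>

lemma tangent_cong:
  assumes v: "v \<in> tangent_space A p" and eq: "\<And>q. q \<in> pts A \<Longrightarrow> f q = g q"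
  shows "v f = v g"
proof (cases "f \<in> germs A p")
  case True
  have g: "g \<in> germs A p" using True eq by (rule germs_cong)
  have "v (\<lambda>q. f q - g q) = 0"
  proof -
    obtain U \<phi> u where c: "(U, \<phi>) \<in> A" "p \<in> U" "v = coord_vec A (U, \<phi>) p u"
      using v by (auto simp: tangent_space_def)
    have "der ((\<lambda>q. f q - g q) \<circ> inv_into U \<phi>) (\<phi> p) =
        der (\<lambda>x. 0) (\<phi> p)"
    proof (rule sym, rule frechet_derivative_transform_within_open[OF _ chart_open[OF c(1)]])
      show "0 = ((\<lambda>q. f q - g q) \<circ> inv_into U \<phi>) x" if "x \<in> \<phi> ` U" for x
        using eq that chart_pts[OF c(1)] by (auto simp: inv_into_into subset_iff)
    qed (use c in auto)
    then show ?thesis by (simp add: c(3) coord_vec_def)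
  qed
  then show ?thesis using tangent_diff[OF v True g] by simp
next
  case False
  then have "g \<notin> germs A p" using germs_cong[of g p f] eq by auto
  then show ?thesis using False tangent_spaceE[OF v] by metis
qed

lemma vfields_tangent: "X \<in> vfields A \<Longrightarrow> p \<in> pts A \<Longrightarrow> X p \<in> tangent_space A p"
  by (simp add: vfields_def)

lemma vfields_germs: "X \<in> vfields A \<Longrightarrow> f \<in> germs A p \<Longrightarrow> (\<lambda>q. X q f) \<in> germs A p"
  using germs_pts by (auto simp: vfields_def)

lemma vfields_zero: "X \<in> vfields A \<Longrightarrow> p \<notin> pts A \<Longrightarrow> X p f = 0"
  by (simp add: vfields_def)

lemma vfields_not_germ: "X \<in> vfields A \<Longrightarrow> f \<notin> germs A p \<Longrightarrow> X p f = 0"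
  using vfields_zero vfields_tangent tangent_spaceE by metis

lemma vfields_smooth_funs: "X \<in> vfields A \<Longrightarrow> f \<in> smooth_funs A \<Longrightarrow> (\<lambda>q. X q f) \<in> smooth_funs A"
  by (simp add: smooth_funs_def vfields_germs)


text \<open>The type of points carries no topology here, so neighbourhoods are read off from
  charts.\<close>

definition near :: "'p \<Rightarrow> ('p \<Rightarrow> bool) \<Rightarrow> bool" where
  "near p P \<longleftrightarrow> (\<exists>U \<phi> N. (U, \<phi>) \<in> A \<and> p \<in> U \<and> open N \<and> \<phi> p \<in> N \<and> N \<subseteq> \<phi> ` U \<and>
     (\<forall>x\<in>N. P (inv_into U \<phi> x)))"

lemma near_at: "near p P \<Longrightarrow> P p"
  unfolding near_def using chart_inj by (metis inv_into_f_f)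

lemma near_mono: "near p P \<Longrightarrow> (\<And>q. P q \<Longrightarrow> Q q) \<Longrightarrow> near p Q"
  unfolding near_def by blast

lemma near_germs: "f \<in> germs A p \<Longrightarrow> near p (\<lambda>q. f \<in> germs A q)"
proof -
  assume "f \<in> germs A p"
  then obtain U \<phi> N where c: "(U, \<phi>) \<in> A" "p \<in> U" "open N" "\<phi> p \<in> N" "N \<subseteq> \<phi> ` U"
    "smooth_on N (f \<circ> inv_into U \<phi>)" using germs_two by metis
  have "f \<in> germs A (inv_into U \<phi> x)" if "x \<in> N" for x
    using c that by (intro germsI[of U \<phi> _ N]) (auto simp: inv_into_into f_inv_into_f)
  then show ?thesis unfolding near_def using c by blast
qed

lemma germs_cong_near:
  assumes f: "f \<in> germs A p" and eq: "near p (\<lambda>q. f q = g q)"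
  shows "g \<in> germs A p"
proof -
  obtain U \<phi> N where c: "(U, \<phi>) \<in> A" "p \<in> U" "open N" "\<phi> p \<in> N" "N \<subseteq> \<phi> ` U"
    "\<And>x. x \<in> N \<Longrightarrow> f (inv_into U \<phi> x) = g (inv_into U \<phi> x)"
    using eq unfolding near_def by blast
  obtain N' where N': "open N'" "\<phi> p \<in> N'" "N' \<subseteq> \<phi> ` U" "smooth_on N' (f \<circ> inv_into U \<phi>)"
    using germ_chart[OF c(1,2) f] by blast
  have "smooth_on (N \<inter> N') (g \<circ> inv_into U \<phi>)"
    by (rule smooth_on_cong[OF _ _ smooth_on_subset[OF N'(4)]]) (use c N' in auto)
  then show ?thesis using c N' by (intro germsI[of U \<phi> p "N \<inter> N'"]) auto
qed

text \<open>The neighbourhood of agreement may come from another chart than the tangent vector, and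
  no transition map is at hand. Instead both functions are multiplied by the indicator of that
  neighbourhood, and the Leibniz rule compares the products.\<close>

lemma coord_vec_cong_near:
  assumes c: "(U, \<phi>) \<in> A" "p \<in> U" and f: "f \<in> germs A p" and eq: "near p (\<lambda>q. f q = g q)"
  shows "coord_vec A (U, \<phi>) p u f = coord_vec A (U, \<phi>) p u g"
proof -
  have g: "g \<in> germs A p" using germs_cong_near[OF f eq] .
  obtain V \<psi> N where d: "(V, \<psi>) \<in> A" "p \<in> V" "open N" "\<psi> p \<in> N" "N \<subseteq> \<psi> ` V"
    "\<And>x. x \<in> N \<Longrightarrow> f (inv_into V \<psi> x) = g (inv_into V \<psi> x)"
    using eq unfolding near_def by blast
  \<comment> \<open>A germ is constrained near \<open>p\<close> only, so this discontinuous
    indicator is a germ, locally constant 1; it makes the products of \<open>f\<close> and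
    \<open>g\<close> with \<open>ch\<close> equal everywhere.\<close>
  define ch where "ch = (\<lambda>q. if q \<in> V \<and> \<psi> q \<in> N then 1 else (0::real))"
  have ch1: "near p (\<lambda>q. 1 = ch q)"
    unfolding near_def using d chart_inj[OF d(1)]
    by (intro exI[of _ V] exI[of _ \<psi>] exI[of _ N]) (auto simp: ch_def inv_into_into f_inv_into_f)
  have chg: "ch \<in> germs A p"
    by (rule germs_cong_near[OF germs_const ch1]) (use chart_pts[OF c(1)] c(2) in blast)
  have t: "coord_vec A (U, \<phi>) p u \<in> tangent_space A p" (is "?v \<in> _")
    using c by (force simp: tangent_space_def)
  have "(\<lambda>q. f q * ch q) = (\<lambda>q. g q * ch q)"
  proof
    fix q show "f q * ch q = g q * ch q"
      using d(6)[of "\<psi> q"] chart_inj[OF d(1)] by (auto simp: ch_def)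
  qed
  then have "?v f * ch p + f p * ?v ch = ?v g * ch p + g p * ?v ch"
    using tangent_mult[OF t f chg] tangent_mult[OF t g chg] by metis
  moreover have "ch p = 1" "f p = g p"
    using near_at[OF ch1] near_at[OF eq] by auto
  ultimately show ?thesis by simp
qed

lemma tangent_cong_near:
  "v \<in> tangent_space A p \<Longrightarrow> f \<in> germs A p \<Longrightarrow> near p (\<lambda>q. f q = g q) \<Longrightarrow> v f = v g"
  using coord_vec_cong_near by (force simp: tangent_space_def)

end

text \<open>\<open>coefficient_smooth\<close> expresses smoothness of the dual coframe; for the
  quotient it will come from the invariant metric.\<close>

locale framed_manifold = smooth_charts A
  for A :: "('p, 'e::euclidean_space) chart set" +
  fixes E :: "'e \<Rightarrow> 'p field" and c :: "'e \<Rightarrow> 'e \<Rightarrow> 'e"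
  assumes E_field [simp]: "E u \<in> vfields A"
    and E_linear: "p \<in> pts A \<Longrightarrow> linear (\<lambda>u. E u p f)"
    and E_inj: "p \<in> pts A \<Longrightarrow> E u p = E v p \<Longrightarrow> u = v"
    and E_surj: "t \<in> tangent_space A p \<Longrightarrow> p \<in> pts A \<Longrightarrow> \<exists>u. t = E u p"
    and coefficient_smooth: "X \<in> vfields A \<Longrightarrow> (\<And>p. p \<in> pts A \<Longrightarrow> X p = E (x p) p) \<Longrightarrow>
      b \<in> Basis \<Longrightarrow> (\<lambda>p. x p \<bullet> b) \<in> smooth_funs A"
    and E_bracket: "bracket A (E u) (E v) = E (c u v)"
    and c_bilin: "bilinear c"
begin

section \<open>Fields as coefficient functions in the frame\<close>

lemma E_tangent: "p \<in> pts A \<Longrightarrow> E u p \<in> tangent_space A p"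
  using vfields_tangent E_field by blast

lemma E_sum: "p \<in> pts A \<Longrightarrow> E u p f = (\<Sum>b\<in>Basis. (u \<bullet> b) * E b p f)"
  using linear_eq_sum_Basis[where v = u, OF E_linear[where p = p and f = f]] by simp

lemma E_lin [simp]:
  assumes "p \<in> pts A"
  shows "E (u + v) p f = E u p f + E v p f" "E (u - v) p f = E u p f - E v p f"
    "E (- u) p f = - E u p f" "E (r *\<^sub>R u) p f = r * E u p f" "E 0 p f = 0"
  using linear_add[OF E_linear[OF assms, of f], of u v] linear_diff[OF E_linear[OF assms, of f], of u v]
    linear_neg[OF E_linear[OF assms, of f], of u] linear_cmul[OF E_linear[OF assms, of f], of r u]
    linear_0[OF E_linear[OF assms, of f]]
  by simp_all

text \<open>A field is given by its coefficient function in the frame (\<open>cf\<close> and \<open>fld\<close> are mutually inverse),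
  and \<open>dv\<close> differentiates coefficient functions along a tangent vector.\<close>

definition cf :: "'p field \<Rightarrow> 'p \<Rightarrow> 'e" where
  "cf X p = (THE u. X p = E u p)"

definition smooth_coeffs :: "('p \<Rightarrow> 'e) \<Rightarrow> bool" where
  "smooth_coeffs x \<longleftrightarrow> (\<forall>b\<in>Basis. (\<lambda>p. x p \<bullet> b) \<in> smooth_funs A)"

definition fld :: "('p \<Rightarrow> 'e) \<Rightarrow> 'p field" where
  "fld x = (\<lambda>p. if p \<in> pts A then E (x p) p else (\<lambda>f. 0))"

definition dv :: "'p tvec \<Rightarrow> ('p \<Rightarrow> 'e) \<Rightarrow> 'e" where
  "dv v y = (\<Sum>b\<in>Basis. v (\<lambda>q. y q \<bullet> b) *\<^sub>R b)"

lemma dv_inner: "b \<in> Basis \<Longrightarrow> dv v y \<bullet> b = v (\<lambda>q. y q \<bullet> b)"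
  by (simp add: dv_def)

lemma cf_eqI: "p \<in> pts A \<Longrightarrow> X p = E u p \<Longrightarrow> cf X p = u"
  unfolding cf_def by (rule the_equality) (auto dest: E_inj)

lemma E_cf: "X \<in> vfields A \<Longrightarrow> p \<in> pts A \<Longrightarrow> E (cf X p) p = X p"
  using E_surj[OF vfields_tangent] cf_eqI by metis

lemma cf_E [simp]: "p \<in> pts A \<Longrightarrow> cf (E u) p = u"
  by (rule cf_eqI) auto

lemma cf_fld [simp]: "p \<in> pts A \<Longrightarrow> cf (fld x) p = x p"
  by (rule cf_eqI) (auto simp: fld_def)

lemma smooth_coeffs_cf: "X \<in> vfields A \<Longrightarrow> smooth_coeffs (cf X)"
  unfolding smooth_coeffs_def using coefficient_smooth[of X "cf X"] E_cf by simp

lemma fld_cf [simp]: "X \<in> vfields A \<Longrightarrow> fld (cf X) = X"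
  by (auto simp: fld_def fun_eq_iff E_cf vfields_zero)

lemma vfields_eqI:
  assumes "X \<in> vfields A" "Y \<in> vfields A" "\<And>p. p \<in> pts A \<Longrightarrow> cf X p = cf Y p"
  shows "X = Y"
proof -
  have "fld (cf X) = fld (cf Y)" using assms(3) by (auto simp: fld_def)
  then show ?thesis using assms by simp
qed

lemma smooth_coeffs_linear:
  assumes "smooth_coeffs y" "linear T"
  shows "(\<lambda>q. T (y q) :: real) \<in> smooth_funs A"
proof -
  have "(\<lambda>q. \<Sum>b\<in>Basis. (y q \<bullet> b) * T b) \<in> smooth_funs A"
    using assms(1) by (auto simp: smooth_coeffs_def intro!: smooth_funs_sum smooth_funs_mult smooth_funs_const)
  also have "(\<lambda>q. \<Sum>b\<in>Basis. (y q \<bullet> b) * T b) = (\<lambda>q. T (y q))"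
    using linear_eq_sum_Basis[OF assms(2), of "y q" for q] by (intro ext) simp
  finally show ?thesis .
qed

lemma smooth_coeffs_bilinear_form:
  assumes "smooth_coeffs y" "smooth_coeffs z" "bilinear B"
  shows "(\<lambda>q. B (y q) (z q) :: real) \<in> smooth_funs A"
proof -
  have "(\<lambda>q. \<Sum>a\<in>Basis. \<Sum>b\<in>Basis. ((y q \<bullet> a) * (z q \<bullet> b)) * B a b) \<in> smooth_funs A"
    using assms(1,2) by (auto simp: smooth_coeffs_def intro!: smooth_funs_sum smooth_funs_mult smooth_funs_const)
  also have "(\<lambda>q. \<Sum>a\<in>Basis. \<Sum>b\<in>Basis. ((y q \<bullet> a) * (z q \<bullet> b)) * B a b) = (\<lambda>q. B (y q) (z q))"
    using bilinear_eq_sum_Basis[OF assms(3), of "y q" "z q" for q] by (intro ext) simp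
  finally show ?thesis .
qed

lemma smooth_coeffs_const [simp]: "smooth_coeffs (\<lambda>p. u)"
  by (simp add: smooth_coeffs_def smooth_funs_const)

lemma smooth_coeffs_add: "smooth_coeffs x \<Longrightarrow> smooth_coeffs y \<Longrightarrow> smooth_coeffs (\<lambda>p. x p + y p)"
  by (simp add: smooth_coeffs_def inner_add_left smooth_funs_add)

lemma smooth_coeffs_map: "smooth_coeffs x \<Longrightarrow> linear T \<Longrightarrow> smooth_coeffs (\<lambda>p. T (x p))"
  unfolding smooth_coeffs_def
  by (auto intro!: smooth_coeffs_linear[of x "\<lambda>u. T u \<bullet> b" for b, unfolded smooth_coeffs_def] linearI
      simp: linear_add linear_cmul inner_add_left)

lemma smooth_coeffs_bilinear: "smooth_coeffs x \<Longrightarrow> smooth_coeffs y \<Longrightarrow> bilinear B \<Longrightarrow>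
    smooth_coeffs (\<lambda>p. B (x p) (y p))"
  unfolding smooth_coeffs_def[of "\<lambda>p. B (x p) (y p)"]
  using smooth_coeffs_bilinear_form[OF _ _ bilinear_inner] by blast

lemma smooth_coeffs_scale: "a \<in> smooth_funs A \<Longrightarrow> smooth_coeffs x \<Longrightarrow> smooth_coeffs (\<lambda>p. a p *\<^sub>R x p)"
  by (simp add: smooth_coeffs_def smooth_funs_mult)

lemma fld_vfields:
  assumes "smooth_coeffs x"
  shows "fld x \<in> vfields A"
proof -
  have "(\<lambda>q. fld x q f) \<in> germs A p" if p: "p \<in> pts A" and f: "f \<in> germs A p" for p f
  proof (rule germs_cong)
    show "(\<lambda>q. \<Sum>b\<in>Basis. (x q \<bullet> b) * E b q f) \<in> germs A p"
      by (intro germs_sum p germs_mult vfields_germs[OF E_field f] smooth_funs_germs[OF _ p])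
        (use assms in \<open>auto simp: smooth_coeffs_def\<close>)
    show "(\<Sum>b\<in>Basis. (x q \<bullet> b) * E b q f) = fld x q f" if "q \<in> pts A" for q
      using that E_sum[OF that, of "x q" f] by (simp add: fld_def)
  qed
  then show ?thesis using E_tangent by (auto simp: vfields_def fld_def)
qed

lemma dv_linear:
  assumes v: "v \<in> tangent_space A p" "p \<in> pts A" and y: "smooth_coeffs y" and T: "linear T"
  shows "v (\<lambda>q. T (y q)) = T (dv v y)"
proof -
  have g: "(\<lambda>q. y q \<bullet> b) \<in> germs A p" if "b \<in> Basis" for b
    using y that v by (auto simp: smooth_coeffs_def smooth_funs_germs)
  have "v (\<lambda>q. T (y q)) = v (\<lambda>q. \<Sum>b\<in>Basis. T b * (y q \<bullet> b))"
    by (rule arg_cong[of _ _ v], rule ext)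
      (use linear_eq_sum_Basis[OF T, of "y q" for q] in \<open>simp add: mult.commute\<close>)
  also have "\<dots> = (\<Sum>b\<in>Basis. v (\<lambda>q. T b * (y q \<bullet> b)))"
    by (rule tangent_sum[OF v]) (rule germs_cmult[OF g])
  also have "\<dots> = (\<Sum>b\<in>Basis. T b * v (\<lambda>q. y q \<bullet> b))"
    by (rule sum.cong[OF refl]) (rule tangent_cmult[OF v(1) g])
  also have "\<dots> = T (dv v y)"
    using linear_eq_sum_Basis[OF T, of "dv v y"] by (simp add: dv_inner mult.commute)
  finally show ?thesis .
qed

lemma dv_bilinear_form:
  assumes v: "v \<in> tangent_space A p" "p \<in> pts A" and yz: "smooth_coeffs y" "smooth_coeffs z"
    and B: "bilinear B"
  shows "v (\<lambda>q. B (y q) (z q)) = B (dv v y) (z p) + B (y p) (dv v z)"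
proof -
  have g: "(\<lambda>q. y q \<bullet> b) \<in> germs A p" "(\<lambda>q. z q \<bullet> b) \<in> germs A p" if "b \<in> Basis" for b
    using yz that v by (auto simp: smooth_coeffs_def smooth_funs_germs)
  have "v (\<lambda>q. B (y q) (z q)) = v (\<lambda>q. \<Sum>a\<in>Basis. \<Sum>b\<in>Basis. B a b * ((y q \<bullet> a) * (z q \<bullet> b)))"
    by (rule arg_cong[of _ _ v], rule ext)
      (use bilinear_eq_sum_Basis[OF B, of "y q" "z q" for q] in \<open>simp add: mult.commute\<close>)
  also have "\<dots> = (\<Sum>a\<in>Basis. v (\<lambda>q. \<Sum>b\<in>Basis. B a b * ((y q \<bullet> a) * (z q \<bullet> b))))"
    by (rule tangent_sum[OF v]) (intro germs_sum v germs_cmult germs_mult g)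
  also have "\<dots> = (\<Sum>a\<in>Basis. \<Sum>b\<in>Basis. B a b * (v (\<lambda>q. y q \<bullet> a) * (z p \<bullet> b) + (y p \<bullet> a) * v (\<lambda>q. z q \<bullet> b)))"
    by (rule sum.cong[OF refl], subst tangent_sum[OF v])
      (auto intro!: sum.cong germs_cmult germs_mult g
        simp: tangent_cmult[OF v(1) germs_mult[OF g]] tangent_mult[OF v(1) g])
  also have "\<dots> = B (dv v y) (z p) + B (y p) (dv v z)"
    unfolding bilinear_eq_sum_Basis[OF B, of "dv v y"] bilinear_eq_sum_Basis[OF B, of "y p"]
    by (simp add: dv_inner algebra_simps sum.distrib)
  finally show ?thesis .
qed

lemma dv_map:
  assumes v: "v \<in> tangent_space A p" "p \<in> pts A" and y: "smooth_coeffs y" and T: "linear T"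
  shows "dv v (\<lambda>q. T (y q)) = T (dv v y)"
proof (rule euclidean_eqI)
  fix b :: 'e assume b: "b \<in> Basis"
  have "linear (\<lambda>u. T u \<bullet> b)"
    by (rule linearI) (simp_all add: linear_add[OF T] linear_cmul[OF T] inner_add_left)
  from dv_linear[OF v y this] show "dv v (\<lambda>q. T (y q)) \<bullet> b = T (dv v y) \<bullet> b"
    unfolding dv_inner[OF b] .
qed

lemma dv_bilinear:
  assumes v: "v \<in> tangent_space A p" "p \<in> pts A" and yz: "smooth_coeffs y" "smooth_coeffs z"
    and B: "bilinear B"
  shows "dv v (\<lambda>q. B (y q) (z q)) = B (dv v y) (z p) + B (y p) (dv v z)"
proof (rule euclidean_eqI)
  fix b :: 'e assume b: "b \<in> Basis"
  from dv_bilinear_form[OF v yz bilinear_inner[OF B]]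
  show "dv v (\<lambda>q. B (y q) (z q)) \<bullet> b = (B (dv v y) (z p) + B (y p) (dv v z)) \<bullet> b"
    by (simp add: dv_inner b inner_add_left)
qed

lemma dv_const [simp]: "v \<in> tangent_space A p \<Longrightarrow> dv v (\<lambda>q. u) = 0"
  by (simp add: dv_def tangent_const)

lemma dv_cong:
  "v \<in> tangent_space A p \<Longrightarrow> (\<And>q. q \<in> pts A \<Longrightarrow> y q = z q) \<Longrightarrow> dv v y = dv v z"
  by (rule euclidean_eqI) (auto simp: dv_inner intro: tangent_cong)

lemma dv_add:
  "v \<in> tangent_space A p \<Longrightarrow> p \<in> pts A \<Longrightarrow> smooth_coeffs y \<Longrightarrow> smooth_coeffs z \<Longrightarrow>
    dv v (\<lambda>q. y q + z q) = dv v y + dv v z"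
  by (rule euclidean_eqI)
    (auto simp: dv_inner inner_add_left smooth_coeffs_def smooth_funs_germs tangent_add[of v p])

lemma dv_scale:
  "v \<in> tangent_space A p \<Longrightarrow> p \<in> pts A \<Longrightarrow> a \<in> smooth_funs A \<Longrightarrow> smooth_coeffs y \<Longrightarrow>
    dv v (\<lambda>q. a q *\<^sub>R y q) = v a *\<^sub>R y p + a p *\<^sub>R dv v y"
  by (rule euclidean_eqI)
    (auto simp: dv_inner inner_add_left smooth_coeffs_def smooth_funs_germs tangent_mult[of v p])

lemma dv_E_linear: "p \<in> pts A \<Longrightarrow> linear (\<lambda>u. dv (E u p) y)"
  by (rule linearI) (simp_all add: dv_def scaleR_add_left sum.distrib scaleR_sum_right)

lemma smooth_coeffs_dv: "X \<in> vfields A \<Longrightarrow> smooth_coeffs y \<Longrightarrow> smooth_coeffs (\<lambda>p. dv (X p) y)"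
  by (simp add: smooth_coeffs_def dv_inner vfields_smooth_funs)

text \<open>The inner field is expanded in the frame and the Leibniz rule applied: derivatives of
  its coefficients give the first two terms, and the iterated derivatives along frame fields pair up
  to brackets of frame fields, hence to \<open>c\<close>.\<close>

lemma bracket_eq:
  assumes X: "X \<in> vfields A" and Y: "Y \<in> vfields A"
  shows "bracket A X Y = fld (\<lambda>p. dv (X p) (cf Y) - dv (Y p) (cf X) + c (cf X p) (cf Y p))"
proof (intro ext)
  fix p f
  show "bracket A X Y p f = fld (\<lambda>p. dv (X p) (cf Y) - dv (Y p) (cf X) + c (cf X p) (cf Y p)) p f"
  proof (cases "f \<in> germs A p")
    case False
    have "fld z p f = 0" for z
      by (cases "p \<in> pts A") (auto simp: fld_def vfields_not_germ[OF E_field False])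
    then show ?thesis using False by (simp add: bracket_def)
  next
    case f: True
    then have p: "p \<in> pts A" by (rule germs_pts)
    have *: "X p (\<lambda>q. Y q f) = E (dv (X p) (cf Y)) p f +
        (\<Sum>b\<in>Basis. \<Sum>a\<in>Basis. (cf Y p \<bullet> b) * ((cf X p \<bullet> a) * E a p (\<lambda>q. E b q f)))"
      if X: "X \<in> vfields A" and Y: "Y \<in> vfields A" for X Y
    proof -
      have Xp: "X p \<in> tangent_space A p" using X p vfields_tangent by blast
      have g: "(\<lambda>q. cf Y q \<bullet> b) \<in> germs A p" if "b \<in> Basis" for b
        using smooth_coeffs_cf[OF Y] that p by (auto simp: smooth_coeffs_def smooth_funs_germs)
      have e: "(\<lambda>q. E b q f) \<in> germs A p" for b using vfields_germs[OF E_field f] .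
      have "X p (\<lambda>q. Y q f) = X p (\<lambda>q. \<Sum>b\<in>Basis. (cf Y q \<bullet> b) * E b q f)"
        by (rule tangent_cong[OF Xp]) (use E_cf[OF Y] E_sum in metis)
      also have "\<dots> = (\<Sum>b\<in>Basis. X p (\<lambda>q. (cf Y q \<bullet> b) * E b q f))"
        by (rule tangent_sum[OF Xp p]) (rule germs_mult[OF g e])
      also have "\<dots> = (\<Sum>b\<in>Basis. X p (\<lambda>q. cf Y q \<bullet> b) * E b p f + (cf Y p \<bullet> b) * X p (\<lambda>q. E b q f))"
        by (rule sum.cong[OF refl]) (rule tangent_mult[OF Xp g e])
      also have "\<dots> = (\<Sum>b\<in>Basis. X p (\<lambda>q. cf Y q \<bullet> b) * E b p f) +
          (\<Sum>b\<in>Basis. (cf Y p \<bullet> b) * E (cf X p) p (\<lambda>q. E b q f))"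
        by (simp add: sum.distrib E_cf[OF X p])
      also have "(\<Sum>b\<in>Basis. X p (\<lambda>q. cf Y q \<bullet> b) * E b p f) = E (dv (X p) (cf Y)) p f"
        by (subst E_sum[OF p, of "dv (X p) (cf Y)"]) (simp add: dv_inner)
      also have "(\<Sum>b\<in>Basis. (cf Y p \<bullet> b) * E (cf X p) p (\<lambda>q. E b q f)) =
        (\<Sum>b\<in>Basis. \<Sum>a\<in>Basis. (cf Y p \<bullet> b) * ((cf X p \<bullet> a) * E a p (\<lambda>q. E b q f)))"
        by (subst E_sum[OF p, of "cf X p"]) (simp add: sum_distrib_left)
      finally show ?thesis .
    qed
    have br: "E (c a b) p f = E a p (\<lambda>q. E b q f) - E b p (\<lambda>q. E a q f)" for a b
      unfolding E_bracket[symmetric] using f by (simp add: bracket_def)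
    have "bracket A X Y p f = E (dv (X p) (cf Y)) p f - E (dv (Y p) (cf X)) p f +
        ((\<Sum>b\<in>Basis. \<Sum>a\<in>Basis. (cf Y p \<bullet> b) * ((cf X p \<bullet> a) * E a p (\<lambda>q. E b q f))) -
         (\<Sum>a\<in>Basis. \<Sum>b\<in>Basis. (cf X p \<bullet> a) * ((cf Y p \<bullet> b) * E b p (\<lambda>q. E a q f))))"
      using f by (simp add: bracket_def *[OF X Y] *[OF Y X])
    also have "(\<Sum>b\<in>Basis. \<Sum>a\<in>Basis. (cf Y p \<bullet> b) * ((cf X p \<bullet> a) * E a p (\<lambda>q. E b q f))) =
        (\<Sum>a\<in>Basis. \<Sum>b\<in>Basis. (cf X p \<bullet> a) * ((cf Y p \<bullet> b) * E a p (\<lambda>q. E b q f)))"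
      by (subst sum.swap) (simp add: mult.left_commute)
    also have "\<dots> - (\<Sum>a\<in>Basis. \<Sum>b\<in>Basis. (cf X p \<bullet> a) * ((cf Y p \<bullet> b) * E b p (\<lambda>q. E a q f))) =
        (\<Sum>a\<in>Basis. \<Sum>b\<in>Basis. ((cf X p \<bullet> a) * (cf Y p \<bullet> b)) * E (c a b) p f)"
      by (simp add: sum_subtractf[symmetric] br algebra_simps)
    also have "\<dots> = E (c (cf X p) (cf Y p)) p f"
    proof (rule bilinear_eq_sum_Basis[of "\<lambda>u v. E (c u v) p f", symmetric])
      show "bilinear (\<lambda>u v. E (c u v) p f)"
        unfolding bilinear_def
        using p by (auto intro!: linearI simp: bilinear_ladd[OF c_bilin] bilinear_radd[OF c_bilin]
            bilinear_lmul[OF c_bilin] bilinear_rmul[OF c_bilin])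
    qed
    finally show ?thesis using p by (simp add: fld_def)
  qed
qed

lemma smooth_coeffs_diff: "smooth_coeffs x \<Longrightarrow> smooth_coeffs y \<Longrightarrow> smooth_coeffs (\<lambda>p. x p - y p)"
  using smooth_coeffs_add[of x "\<lambda>p. (-1) *\<^sub>R y p"] smooth_coeffs_scale[OF smooth_funs_const, of y "-1"]
  by simp

lemma bracket_vfields: "X \<in> vfields A \<Longrightarrow> Y \<in> vfields A \<Longrightarrow> bracket A X Y \<in> vfields A"
  unfolding bracket_eq
  by (intro fld_vfields smooth_coeffs_add smooth_coeffs_diff smooth_coeffs_dv smooth_coeffs_cf
      smooth_coeffs_bilinear[OF _ _ c_bilin])

lemma cf_bracket: "X \<in> vfields A \<Longrightarrow> Y \<in> vfields A \<Longrightarrow> p \<in> pts A \<Longrightarrow>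
    cf (bracket A X Y) p = dv (X p) (cf Y) - dv (Y p) (cf X) + c (cf X p) (cf Y p)"
  by (simp add: bracket_eq)

lemma dv_bracket:
  assumes "X \<in> vfields A" "Y \<in> vfields A" "p \<in> pts A" "smooth_coeffs z"
  shows "dv (bracket A X Y p) z = dv (X p) (\<lambda>q. dv (Y q) z) - dv (Y p) (\<lambda>q. dv (X q) z)"
  by (rule euclidean_eqI)
    (use assms in \<open>auto simp: dv_inner inner_diff_left bracket_def smooth_coeffs_def smooth_funs_germs\<close>)


lemma E_bracket_apply:
  "f \<in> germs A p \<Longrightarrow> E (c u v) p f = E u p (\<lambda>q. E v q f) - E v p (\<lambda>q. E u q f)"
  unfolding E_bracket[symmetric] by (simp add: bracket_def)

text \<open>Commutators of derivations satisfy the Jacobi identity, and the frame is injective at a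
  point; this is where a point must exist.\<close>

lemma c_jacobi:
  assumes "pts A \<noteq> {}"
  shows "c u (c v w) = c (c u v) w + c v (c u w)"
proof -
  obtain p where p: "p \<in> pts A" using assms by blast
  have "E (c u (c v w)) p f = E (c (c u v) w + c v (c u w)) p f" for f
  proof (cases "f \<in> germs A p")
    case f: True
    note g = vfields_germs[OF E_field]
    have *: "E u p (\<lambda>q. E (c v w) q f) =
        E u p (\<lambda>q. E v q (\<lambda>q. E w q f)) - E u p (\<lambda>q. E w q (\<lambda>q. E v q f))" for u v w
    proof -
      have "E u p (\<lambda>q. E (c v w) q f) =
          E u p (\<lambda>q. E v q (\<lambda>q. E w q f) - E w q (\<lambda>q. E v q f))"
        \<comment> \<open>\<open>E_bracket_apply\<close> holds where \<open>f\<close> is a germ, and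
          this is known on a neighbourhood of \<open>p\<close> only, so the local congruence is
          required.\<close>
        by (rule tangent_cong_near[OF E_tangent[OF p] g[OF f] near_mono[OF near_germs[OF f]]])
          (rule E_bracket_apply)
      also have "\<dots> = E u p (\<lambda>q. E v q (\<lambda>q. E w q f)) - E u p (\<lambda>q. E w q (\<lambda>q. E v q f))"
        by (rule tangent_diff[OF E_tangent[OF p]]) (intro g f)+
      finally show ?thesis .
    qed
    show ?thesis
      using p f g[OF f] by (simp add: E_bracket_apply *)
  qed (simp add: vfields_not_germ)
  then show ?thesis using E_inj[OF p] by blast
qed

end

context framed_manifold
begin

section \<open>Affine connections in the frame\<close>

lemma fld_cong: "(\<And>p. p \<in> pts A \<Longrightarrow> x p = y p) \<Longrightarrow> fld x = fld y"
  by (auto simp: fld_def)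

lemma fld_apply: "p \<in> pts A \<Longrightarrow> fld x p = E (x p) p"
  by (simp add: fld_def)

lemma vfields_eq_fldI:
  assumes "\<And>p f. p \<in> pts A \<Longrightarrow> X p f = E (x p) p f" "\<And>p f. p \<notin> pts A \<Longrightarrow> X p f = 0"
  shows "X = fld x"
  using assms by (auto simp: fld_def fun_eq_iff)

lemma E_cf_apply: "X \<in> vfields A \<Longrightarrow> p \<in> pts A \<Longrightarrow> E (cf X p) p f = X p f"
  by (simp add: E_cf)

lemma E_sum_left: "p \<in> pts A \<Longrightarrow> E (\<Sum>i\<in>I. u i) p f = (\<Sum>i\<in>I. E (u i) p f)"
  by (rule linear_sum[OF E_linear])

lemma field_sum_eq:
  assumes "\<And>i. i \<in> I \<Longrightarrow> X i \<in> vfields A"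
  shows "(\<lambda>p f. \<Sum>i\<in>I. a i p * X i p f) = fld (\<lambda>p. \<Sum>i\<in>I. a i p *\<^sub>R cf (X i) p)"
proof (rule vfields_eq_fldI)
  fix p f assume p: "p \<in> pts A"
  show "(\<Sum>i\<in>I. a i p * X i p f) = E (\<Sum>i\<in>I. a i p *\<^sub>R cf (X i) p) p f"
    using linear_sum[OF E_linear[OF p, of f], of "\<lambda>i. a i p *\<^sub>R cf (X i) p" I] p assms
    by (simp add: E_cf_apply)
qed (simp add: assms vfields_zero)

lemma field_sum:
  assumes "\<And>i. i \<in> I \<Longrightarrow> X i \<in> vfields A" "\<And>i. i \<in> I \<Longrightarrow> a i \<in> smooth_funs A"
  shows "(\<lambda>p f. \<Sum>i\<in>I. a i p * X i p f) \<in> vfields A"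
proof -
  have "smooth_coeffs (\<lambda>p. \<Sum>i\<in>I. a i p *\<^sub>R cf (X i) p)"
    unfolding smooth_coeffs_def inner_sum_left inner_scaleR_left
    using assms smooth_coeffs_cf by (auto simp: smooth_coeffs_def intro!: smooth_funs_sum smooth_funs_mult)
  then show ?thesis using field_sum_eq[of I X a] assms fld_vfields by simp
qed

lemma field_comb_eq:
  assumes "X \<in> vfields A" "Y \<in> vfields A"
  shows "(\<lambda>p f. a p * X p f + b p * Y p f) = fld (\<lambda>p. a p *\<^sub>R cf X p + b p *\<^sub>R cf Y p)"
  by (rule vfields_eq_fldI) (use assms in \<open>auto simp: E_cf_apply vfields_zero\<close>)

lemma field_add_eq:
  assumes "X \<in> vfields A" "Y \<in> vfields A"
  shows "(\<lambda>p f. X p f + Y p f) = fld (\<lambda>p. cf X p + cf Y p)"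
  using field_comb_eq[OF assms, of "\<lambda>p. 1" "\<lambda>p. 1"] by simp

lemma field_scale_eq:
  assumes "X \<in> vfields A"
  shows "(\<lambda>p f. a p * X p f) = fld (\<lambda>p. a p *\<^sub>R cf X p)"
  using field_comb_eq[OF assms assms, of a "\<lambda>p. 0"] by simp

lemma field_basis: "X \<in> vfields A \<Longrightarrow> X = (\<lambda>p f. \<Sum>b\<in>Basis. (cf X p \<bullet> b) * E b p f)"
proof -
  assume X: "X \<in> vfields A"
  have "(\<lambda>p f. \<Sum>b\<in>Basis. (cf X p \<bullet> b) * E b p f) = fld (\<lambda>p. \<Sum>b\<in>Basis. (cf X p \<bullet> b) *\<^sub>R cf (E b) p)"
    by (rule field_sum_eq) simp
  also have "\<dots> = fld (cf X)" by (rule fld_cong) (simp add: euclidean_representation)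
  finally show ?thesis using X by simp
qed

lemma zero_field_eq: "zero_field = fld (\<lambda>p. 0)"
  by (rule vfields_eq_fldI) (auto simp: zero_field_def)

text \<open>In the frame, every affine connection is differentiation of coefficients plus a bilinear term.\<close>

definition conn :: "('e \<Rightarrow> 'e \<Rightarrow> 'e) \<Rightarrow> 'p conn" where
  "conn \<Gamma> X Y = (if X \<in> vfields A \<and> Y \<in> vfields A
     then fld (\<lambda>p. dv (X p) (cf Y) + \<Gamma> (cf X p) (cf Y p)) else zero_field)"

abbreviation flat :: "'p conn" where
  "flat \<equiv> conn (\<lambda>_ _. 0)"

lemma conn_vfields: "bilinear \<Gamma> \<Longrightarrow> X \<in> vfields A \<Longrightarrow> Y \<in> vfields A \<Longrightarrow> conn \<Gamma> X Y \<in> vfields A"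
  by (simp add: conn_def fld_vfields smooth_coeffs_add smooth_coeffs_dv smooth_coeffs_cf smooth_coeffs_bilinear)

lemma cf_conn: "X \<in> vfields A \<Longrightarrow> Y \<in> vfields A \<Longrightarrow> p \<in> pts A \<Longrightarrow>
    cf (conn \<Gamma> X Y) p = dv (X p) (cf Y) + \<Gamma> (cf X p) (cf Y p)"
  by (simp add: conn_def)

lemma dv_fld: 
  assumes "v \<in> tangent_space A p"
  shows "dv v (cf (fld x)) = dv v x"
  by (rule dv_cong[OF assms]) simp

lemma dv_E_add: "p \<in> pts A \<Longrightarrow> dv (E (u + v) p) y = dv (E u p) y + dv (E v p) y"
  and dv_E_scale: "p \<in> pts A \<Longrightarrow> dv (E (r *\<^sub>R u) p) y = r *\<^sub>R dv (E u p) y"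
  using linear_add[OF dv_E_linear] linear_cmul[OF dv_E_linear] by auto

lemma affine_connection_conn:
  assumes "bilinear \<Gamma>"
  shows "affine_connection A (conn \<Gamma>)"
proof -
  note [simp] = bilinear_ladd[OF assms] bilinear_radd[OF assms] bilinear_lmul[OF assms] bilinear_rmul[OF assms]
  show ?thesis
    unfolding affine_connection_def
  proof (intro conjI ballI allI impI)
    fix X Y assume X: "X \<in> vfields A" and Y: "Y \<in> vfields A"
    show "conn \<Gamma> X Y \<in> vfields A" using conn_vfields[OF assms X Y] .
  next
    fix X X' Y a b
    assume X: "X \<in> vfields A" "X' \<in> vfields A" and Y: "Y \<in> vfields A"
      and ab: "a \<in> smooth_funs A" "b \<in> smooth_funs A"
    have s: "smooth_coeffs (\<lambda>p. a p *\<^sub>R cf X p + b p *\<^sub>R cf X' p)"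
      by (intro smooth_coeffs_add smooth_coeffs_scale ab smooth_coeffs_cf X)
    show "conn \<Gamma> (\<lambda>p f. a p * X p f + b p * X' p f) Y = (\<lambda>p f. a p * conn \<Gamma> X Y p f + b p * conn \<Gamma> X' Y p f)"
      unfolding field_comb_eq[OF X] field_comb_eq[OF conn_vfields[OF assms X(1) Y] conn_vfields[OF assms X(2) Y]]
      by (simp add: conn_def fld_vfields s Y X cong: conj_cong)
        (rule fld_cong, simp add: fld_apply dv_E_add dv_E_scale E_cf X algebra_simps)
  next
    fix X Y Y'
    assume X: "X \<in> vfields A" and Y: "Y \<in> vfields A" "Y' \<in> vfields A"
    have s: "smooth_coeffs (\<lambda>p. cf Y p + cf Y' p)"
      by (intro smooth_coeffs_add smooth_coeffs_cf Y)
    show "conn \<Gamma> X (\<lambda>p f. Y p f + Y' p f) = (\<lambda>p f. conn \<Gamma> X Y p f + conn \<Gamma> X Y' p f)"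
      unfolding field_add_eq[OF Y] field_add_eq[OF conn_vfields[OF assms X Y(1)] conn_vfields[OF assms X Y(2)]]
      by (simp add: conn_def fld_vfields s Y X cong: conj_cong)
        (rule fld_cong, simp add: dv_fld[OF vfields_tangent[OF X]] dv_add[OF vfields_tangent[OF X]]
           smooth_coeffs_cf Y)
  next
    fix X Y a
    assume X: "X \<in> vfields A" and Y: "Y \<in> vfields A" and a: "a \<in> smooth_funs A"
    have s: "smooth_coeffs (\<lambda>p. a p *\<^sub>R cf Y p)"
      by (intro smooth_coeffs_scale smooth_coeffs_cf Y a)
    show "conn \<Gamma> X (\<lambda>p f. a p * Y p f) = (\<lambda>p f. X p a * Y p f + a p * conn \<Gamma> X Y p f)"
      unfolding field_scale_eq[OF Y] field_comb_eq[OF Y conn_vfields[OF assms X Y]]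
      by (simp add: conn_def fld_vfields s Y X cong: conj_cong)
        (rule fld_cong, simp add: dv_fld[OF vfields_tangent[OF X]] dv_scale[OF vfields_tangent[OF X]]
           smooth_coeffs_cf Y a algebra_simps)
  qed (auto simp: conn_def)
qed

lemma affineD:
  assumes D: "affine_connection A D"
  shows "\<not> (X \<in> vfields A \<and> Y \<in> vfields A) \<Longrightarrow> D X Y = zero_field"
    and "X \<in> vfields A \<Longrightarrow> Y \<in> vfields A \<Longrightarrow> D X Y \<in> vfields A"
    and "X \<in> vfields A \<Longrightarrow> X' \<in> vfields A \<Longrightarrow> Y \<in> vfields A \<Longrightarrow> a \<in> smooth_funs A \<Longrightarrow>
      b \<in> smooth_funs A \<Longrightarrow>
      D (\<lambda>p f. a p * X p f + b p * X' p f) Y = (\<lambda>p f. a p * D X Y p f + b p * D X' Y p f)"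
    and "X \<in> vfields A \<Longrightarrow> Y \<in> vfields A \<Longrightarrow> Y' \<in> vfields A \<Longrightarrow>
      D X (\<lambda>p f. Y p f + Y' p f) = (\<lambda>p f. D X Y p f + D X Y' p f)"
    and "X \<in> vfields A \<Longrightarrow> Y \<in> vfields A \<Longrightarrow> a \<in> smooth_funs A \<Longrightarrow>
      D X (\<lambda>p f. a p * Y p f) = (\<lambda>p f. X p a * Y p f + a p * D X Y p f)"
  using D unfolding affine_connection_def by auto

lemma affine_sum_left:
  assumes D: "affine_connection A D" and Y: "Y \<in> vfields A" and I: "finite I"
    and a: "\<And>i. i \<in> I \<Longrightarrow> X i \<in> vfields A" "\<And>i. i \<in> I \<Longrightarrow> a i \<in> smooth_funs A"
  shows "D (\<lambda>p f. \<Sum>i\<in>I. a i p * X i p f) Y = (\<lambda>p f. \<Sum>i\<in>I. a i p * D (X i) Y p f)"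
  using I a
proof (induction I)
  case empty
  \<comment> \<open>Both coefficients are 0, so this presents the zero field and shows that
    differentiating along it gives zero.\<close>
  have "D (\<lambda>p f. 0 * E 0 p f + 0 * E 0 p f) Y = (\<lambda>p f. 0 * D (E 0) Y p f + 0 * D (E 0) Y p f)"
    by (rule affineD(3)[OF D E_field E_field Y smooth_funs_const smooth_funs_const])
  then show ?case by simp
next
  case (insert i I)
  have S: "(\<lambda>p f. \<Sum>i\<in>I. a i p * X i p f) \<in> vfields A" by (rule field_sum) (use insert in auto)
  have "D (\<lambda>p f. a i p * X i p f + (\<lambda>p. 1) p * (\<Sum>i\<in>I. a i p * X i p f)) Y =
      (\<lambda>p f. a i p * D (X i) Y p f + (\<lambda>p. 1) p * D (\<lambda>p f. \<Sum>i\<in>I. a i p * X i p f) Y p f)"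
    by (rule affineD(3)[OF D _ S Y _ smooth_funs_const]) (use insert.prems in auto)
  then show ?case using insert by simp
qed

lemma affine_sum_right:
  assumes D: "affine_connection A D" and X: "X \<in> vfields A" and I: "finite I"
    and a: "\<And>i. i \<in> I \<Longrightarrow> Y i \<in> vfields A" "\<And>i. i \<in> I \<Longrightarrow> a i \<in> smooth_funs A"
  shows "D X (\<lambda>p f. \<Sum>i\<in>I. a i p * Y i p f) =
    (\<lambda>p f. \<Sum>i\<in>I. X p (a i) * Y i p f + a i p * D X (Y i) p f)"
  using I a
proof (induction I)
  case empty
  have "D X (\<lambda>p f. (\<lambda>p. 0) p * E 0 p f) = (\<lambda>p f. X p (\<lambda>p. 0) * E 0 p f + (\<lambda>p. 0) p * D X (E 0) p f)"
    by (rule affineD(5)[OF D X E_field smooth_funs_const])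
  moreover have "E 0 p f = 0" for p f
    by (cases "p \<in> pts A") (auto simp: vfields_zero)
  ultimately show ?case by simp
next
  case (insert i I)
  have S: "(\<lambda>p f. \<Sum>i\<in>I. a i p * Y i p f) \<in> vfields A" by (rule field_sum) (use insert in auto)
  have T: "(\<lambda>p f. a i p * Y i p f) \<in> vfields A"
    using field_sum[of "{i}" Y a] insert.prems by simp
  have "D X (\<lambda>p f. (\<lambda>p f. a i p * Y i p f) p f + (\<lambda>p f. \<Sum>i\<in>I. a i p * Y i p f) p f) =
      (\<lambda>p f. D X (\<lambda>p f. a i p * Y i p f) p f + D X (\<lambda>p f. \<Sum>i\<in>I. a i p * Y i p f) p f)"
    by (rule affineD(4)[OF D X T S])
  moreover have "D X (\<lambda>p f. a i p * Y i p f) = (\<lambda>p f. X p (a i) * Y i p f + a i p * D X (Y i) p f)"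
    by (rule affineD(5)[OF D X]) (use insert.prems in auto)
  ultimately show ?case using insert by simp
qed

text \<open>The Christoffel symbols of \<open>D\<close> in the frame, extended bilinearly; a priori
  they depend on \<open>p\<close>.\<close>

definition chr :: "'p conn \<Rightarrow> 'p \<Rightarrow> 'e \<Rightarrow> 'e \<Rightarrow> 'e" where
  "chr D p u v = (\<Sum>a\<in>Basis. \<Sum>b\<in>Basis. ((u \<bullet> a) * (v \<bullet> b)) *\<^sub>R cf (D (E a) (E b)) p)"

lemma chr_bilinear: "bilinear (chr D p)"
  unfolding bilinear_def chr_def
  by (auto intro!: linearI simp: inner_add_left sum.distrib algebra_simps scaleR_sum_right)

text \<open>Because the frame is global, fields decompose without cutoff functions, and the Leibniz
  rule determines \<open>D\<close> from its values on frame fields.\<close>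

lemma affine_cf:
  assumes D: "affine_connection A D" and X: "X \<in> vfields A" and Y: "Y \<in> vfields A" and p: "p \<in> pts A"
  shows "cf (D X Y) p = dv (X p) (cf Y) + chr D p (cf X p) (cf Y p)"
proof (rule cf_eqI[OF p], rule ext)
  fix f
  have Dv: "D (E a) (E b) \<in> vfields A" for a b
    using affineD(2)[OF D] by simp
  have sx: "(\<lambda>p. cf X p \<bullet> b) \<in> smooth_funs A" "(\<lambda>p. cf Y p \<bullet> b) \<in> smooth_funs A" if "b \<in> Basis" for b
    using smooth_coeffs_cf[OF X] smooth_coeffs_cf[OF Y] that by (auto simp: smooth_coeffs_def)
  have DX: "D X (E b) p f = (\<Sum>a\<in>Basis. (cf X p \<bullet> a) * D (E a) (E b) p f)" for b
    using affine_sum_left[OF D, of "E b" Basis E "\<lambda>b p. cf X p \<bullet> b"] sx field_basis[OF X] by simp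
  have "D X Y p f = D X (\<lambda>p f. \<Sum>b\<in>Basis. (cf Y p \<bullet> b) * E b p f) p f"
    using field_basis[OF Y] by simp
  also have "\<dots> = (\<Sum>b\<in>Basis. X p (\<lambda>p. cf Y p \<bullet> b) * E b p f + (cf Y p \<bullet> b) * D X (E b) p f)"
    using affine_sum_right[OF D X, of Basis E "\<lambda>b p. cf Y p \<bullet> b"] sx by simp
  also have "\<dots> = E (dv (X p) (cf Y)) p f + (\<Sum>b\<in>Basis. (cf Y p \<bullet> b) * D X (E b) p f)"
    using E_sum[OF p, of "dv (X p) (cf Y)" f] by (simp add: sum.distrib dv_inner)
  also have "(\<Sum>b\<in>Basis. (cf Y p \<bullet> b) * D X (E b) p f) =
      (\<Sum>b\<in>Basis. (cf Y p \<bullet> b) * (\<Sum>a\<in>Basis. (cf X p \<bullet> a) * D (E a) (E b) p f))"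
    by (simp only: DX)
  also have "(\<Sum>b\<in>Basis. (cf Y p \<bullet> b) * (\<Sum>a\<in>Basis. (cf X p \<bullet> a) * D (E a) (E b) p f)) =
      (\<Sum>a\<in>Basis. \<Sum>b\<in>Basis. ((cf X p \<bullet> a) * (cf Y p \<bullet> b)) * E (cf (D (E a) (E b)) p) p f)"
    unfolding sum_distrib_left by (subst sum.swap) (simp add: E_cf[OF Dv p] mult_ac)
  also have "\<dots> = E (chr D p (cf X p) (cf Y p)) p f"
    unfolding chr_def using p by (simp add: E_sum_left)
  finally show "D X Y p f = E (dv (X p) (cf Y) + chr D p (cf X p) (cf Y p)) p f"
    using p by simp
qed

lemma affine_cf_E:
  assumes "affine_connection A D" "p \<in> pts A"
  shows "cf (D (E u) (E v)) p = chr D p u v"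
proof -
  have "dv (E u p) (cf (E v)) = dv (E u p) (\<lambda>q. v)"
    by (rule dv_cong[OF E_tangent[OF assms(2)]]) simp
  then show ?thesis
    using affine_cf[OF assms(1) E_field E_field assms(2), of u v] assms(2)
      dv_const[OF E_tangent[OF assms(2)]] by simp
qed

lemma affine_E:
  assumes D: "affine_connection A D" and p: "p \<in> pts A"
  shows "D (E u) (E v) p = E (chr D p u v) p"
proof -
  have "D (E u) (E v) \<in> vfields A" using affineD(2)[OF D] by simp
  then show ?thesis using E_cf[OF _ p] affine_cf_E[OF D p] by metis
qed

text \<open>Turns the uniqueness claims behind \<open>THE\<close> into linear algebra at each point:
  the axioms only have to force the Christoffel symbols to be the constant
  \<open>\<Gamma>\<close>.\<close>

lemma affine_eq_conn:
  assumes D: "affine_connection A D" and \<Gamma>: "bilinear \<Gamma>" "\<And>p u v. p \<in> pts A \<Longrightarrow> chr D p u v = \<Gamma> u v"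
  shows "D = conn \<Gamma>"
proof (intro ext)
  fix X Y p f
  show "D X Y p f = conn \<Gamma> X Y p f"
  proof (cases "X \<in> vfields A \<and> Y \<in> vfields A")
    case True
    then have "D X Y \<in> vfields A" using affineD(2)[OF D] by blast
    then have "D X Y = conn \<Gamma> X Y"
      using True \<Gamma>(1) by (auto intro!: vfields_eqI conn_vfields simp: cf_conn affine_cf[OF D] \<Gamma>(2))
    then show ?thesis by simp
  next
    \<comment> \<open>Connections are normalised to \<open>zero_field\<close> off the vector fields,
      so the equality extends to all arguments.\<close>
    case False
    then show ?thesis using affineD(1)[OF D False] by (auto simp: conn_def)
  qed
qed

lemma torsion_conn:
  assumes "bilinear \<Gamma>" "X \<in> vfields A" "Y \<in> vfields A"
  shows "torsion A (conn \<Gamma>) X Y =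
    fld (\<lambda>p. \<Gamma> (cf X p) (cf Y p) - \<Gamma> (cf Y p) (cf X p) - c (cf X p) (cf Y p))"
  by (rule vfields_eq_fldI)
    (use assms in \<open>auto simp: torsion_def conn_def bracket_eq fld_apply fld_def\<close>)

lemma torsion_affine_E:
  assumes "affine_connection A D" "p \<in> pts A"
  shows "torsion A D (E u) (E v) p f = E (chr D p u v - chr D p v u - c u v) p f"
  using assms by (simp add: torsion_def affine_E E_bracket)

text \<open>Second derivatives of the coefficients of \<open>Z\<close> cancel by
  \<open>dv_bracket\<close>, and the terms with one derivative cancel in pairs, so the result is
  tensorial.\<close>

lemma curvature_conn:
  assumes \<Gamma>: "bilinear \<Gamma>" and X: "X \<in> vfields A" and Y: "Y \<in> vfields A" and Z: "Z \<in> vfields A"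
  shows "curvature_op A (conn \<Gamma>) X Y Z =
    fld (\<lambda>p. \<Gamma> (cf X p) (\<Gamma> (cf Y p) (cf Z p)) - \<Gamma> (cf Y p) (\<Gamma> (cf X p) (cf Z p))
      - \<Gamma> (c (cf X p) (cf Y p)) (cf Z p))"
proof (rule vfields_eq_fldI)
  fix p f assume p: "p \<in> pts A"
  have *: "cf (conn \<Gamma> X (conn \<Gamma> Y Z)) p = dv (X p) (\<lambda>q. dv (Y q) (cf Z)) +
      \<Gamma> (dv (X p) (cf Y)) (cf Z p) + \<Gamma> (cf Y p) (dv (X p) (cf Z)) +
      \<Gamma> (cf X p) (dv (Y p) (cf Z) + \<Gamma> (cf Y p) (cf Z p))"
    if X: "X \<in> vfields A" and Y: "Y \<in> vfields A" for X Y
  proof -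
    have t: "X p \<in> tangent_space A p" using vfields_tangent[OF X p] .
    have "dv (X p) (cf (conn \<Gamma> Y Z)) = dv (X p) (\<lambda>q. dv (Y q) (cf Z) + \<Gamma> (cf Y q) (cf Z q))"
      by (rule dv_cong[OF t]) (simp add: cf_conn Y Z)
    also have "\<dots> = dv (X p) (\<lambda>q. dv (Y q) (cf Z)) + dv (X p) (\<lambda>q. \<Gamma> (cf Y q) (cf Z q))"
      by (rule dv_add[OF t p smooth_coeffs_dv[OF Y smooth_coeffs_cf[OF Z]]
            smooth_coeffs_bilinear[OF smooth_coeffs_cf[OF Y] smooth_coeffs_cf[OF Z] \<Gamma>]])
    also have "dv (X p) (\<lambda>q. \<Gamma> (cf Y q) (cf Z q)) = \<Gamma> (dv (X p) (cf Y)) (cf Z p) + \<Gamma> (cf Y p) (dv (X p) (cf Z))"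
      by (rule dv_bilinear[OF t p smooth_coeffs_cf[OF Y] smooth_coeffs_cf[OF Z] \<Gamma>])
    finally show ?thesis
      using cf_conn[OF X conn_vfields[OF \<Gamma> Y Z] p] cf_conn[OF Y Z p] by (simp add: add.assoc)
  qed
  have b: "bracket A X Y \<in> vfields A" using bracket_vfields X Y .
  have **: "conn \<Gamma> U V p f = E (cf (conn \<Gamma> U V) p) p f" if "U \<in> vfields A" "V \<in> vfields A" for U V
    using E_cf_apply[OF conn_vfields[OF \<Gamma> that] p] by simp
  have "curvature_op A (conn \<Gamma>) X Y Z p f =
      E (cf (conn \<Gamma> X (conn \<Gamma> Y Z)) p - cf (conn \<Gamma> Y (conn \<Gamma> X Z)) p - cf (conn \<Gamma> (bracket A X Y) Z) p) p f"
    using p by (simp add: curvature_op_def ** X Y Z b conn_vfields[OF \<Gamma>])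
  also have "cf (conn \<Gamma> X (conn \<Gamma> Y Z)) p - cf (conn \<Gamma> Y (conn \<Gamma> X Z)) p - cf (conn \<Gamma> (bracket A X Y) Z) p =
     \<Gamma> (cf X p) (\<Gamma> (cf Y p) (cf Z p)) - \<Gamma> (cf Y p) (\<Gamma> (cf X p) (cf Z p)) - \<Gamma> (c (cf X p) (cf Y p)) (cf Z p)"
    unfolding *[OF X Y] *[OF Y X] cf_conn[OF b Z p] cf_bracket[OF X Y p]
      dv_bracket[OF X Y p smooth_coeffs_cf[OF Z]]
    by (simp add: bilinear_ladd[OF \<Gamma>] bilinear_radd[OF \<Gamma>] bilinear_lsub[OF \<Gamma>] algebra_simps)
  finally show "curvature_op A (conn \<Gamma>) X Y Z p f = E (\<Gamma> (cf X p) (\<Gamma> (cf Y p) (cf Z p))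
      - \<Gamma> (cf Y p) (\<Gamma> (cf X p) (cf Z p)) - \<Gamma> (c (cf X p) (cf Y p)) (cf Z p)) p f" .
qed (auto simp: curvature_op_def bracket_vfields X Y Z conn_vfields[OF \<Gamma>] vfields_zero)

section \<open>Parallel transport and holonomy for the connection that makes the frame
  parallel\<close>

lemma smooth_curve_derivative:
  assumes c: "smooth_curve A \<gamma>" and t: "t \<in> {0..1}"
  shows "\<gamma> t \<in> pts A" "velocity A \<gamma> t \<in> tangent_space A (\<gamma> t)"
    "f \<in> germs A (\<gamma> t) \<Longrightarrow> ((f \<circ> \<gamma>) has_real_derivative velocity A \<gamma> t f) (at t)"
proof -
  obtain U \<phi> N where ch: "(U, \<phi>) \<in> A" and N: "open N" "t \<in> N" "\<gamma> ` N \<subseteq> U" "smooth_on N (\<phi> \<circ> \<gamma>)"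
    using c t unfolding smooth_curve_def by blast
  have U: "\<gamma> t \<in> U" using N by blast
  then show p: "\<gamma> t \<in> pts A" using chart_pts[OF ch] by blast
  define u where "u = der (\<phi> \<circ> \<gamma>) t 1"
  have d\<gamma>: "(\<phi> \<circ> \<gamma> has_derivative (\<lambda>s. s *\<^sub>R u)) (at t)"
  proof -
    have "(\<phi> \<circ> \<gamma>) differentiable (at t)" using smooth_on_differentiable[OF N(4,2)] .
    then have "(\<phi> \<circ> \<gamma> has_derivative der (\<phi> \<circ> \<gamma>) t) (at t)"
      and l: "linear (der (\<phi> \<circ> \<gamma>) t)"
      by (simp_all only: frechet_derivative_works[symmetric] linear_frechet_derivative)
    moreover have "der (\<phi> \<circ> \<gamma>) t = (\<lambda>s. s *\<^sub>R u)"
    proof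
      fix s show "der (\<phi> \<circ> \<gamma>) t s = s *\<^sub>R u"
        using linear_cmul[OF l, of s 1] by (simp add: u_def)
    qed
    ultimately show ?thesis by simp
  qed
  have main: "((f \<circ> \<gamma>) has_real_derivative coord_vec A (U, \<phi>) (\<gamma> t) u f) (at t)"
    if f: "f \<in> germs A (\<gamma> t)" for f
  proof -
    let ?F = "f \<circ> inv_into U \<phi>"
    have "?F differentiable (at (\<phi> (\<gamma> t)))"
      using germ_chart[OF ch U f] smooth_on_differentiable by blast
    then have dF: "(?F has_derivative der ?F (\<phi> (\<gamma> t))) (at ((\<phi> \<circ> \<gamma>) t))"
      and l: "linear (der ?F (\<phi> (\<gamma> t)))"
      by (auto simp: frechet_derivative_works intro: linear_frechet_derivative)
    have "((\<lambda>s. ?F ((\<phi> \<circ> \<gamma>) s)) has_derivative (\<lambda>s. der ?F (\<phi> (\<gamma> t)) (s *\<^sub>R u))) (at t)"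
      using has_derivative_compose[OF d\<gamma> dF] .
    then have "(f \<circ> \<gamma> has_derivative (\<lambda>s. der ?F (\<phi> (\<gamma> t)) (s *\<^sub>R u))) (at t)"
      by (rule has_derivative_transform_within_open[OF _ N(1,2)])
        (use N(3) chart_inj[OF ch] in auto)
    then show ?thesis
      using l f by (simp add: has_field_derivative_def coord_vec_def linear_cmul mult_commute_abs)
  qed
  have v: "velocity A \<gamma> t = coord_vec A (U, \<phi>) (\<gamma> t) u"
  proof
    fix f show "velocity A \<gamma> t f = coord_vec A (U, \<phi>) (\<gamma> t) u f"
      using main DERIV_imp_deriv by (cases "f \<in> germs A (\<gamma> t)") (auto simp: velocity_def coord_vec_def)
  qed
  show "velocity A \<gamma> t \<in> tangent_space A (\<gamma> t)"
    unfolding v using ch U by (force simp: tangent_space_def)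
  show "f \<in> germs A (\<gamma> t) \<Longrightarrow> ((f \<circ> \<gamma>) has_real_derivative velocity A \<gamma> t f) (at t)"
    unfolding v by (rule main)
qed

text \<open>A frame field \<open>E u\<close> extends \<open>v\<close> to a global field, and the
  derivative depends on the extension through \<open>v\<close> alone, so \<open>THE\<close> denotes
  a single value.\<close>

lemma cov_deriv_at_flat:
  assumes v: "v \<in> tangent_space A p" "p \<in> pts A" and Y: "Y \<in> vfields A"
  shows "cov_deriv_at A flat p v Y = E (dv v (cf Y)) p"
proof -
  obtain u where u: "v = E u p" using E_surj v by blast
  show ?thesis
    unfolding cov_deriv_at_def
    by (rule the_equality) (use v Y u E_field in \<open>auto simp: conn_def fld_apply intro!: bexI[of _ "E u"]\<close>)
qed

text \<open>The functions \<open>k i\<close> and fields \<open>Y i\<close> representing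
  \<open>V\<close> are far from unique, so the argument passes to the coefficient curve
  \<open>W\<close> of \<open>V\<close> in the frame and shows that it is constant.\<close>

lemma parallel_flat:
  assumes \<gamma>: "smooth_curve A \<gamma>" and V: "parallel_along A flat \<gamma> V" and V0: "V 0 = E u (\<gamma> 0)"
  shows "V 1 = E u (\<gamma> 1)"
proof -
  obtain m and k :: "nat \<Rightarrow> real \<Rightarrow> real" and Y S where S: "open S" "{0..1} \<subseteq> S" and
    kY: "\<And>i. i < m \<Longrightarrow> smooth_on S (k i) \<and> Y i \<in> vfields A" and
    Vt: "\<And>t f. t \<in> {0..1} \<Longrightarrow> V t f = (\<Sum>i<m. k i t * Y i (\<gamma> t) f)" and
    par: "\<And>t f. t \<in> {0..1} \<Longrightarrow> (\<Sum>i<m. deriv (k i) t * Y i (\<gamma> t) f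
       + k i t * cov_deriv_at A flat (\<gamma> t) (velocity A \<gamma> t) (Y i) f) = 0"
    using V unfolding parallel_along_def by blast
  define W where "W t = (\<Sum>i<m. k i t *\<^sub>R cf (Y i) (\<gamma> t))" for t
  have VW: "V t = E (W t) (\<gamma> t)" if t: "t \<in> {0..1}" for t
  proof
    fix f
    have p: "\<gamma> t \<in> pts A" using smooth_curve_derivative(1)[OF \<gamma> t] .
    show "V t f = E (W t) (\<gamma> t) f"
      unfolding W_def Vt[OF t] using p kY by (simp add: E_cf E_sum_left)
  qed
  have dW: "((\<lambda>t. W t \<bullet> b) has_real_derivative 0) (at t)" if t: "t \<in> {0..1}" and b: "b \<in> Basis" for t b
  proof -
    note sc = smooth_curve_derivative[OF \<gamma> t]
    have p: "\<gamma> t \<in> pts A" and v: "velocity A \<gamma> t \<in> tangent_space A (\<gamma> t)" using sc by auto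
    \<comment> \<open>\<open>w\<close> is what the product rule gives for the derivative of
      \<open>W\<close>; the parallel equation says that the frame vector
      \<open>E w (\<gamma> t)\<close> vanishes.\<close>
    define w where "w = (\<Sum>i<m. deriv (k i) t *\<^sub>R cf (Y i) (\<gamma> t) + k i t *\<^sub>R dv (velocity A \<gamma> t) (cf (Y i)))"
    have "E w (\<gamma> t) f = 0" for f
      unfolding w_def using p kY par[OF t, of f]
      by (simp add: E_cf cov_deriv_at_flat[OF v p] E_sum_left)
    then have "E w (\<gamma> t) = E 0 (\<gamma> t)" using p by (auto simp: fun_eq_iff)
    then have w0: "w = 0" using E_inj[OF p] by blast
    have "((\<lambda>t. k i t * (cf (Y i) (\<gamma> t) \<bullet> b)) has_real_derivative
       (k i t * velocity A \<gamma> t (\<lambda>q. cf (Y i) q \<bullet> b) + deriv (k i) t * (cf (Y i) (\<gamma> t) \<bullet> b))) (at t)"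
      if i: "i < m" for i
    proof -
      have "(\<lambda>q. cf (Y i) q \<bullet> b) \<in> germs A (\<gamma> t)"
        using smooth_coeffs_cf[of "Y i"] kY[OF i] b p by (auto simp: smooth_coeffs_def smooth_funs_germs)
      from sc(3)[OF this]
      have 1: "((\<lambda>t. cf (Y i) (\<gamma> t) \<bullet> b) has_real_derivative velocity A \<gamma> t (\<lambda>q. cf (Y i) q \<bullet> b)) (at t)"
        by (simp add: o_def)
      have "k i differentiable (at t)" using smooth_on_differentiable kY[OF i] S t by blast
      then have 2: "(k i has_real_derivative deriv (k i) t) (at t)"
        by (metis DERIV_deriv_iff_real_differentiable)
      show ?thesis using DERIV_mult'[OF 2 1] .
    qed
    then have "((\<lambda>t. \<Sum>i<m. k i t * (cf (Y i) (\<gamma> t) \<bullet> b)) has_real_derivative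
       (\<Sum>i<m. k i t * velocity A \<gamma> t (\<lambda>q. cf (Y i) q \<bullet> b) + deriv (k i) t * (cf (Y i) (\<gamma> t) \<bullet> b))) (at t)"
      by (intro DERIV_sum) auto
    moreover have "(\<Sum>i<m. k i t * velocity A \<gamma> t (\<lambda>q. cf (Y i) q \<bullet> b) + deriv (k i) t * (cf (Y i) (\<gamma> t) \<bullet> b)) = w \<bullet> b"
      by (simp add: w_def inner_sum_left inner_add_left dv_inner b add.commute)
    ultimately show ?thesis by (simp add: W_def inner_sum_left w0)
  qed
  have "W 1 \<bullet> b = W 0 \<bullet> b" if b: "b \<in> Basis" for b
  proof (rule DERIV_isconst_end[of 0 1 "\<lambda>t. W t \<bullet> b"])
    show "continuous_on {0..1} (\<lambda>t. W t \<bullet> b)"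
      by (rule continuous_at_imp_continuous_on) (blast intro: DERIV_isCont[OF dW[OF _ b]])
    show "((\<lambda>t. W t \<bullet> b) has_real_derivative 0) (at t)" if "0 < t" "t < 1" for t
      by (rule dW[OF _ b]) (use that in simp)
  qed simp
  then have "W 1 = W 0" by (rule euclidean_eqI)
  moreover have "W 0 = u"
    by (rule E_inj[OF smooth_curve_derivative(1)[OF \<gamma>, of 0]]) (use VW[of 0] V0 in auto)
  ultimately show ?thesis using VW[of 1] by simp
qed

lemma transport_flat:
  "smooth_path A cs p q \<Longrightarrow> transport A flat cs (E u p) w \<Longrightarrow> w = E u q"
proof (induction cs arbitrary: p)
  case (Cons \<gamma> cs)
  then obtain V where V: "parallel_along A flat \<gamma> V" "V 0 = E u (\<gamma> 0)"
    "transport A flat cs (V 1) w" "smooth_curve A \<gamma>" "smooth_path A cs (\<gamma> 1) q" by auto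
  have "V 1 = E u (\<gamma> 1)" using parallel_flat[OF V(4,1,2)] .
  then show ?case using Cons.IH[OF V(5)] V(3) by simp
qed auto

lemma holonomy_flat:
  assumes p: "p \<in> pts A"
  shows "holonomy A flat p = {restrict (\<lambda>v. v) (tangent_space A p)}"
proof -
  have "P = restrict (\<lambda>v. v) (tangent_space A p)" if P: "P \<in> holonomy A flat p" for P
  proof (rule extensionalityI[of _ "tangent_space A p"])
    show "P \<in> extensional (tangent_space A p)" using P by (simp add: holonomy_def)
    fix v assume v: "v \<in> tangent_space A p"
    then obtain u where u: "v = E u p" using E_surj p by blast
    obtain cs where "smooth_path A cs p p" "transport A flat cs (E u p) (P v)"
      using P v unfolding u holonomy_def by blast
    then have "P v = v" unfolding u by (rule transport_flat)
    then show "P v = restrict (\<lambda>v. v) (tangent_space A p) v" using v by simp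
  qed auto
  \<comment> \<open>The empty list is the constant path at \<open>p\<close>, so the identity is
    always a holonomy.\<close>
  moreover have "restrict (\<lambda>v. v) (tangent_space A p) \<in> holonomy A flat p"
    by (auto simp: holonomy_def intro!: exI[of _ "[]"])
  ultimately show ?thesis by blast
qed

end

locale hermitian_frame = framed_manifold A E c + metric_complex_lie_algebra c J h
  for A :: "('p, 'e::euclidean_space) chart set" and E c J h +
  fixes g :: "'p metr"
  assumes g_E: "p \<in> pts A \<Longrightarrow> g p (E u p) (E v p) = h u v"
    and nonempty: "pts A \<noteq> {}"
begin

section \<open>Metric connections and the Levi-Civita connection\<close>

lemma g_cf: "X \<in> vfields A \<Longrightarrow> Y \<in> vfields A \<Longrightarrow> p \<in> pts A \<Longrightarrow> g p (X p) (Y p) = h (cf X p) (cf Y p)"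
  by (metis E_cf g_E)

lemma metric_connection_conn:
  assumes \<Gamma>: "bilinear \<Gamma>" and skew: "\<And>x y z. h (\<Gamma> x y) z + h y (\<Gamma> x z) = 0"
  shows "metric_connection A g (conn \<Gamma>)"
  unfolding metric_connection_def
proof (intro ballI)
  fix X Y Z p assume f: "X \<in> vfields A" "Y \<in> vfields A" "Z \<in> vfields A" and p: "p \<in> pts A"
  have t: "X p \<in> tangent_space A p" using vfields_tangent f p by blast
  have "X p (\<lambda>q. g q (Y q) (Z q)) = X p (\<lambda>q. h (cf Y q) (cf Z q))"
    by (rule tangent_cong[OF t]) (simp add: g_cf f)
  also have "\<dots> = h (dv (X p) (cf Y)) (cf Z p) + h (cf Y p) (dv (X p) (cf Z))"
    by (rule dv_bilinear_form[OF t p smooth_coeffs_cf[OF f(2)] smooth_coeffs_cf[OF f(3)] h_bilinear])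
  also have "\<dots> = g p (conn \<Gamma> X Y p) (Z p) + g p (Y p) (conn \<Gamma> X Z p)"
    using skew[of "cf X p" "cf Y p" "cf Z p"]
    by (simp add: g_cf conn_vfields[OF \<Gamma>] f p cf_conn)
  finally show "X p (\<lambda>q. g q (Y q) (Z q)) = g p (conn \<Gamma> X Y p) (Z p) + g p (Y p) (conn \<Gamma> X Z p)" .
qed

text \<open>Frame fields have constant inner products, so the derivative in the metric condition is
  that of a constant.\<close>

lemma metric_connection_skew:
  assumes D: "affine_connection A D" and m: "metric_connection A g D" and p: "p \<in> pts A"
  shows "h (chr D p u v) w + h v (chr D p u w) = 0"
proof -
  have "E u p (\<lambda>q. g q (E v q) (E w q)) = g p (D (E u) (E v) p) (E w p) + g p (E v p) (D (E u) (E w) p)"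
    using m p unfolding metric_connection_def by simp
  moreover have "E u p (\<lambda>q. g q (E v q) (E w q)) = E u p (\<lambda>q. h v w)"
    by (rule tangent_cong[OF E_tangent[OF p]]) (simp add: g_E)
  ultimately show ?thesis
    by (simp add: affine_E[OF D p] g_E p tangent_const[OF E_tangent[OF p]])
qed

lemma levi_civita_eq: "levi_civita A g = conn gam"
  unfolding levi_civita_def
proof (rule the_equality, intro conjI ballI)
  show "affine_connection A (conn gam)" using affine_connection_conn[OF gam_bilinear] .
  show "metric_connection A g (conn gam)"
    by (rule metric_connection_conn[OF gam_bilinear]) (simp add: gam_skew)
  show "torsion A (conn gam) X Y = zero_field" if "X \<in> vfields A" "Y \<in> vfields A" for X Y
    unfolding torsion_conn[OF gam_bilinear that] zero_field_eq
    by (rule fld_cong) (simp add: gam_torsion_free)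
next
  fix D assume *: "affine_connection A D \<and> metric_connection A g D \<and>
    (\<forall>X\<in>vfields A. \<forall>Y\<in>vfields A. torsion A D X Y = zero_field)"
  then have D: "affine_connection A D" and m: "metric_connection A g D" by auto
  show "D = conn gam"
  proof (rule affine_eq_conn[OF D gam_bilinear])
    fix p u v assume p: "p \<in> pts A"
    have "E (chr D p x y - chr D p y x - c x y) p = E 0 p" for x y
    proof
      fix f
      have "torsion A D (E x) (E y) p f = 0" using * by (simp add: zero_field_def)
      then show "E (chr D p x y - chr D p y x - c x y) p f = E 0 p f"
        unfolding torsion_affine_E[OF D p] using p by simp
    qed
    then have "chr D p x y - chr D p y x - c x y = 0" for x y using E_inj[OF p] by blast
    then show "chr D p u v = gam u v"
      by (intro gam_unique metric_connection_skew[OF D m p]) simp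
  qed
qed

lemma riemann_tensor_eq:
  assumes "X \<in> vfields A" "Y \<in> vfields A" "Z \<in> vfields A" "W \<in> vfields A" "p \<in> pts A"
  shows "riemann_tensor A g X Y Z W p = curv (cf X p) (cf Y p) (cf Z p) (cf W p)"
  unfolding riemann_tensor_def levi_civita_eq curv_def
  using assms curvature_conn[OF gam_bilinear assms(1-3)] E_cf[OF assms(4,5)] g_E[OF assms(5)]
  by (metis (no_types, lifting) fld_apply)

text \<open>\<open>K\<close> is the constant matrix of \<open>I\<close> in the frame. Arguing
  through \<open>K\<close> lets \<open>J\<close> and \<open>J\<^sup>-\<close> share what
  follows.\<close>

definition endo :: "'p endo \<Rightarrow> ('e \<Rightarrow> 'e) \<Rightarrow> bool" where
  "endo I K \<longleftrightarrow> linear K \<and> (\<forall>x. K (K x) = - x) \<and> (\<forall>x y. h (K x) (K y) = h x y) \<and>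
     (\<forall>p\<in>pts A. \<forall>u. I p (E u p) = E (K u) p)"

lemma endoD:
  assumes "endo I K"
  shows "linear K" "K (K x) = - x" "h (K x) (K y) = h x y" "p \<in> pts A \<Longrightarrow> I p (E u p) = E (K u) p"
  using assms by (auto simp: endo_def)

lemma app_eq: "endo I K \<Longrightarrow> X \<in> vfields A \<Longrightarrow> app A I X = fld (\<lambda>p. K (cf X p))"
  unfolding app_def fld_def by (rule ext) (metis E_cf endoD(4))

lemma app_vfields: "endo I K \<Longrightarrow> X \<in> vfields A \<Longrightarrow> app A I X \<in> vfields A"
  using app_eq fld_vfields smooth_coeffs_map smooth_coeffs_cf endoD(1) by metis

lemma cf_app: "endo I K \<Longrightarrow> X \<in> vfields A \<Longrightarrow> p \<in> pts A \<Longrightarrow> cf (app A I X) p = K (cf X p)"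
  by (simp add: app_eq)

lemma field_uminus_eq: "X \<in> vfields A \<Longrightarrow> (\<lambda>p f. - X p f) = fld (\<lambda>p. - cf X p)"
  by (rule vfields_eq_fldI) (auto simp: E_cf_apply vfields_zero)

lemma field_uminus: "X \<in> vfields A \<Longrightarrow> (\<lambda>p f. - X p f) \<in> vfields A"
  unfolding field_uminus_eq
  using fld_vfields[OF smooth_coeffs_scale[OF smooth_funs_const smooth_coeffs_cf], of X "-1"] by simp

lemma cf_uminus: "X \<in> vfields A \<Longrightarrow> p \<in> pts A \<Longrightarrow> cf (\<lambda>p f. - X p f) p = - cf X p"
  by (simp add: field_uminus_eq)

lemma type10D:
  assumes I: "endo I K" and Z: "Z \<in> type10 A I"
  shows "fst Z \<in> vfields A" "snd Z \<in> vfields A" "p \<in> pts A \<Longrightarrow> cf (snd Z) p = - K (cf (fst Z) p)"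
proof -
  show f: "fst Z \<in> vfields A" "snd Z \<in> vfields A" using Z by (auto simp: type10_def)
  have "app A I (fst Z) = (\<lambda>p f. - snd Z p f)" using Z by (auto simp: type10_def)
  then show "p \<in> pts A \<Longrightarrow> cf (snd Z) p = - K (cf (fst Z) p)"
    using cf_app[OF I f(1), of p] cf_uminus[OF f(2), of p] by (metis minus_minus)
qed

text \<open>Pairs of frame fields realise every (1,0) vector at a point; this is what extracts an
  algebraic condition from a condition on all fields.\<close>

lemma E_type10:
  assumes I: "endo I K"
  shows "(E u, E (- K u)) \<in> type10 A I"
proof -
  have "app A I (E u) = (\<lambda>p f. - E (- K u) p f)"
    unfolding app_eq[OF I E_field] field_uminus_eq[OF E_field] by (rule fld_cong) simp
  moreover have "app A I (E (- K u)) = E u"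
    using fld_cf[OF E_field, of u] unfolding app_eq[OF I E_field]
    by (metis (no_types, lifting) fld_cong cf_E endoD(1,2)[OF I] linear_neg minus_minus)
  ultimately show ?thesis by (simp add: type10_def)
qed

lemma type10_conj:
  assumes I: "endo I K" and Z: "Z \<in> type10 A I"
  shows "snd (conj_field Z) \<in> vfields A" "p \<in> pts A \<Longrightarrow> cf (snd (conj_field Z)) p = K (cf (fst Z) p)"
  using type10D[OF I Z] by (simp_all add: conj_field_def field_uminus cf_uminus)

lemma part_sel:
  assumes "fst Z \<in> vfields A" "snd Z \<in> vfields A"
  shows "part k Z \<in> vfields A" "cf (part k Z) p = sel k (cf (fst Z) p, cf (snd Z) p)"
  using assms by (auto simp: part_def sel_def)

text \<open>A tensor sees its fields only through their coefficients at \<open>p\<close>, and this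
  persists after complexification.\<close>

lemma cext4_eq:
  assumes "\<And>X Y Z W. X \<in> vfields A \<Longrightarrow> Y \<in> vfields A \<Longrightarrow> Z \<in> vfields A \<Longrightarrow> W \<in> vfields A \<Longrightarrow>
      T X Y Z W = T' (cf X p) (cf Y p) (cf Z p) (cf W p)"
    and "fst Z1 \<in> vfields A" "snd Z1 \<in> vfields A" "fst Z2 \<in> vfields A" "snd Z2 \<in> vfields A"
    "fst Z3 \<in> vfields A" "snd Z3 \<in> vfields A" "fst Z4 \<in> vfields A" "snd Z4 \<in> vfields A"
  shows "cext4 T Z1 Z2 Z3 Z4 = ext4 T' (cf (fst Z1) p, cf (snd Z1) p) (cf (fst Z2) p, cf (snd Z2) p)
    (cf (fst Z3) p, cf (snd Z3) p) (cf (fst Z4) p, cf (snd Z4) p)"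
  unfolding cext4_def ext4_def
  using assms part_sel by simp

lemma cext3_eq:
  assumes "\<And>X Y Z. X \<in> vfields A \<Longrightarrow> Y \<in> vfields A \<Longrightarrow> Z \<in> vfields A \<Longrightarrow>
      T X Y Z = T' (cf X p) (cf Y p) (cf Z p)"
    and "fst Z1 \<in> vfields A" "snd Z1 \<in> vfields A" "fst Z2 \<in> vfields A" "snd Z2 \<in> vfields A"
    "fst Z3 \<in> vfields A" "snd Z3 \<in> vfields A"
  shows "cext3 T Z1 Z2 Z3 = ext3 T' (cf (fst Z1) p, cf (snd Z1) p) (cf (fst Z2) p, cf (snd Z2) p)
    (cf (fst Z3) p, cf (snd Z3) p)"
  unfolding cext3_def ext3_def
  using assms part_sel by simp

lemma endo_J: "endo I J \<longleftrightarrow> (\<forall>p\<in>pts A. \<forall>u. I p (E u p) = E (J u) p)"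
  by (simp add: endo_def J_linear)

lemma endo_Kminus: "endo I Kminus \<longleftrightarrow> (\<forall>p\<in>pts A. \<forall>u. I p (E u p) = E (Kminus u) p)"
  by (simp add: endo_def Kminus_linear Kminus_Kminus Kminus_isometric)

lemma fst_conj_field [simp]: "fst (conj_field Z) = fst Z"
  by (simp add: conj_field_def)

lemma second_gray_iff:
  assumes I: "endo I J"
  shows "second_gray A g I \<longleftrightarrow> (\<forall>x y z. c x (c y z) = 0)"
proof
  assume G: "second_gray A g I"
  obtain p where p: "p \<in> pts A" using nonempty by blast
  have "ext4 curv (x, J x) (y, - J y) (z, - J z) (w, - J w) = 0" for x y z w
  proof -
    let ?Z = "\<lambda>u. (E u, E (- J u))"
    have t: "?Z u \<in> type10 A I" for u using E_type10[OF I] .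
    have "cext4 (\<lambda>X Y Z W. riemann_tensor A g X Y Z W p) (conj_field (?Z x)) (?Z y) (?Z z) (?Z w) = 0"
      using G t p unfolding second_gray_def by blast
    then show ?thesis
      by (subst (asm) cext4_eq[where p = p and T' = curv])
        (use p type10_conj[OF I t] in \<open>auto simp: riemann_tensor_eq\<close>)
  qed
  then show "\<forall>x y z. c x (c y z) = 0" using curv_ext4_zero_iff by blast
next
  assume n: "\<forall>x y z. c x (c y z) = 0"
  show "second_gray A g I"
    unfolding second_gray_def
  proof (intro ballI conjI)
    fix Z1 Z2 Z3 Z4 p
    assume Z: "Z1 \<in> type10 A I" "Z2 \<in> type10 A I" "Z3 \<in> type10 A I" "Z4 \<in> type10 A I"
      and p: "p \<in> pts A"
    note Zs = Z[THEN type10D(1)[OF I]] Z[THEN type10D(2)[OF I]]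
    show "cext4 (\<lambda>X Y Z W. riemann_tensor A g X Y Z W p) Z1 Z2 Z3 Z4 = 0"
      by (subst cext4_eq[where p = p and T' = curv])
        (use p Zs in \<open>auto simp: riemann_tensor_eq Z[THEN type10D(3)[OF I _ p]] curv_ext4_10\<close>)
    show "cext4 (\<lambda>X Y Z W. riemann_tensor A g X Y Z W p) (conj_field Z1) Z2 Z3 Z4 = 0"
      by (subst cext4_eq[where p = p and T' = curv])
        (use p Zs n curv_ext4_zero_iff type10_conj[OF I Z(1)] in
          \<open>auto simp: riemann_tensor_eq Z[THEN type10D(3)[OF I _ p]]\<close>)
  qed
qed

lemma fundamental_form_eq:
  assumes I: "endo I K" and "X \<in> vfields A" "Y \<in> vfields A" "p \<in> pts A"
  shows "fundamental_form g I X Y p = h (cf X p) (K (cf Y p))"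
proof -
  have "fundamental_form g I X Y p = g p (X p) (app A I Y p)"
    using assms by (simp add: fundamental_form_def app_def)
  then show ?thesis using g_cf[OF assms(2) app_vfields[OF I assms(3)] assms(4)] cf_app[OF I assms(3,4)] by simp
qed

text \<open>The fundamental form has constant coefficients in the frame, so the derivatives of the
  coefficient functions cancel between the outer derivatives and the brackets; the skew-symmetry
  \<open>Ks\<close> matches the terms.\<close>

lemma ext_deriv2_eq:
  assumes I: "endo I K" and X: "X \<in> vfields A" and Y: "Y \<in> vfields A" and Z: "Z \<in> vfields A"
    and p: "p \<in> pts A"
  shows "ext_deriv2 A (fundamental_form g I) X Y Z p = dform K (cf X p) (cf Y p) (cf Z p)"
proof -
  have K: "bilinear (\<lambda>x y. h x (K y))"
    unfolding bilinear_def
    by (auto intro!: linearI simp: linear_add[OF endoD(1)[OF I]] linear_cmul[OF endoD(1)[OF I]])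
  have Ks: "h x (K y) = - h y (K x)" for x y
    using endoD(3)[OF I, of x "K y"] h_sym[of "K x" y] by (simp add: endoD(2)[OF I])
  have d: "X p (fundamental_form g I Y Z) = h (dv (X p) (cf Y)) (K (cf Z p)) + h (cf Y p) (K (dv (X p) (cf Z)))"
    if X: "X \<in> vfields A" and Y: "Y \<in> vfields A" and Z: "Z \<in> vfields A" for X Y Z
  proof -
    have t: "X p \<in> tangent_space A p" using vfields_tangent[OF X p] .
    have "X p (fundamental_form g I Y Z) = X p (\<lambda>q. h (cf Y q) (K (cf Z q)))"
      by (rule tangent_cong[OF t]) (rule fundamental_form_eq[OF I Y Z])
    then show ?thesis
      using dv_bilinear_form[OF t p smooth_coeffs_cf[OF Y] smooth_coeffs_cf[OF Z] K] by simp
  qed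
  note b = bracket_vfields
  show ?thesis
    unfolding ext_deriv2_def dform_def d[OF X Y Z] d[OF Y X Z] d[OF Z X Y]
      fundamental_form_eq[OF I b[OF X Y] Z p] fundamental_form_eq[OF I b[OF X Z] Y p]
      fundamental_form_eq[OF I b[OF Y Z] X p] cf_bracket[OF X Y p] cf_bracket[OF X Z p] cf_bracket[OF Y Z p]
    using Ks[of "cf Y p" "dv (X p) (cf Z)"] Ks[of "cf X p" "dv (Y p) (cf Z)"] Ks[of "cf X p" "dv (Z p) (cf Y)"]
    by simp
qed

lemma quasi_kaehler_iff:
  assumes I: "endo I Kminus"
  shows "quasi_kaehler A g I \<longleftrightarrow> (\<forall>x y z. c x (c y z) = 0)"
proof
  assume G: "quasi_kaehler A g I"
  obtain p where p: "p \<in> pts A" using nonempty by blast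
  have "ext3 (dform Kminus) (x, - Kminus x) (y, Kminus y) (z, Kminus z) = 0" for x y z
  proof -
    let ?Z = "\<lambda>u. (E u, E (- Kminus u))"
    have t: "?Z u \<in> type10 A I" for u using E_type10[OF I] .
    have "cext3 (\<lambda>X Y Z. ext_deriv2 A (fundamental_form g I) X Y Z p) (?Z x) (conj_field (?Z y)) (conj_field (?Z z)) = 0"
      using G t p unfolding quasi_kaehler_def by blast
    then show ?thesis
      by (subst (asm) cext3_eq[where p = p and T' = "dform Kminus"])
        (use p type10_conj[OF I t] in \<open>auto simp: ext_deriv2_eq[OF I]\<close>)
  qed
  then show "\<forall>x y z. c x (c y z) = 0" using dform_ext3_zero_iff by blast
next
  assume n: "\<forall>x y z. c x (c y z) = 0"
  show "quasi_kaehler A g I"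
    unfolding quasi_kaehler_def
  proof (intro ballI)
    fix Z1 Z2 Z3 p
    assume Z: "Z1 \<in> type10 A I" "Z2 \<in> type10 A I" "Z3 \<in> type10 A I" and p: "p \<in> pts A"
    note Zs = Z[THEN type10D(1)[OF I]] Z[THEN type10D(2)[OF I]]
    show "cext3 (\<lambda>X Y Z. ext_deriv2 A (fundamental_form g I) X Y Z p) Z1 (conj_field Z2) (conj_field Z3) = 0"
      by (subst cext3_eq[where p = p and T' = "dform Kminus"])
        (use p Zs n dform_ext3_zero_iff type10_conj[OF I Z(2)] type10_conj[OF I Z(3)] in
          \<open>auto simp: ext_deriv2_eq[OF I] Z[THEN type10D(3)[OF I _ p]]\<close>)
  qed
qed

text \<open>The two conditions \<open>cK\<close> are the real and imaginary parts of the vanishing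
  of \<open>c\<close> on a (1,0) and a (0,1) vector for \<open>K\<close>. They ask for no
  \<open>K\<close>-linearity of \<open>c\<close>, and so hold for \<open>Kminus\<close> as well as
  for \<open>J\<close>.\<close>

lemma chern_connection_eq:
  assumes I: "endo I K" and cK: "\<And>x y. c (K x) (K y) = - c x y" "\<And>x y. c (K x) y = c x (K y)"
  shows "chern_connection A g I = flat"
proof -
  note K = endoD[OF I]
  have b0: "bilinear (\<lambda>_ _. 0 :: 'e)" by (auto simp: bilinear_def intro: linearI)
  have cext2: "cext2 T Z W = complex_of_real (T (fst Z) (fst W)) - complex_of_real (T (snd Z) (snd W)) +
      \<i> * (complex_of_real (T (fst Z) (snd W)) + complex_of_real (T (snd Z) (fst W)))"
    for T :: "'p field \<Rightarrow> 'p field \<Rightarrow> real" and Z W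
    by (simp add: cext2_def sum_lessThan_2 part_def algebra_simps)
  show ?thesis
    unfolding chern_connection_def
  proof (rule the_equality, intro conjI ballI allI)
    show "affine_connection A flat" using affine_connection_conn[OF b0] .
    show "metric_connection A g flat" using metric_connection_conn[OF b0] by simp
    show "flat X (app A I Y) = app A I (flat X Y)"
      if X: "X \<in> vfields A" and Y: "Y \<in> vfields A" for X Y
    proof (rule vfields_eqI)
      show "flat X (app A I Y) \<in> vfields A" "app A I (flat X Y) \<in> vfields A"
        by (intro conn_vfields[OF b0] app_vfields[OF I] X Y)+
      fix p assume p: "p \<in> pts A"
      have t: "X p \<in> tangent_space A p" using vfields_tangent[OF X p] .
      have "dv (X p) (cf (app A I Y)) = dv (X p) (\<lambda>q. K (cf Y q))"
        by (rule dv_cong[OF t]) (rule cf_app[OF I Y])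
      then show "cf (flat X (app A I Y)) p = cf (app A I (flat X Y)) p"
        by (simp add: cf_conn X app_vfields[OF I] Y p cf_app[OF I conn_vfields[OF b0 X Y]]
            dv_map[OF t p smooth_coeffs_cf[OF Y] K(1)])
    qed
    fix Z W p f assume Z: "Z \<in> type10 A I" and W: "W \<in> type10 A I"
    note z = type10D[OF I Z] and w = type10D(1)[OF I W] type10_conj[OF I W]
    show "cext2 (\<lambda>X Y. torsion A flat X Y p f) Z (conj_field W) = 0"
    proof (cases "p \<in> pts A")
      case p: True
      show ?thesis
        by (simp add: cext2 torsion_conn[OF b0] z w fld_apply p complex_eq_iff)
          (simp add: bilinear_lneg[OF c_bilin] bilinear_rneg[OF c_bilin] cK K(2) p)
    next
      case False
      then show ?thesis by (simp add: cext2 torsion_conn[OF b0] z w fld_def)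
    qed
  next
    fix D assume *: "affine_connection A D \<and> metric_connection A g D \<and>
     (\<forall>X\<in>vfields A. \<forall>Y\<in>vfields A. D X (app A I Y) = app A I (D X Y)) \<and>
     (\<forall>Z\<in>type10 A I. \<forall>W\<in>type10 A I. \<forall>p f.
        cext2 (\<lambda>X Y. torsion A D X Y p f) Z (conj_field W) = 0)"
    then have D: "affine_connection A D" and m: "metric_connection A g D" by auto
    show "D = flat"
    proof (rule affine_eq_conn[OF D b0])
      fix p u v assume p: "p \<in> pts A"
      have S_I: "chr D p x (K y) = K (chr D p x y)" for x y
      proof -
        have "app A I (E y) = fld (\<lambda>q. K (cf (E y) q))" by (rule app_eq[OF I E_field])
        also have "\<dots> = fld (cf (E (K y)))" by (rule fld_cong) simp
        finally have "app A I (E y) = E (K y)" by simp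
        moreover have "D (E x) (app A I (E y)) = app A I (D (E x) (E y))" using * by simp
        moreover have "D (E x) (E y) \<in> vfields A" using D unfolding affine_connection_def by simp
        ultimately show ?thesis
          using cf_app[OF I, of "D (E x) (E y)" p] p affine_cf_E[OF D p] by metis
      qed
      define T where "T x y = chr D p x y - chr D p y x - c x y" for x y
      have Tb: "T (- x) y = - T x y" for x y
        by (simp add: T_def bilinear_lneg[OF chr_bilinear] bilinear_rneg[OF chr_bilinear])
      \<comment> \<open>The real and imaginary parts of the torsion on x - i K x and y + i K
        y.\<close>
      have T: "T x y + T (K x) (K y) = 0 \<and> T x (K y) - T (K x) y = 0" for x y
      proof -
        have cj: "snd (conj_field (E y, E (- K y))) = E (K y)"
        proof (rule vfields_eqI)
          show "snd (conj_field (E y, E (- K y))) \<in> vfields A"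
            using type10_conj(1)[OF I E_type10[OF I]] .
          show "cf (snd (conj_field (E y, E (- K y)))) p = cf (E (K y)) p" if "p \<in> pts A" for p
            using type10_conj(2)[OF I E_type10[OF I] that, of y] that by simp
        qed simp
        have "cext2 (\<lambda>X Y. torsion A D X Y p f) (E x, E (- K x)) (conj_field (E y, E (- K y))) = 0" for f
          using * E_type10[OF I] by blast
        then have "E (T x y - T (- K x) (K y)) p f = E 0 p f \<and> E (T x (K y) + T (- K x) y) p f = E 0 p f" for f
          unfolding cext2 cj T_def using p
          by (simp add: torsion_affine_E[OF D p] complex_eq_iff)
        then have "T x y - T (- K x) (K y) = 0 \<and> T x (K y) + T (- K x) y = 0"
          by (metis E_inj[OF p] ext)
        then show ?thesis by (simp add: Tb)
      qed
      show "chr D p u v = 0"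
      \<comment> \<open>By \<open>cK\<close> the bracket drops out of the torsion conditions, which
        become conditions on the Christoffel symbols alone.\<close>
      proof (rule chern_rigidity[OF K(2,3) chr_bilinear metric_connection_skew[OF D m p] S_I K(1)])
        show "chr D p x y - chr D p y x + (chr D p (K x) (K y) - chr D p (K y) (K x)) = 0" for x y
          using T[of x y] by (simp add: T_def cK(1) algebra_simps)
        show "chr D p x (K y) - chr D p (K y) x - (chr D p (K x) y - chr D p y (K x)) = 0" for x y
          using T[of x y] by (simp add: T_def cK(2))
      qed
    qed
  qed
qed

lemma chern_flat_J: "endo I J \<Longrightarrow> chern_flat A g I"
  unfolding chern_flat_def by (subst chern_connection_eq[where K = J]) (auto simp: holonomy_flat)

lemma chern_flat_Kminus: "endo I Kminus \<Longrightarrow> chern_flat A g I"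
  unfolding chern_flat_def by (subst chern_connection_eq[where K = Kminus]) (auto simp: holonomy_flat c_Kminus c_Kminus')

end

section \<open>Left-invariant fields on a complex Lie group\<close>

lemma frechet_derivative_partial:
  fixes F :: "'e::euclidean_space \<times> 'f::euclidean_space \<Rightarrow> 'g::real_normed_vector"
  assumes "F differentiable (at (x, y))"
  shows "der (\<lambda>y. F (x, y)) y u = der F (x, y) (0, u)"
    and "der (\<lambda>x. F (x, y)) x v = der F (x, y) (v, 0)"
proof -
  have F: "(F has_derivative der F (x, y)) (at (x, y))"
    using assms frechet_derivative_works by blast
  have "((\<lambda>y. (x, y)) has_derivative (\<lambda>u. (0, u))) (at y)"
    "((\<lambda>x. (x, y)) has_derivative (\<lambda>v. (v, 0))) (at x)"
    by (auto intro!: derivative_eq_intros)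
  from this[THEN has_derivative_compose, OF F]
  show "der (\<lambda>y. F (x, y)) y u = der F (x, y) (0, u)"
    and "der (\<lambda>x. F (x, y)) x v = der F (x, y) (v, 0)"
    by (simp_all add: frechet_derivative_eqI)
qed

text \<open>Symmetry of second derivatives makes the moving vector the outer direction, where
  linearity of the derivative reassembles its basis expansion.\<close>

lemma frechet_derivative_apply:
  fixes F :: "'e::euclidean_space \<Rightarrow> real" and \<eta> :: "'e \<Rightarrow> 'e"
  assumes S: "open S" "smooth_on S F" "smooth_on S \<eta>" "x \<in> S"
  shows "der (\<lambda>z. der F z (\<eta> z)) x w =
    der F x (der \<eta> x w) +
    der (\<lambda>z. der F z w) x (\<eta> x)"
proof -
  have dF: "F differentiable (at z)" if "z \<in> S" for z using smooth_on_differentiable[OF S(2) that] .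
  have dDF: "(\<lambda>z. der F z b) differentiable (at x)" for b
    using smooth_on_differentiable[OF smooth_on_frechet_derivative[OF S(2)] S(4)] .
  have d\<eta>: "\<eta> differentiable (at x)" using smooth_on_differentiable[OF S(3,4)] .
  have l: "linear (der F z)" if "z \<in> S" for z
    using linear_frechet_derivative[OF dF[OF that]] .
  have "((\<lambda>z. \<Sum>b\<in>Basis. (\<eta> z \<bullet> b) *\<^sub>R der F z b) has_derivative
    (\<lambda>w. \<Sum>b\<in>Basis. (\<eta> x \<bullet> b) *\<^sub>R der (\<lambda>z. der F z b) x w +
       (der \<eta> x w \<bullet> b) *\<^sub>R der F x b)) (at x)"
    by (intro has_derivative_sum has_derivative_scaleR has_derivative_inner_left
        d\<eta>[unfolded frechet_derivative_works] dDF[unfolded frechet_derivative_works])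
  then have "((\<lambda>z. der F z (\<eta> z)) has_derivative
    (\<lambda>w. \<Sum>b\<in>Basis. (\<eta> x \<bullet> b) *\<^sub>R der (\<lambda>z. der F z b) x w +
       (der \<eta> x w \<bullet> b) *\<^sub>R der F x b)) (at x)"
    by (rule has_derivative_transform_within_open[OF _ S(1,4)])
      (rule linear_eq_sum_Basis[OF l, symmetric])
  then have "der (\<lambda>z. der F z (\<eta> z)) x w =
    (\<Sum>b\<in>Basis. (\<eta> x \<bullet> b) *\<^sub>R der (\<lambda>z. der F z b) x w) +
    (\<Sum>b\<in>Basis. (der \<eta> x w \<bullet> b) *\<^sub>R der F x b)"
    by (simp add: frechet_derivative_eqI sum.distrib)
  also have "(\<Sum>b\<in>Basis. (\<eta> x \<bullet> b) *\<^sub>R der (\<lambda>z. der F z b) x w) =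
    (\<Sum>b\<in>Basis. (\<eta> x \<bullet> b) *\<^sub>R der (\<lambda>z. der F z w) x b)"
    by (simp add: symmetric_second_derivative[OF S(1,2,4), of _ w])
  also have "\<dots> = der (\<lambda>z. der F z w) x (\<eta> x)"
    by (rule linear_eq_sum_Basis[OF linear_frechet_derivative[OF dDF], symmetric])
  also have "(\<Sum>b\<in>Basis. (der \<eta> x w \<bullet> b) *\<^sub>R der F x b) =
     der F x (der \<eta> x w)"
    by (rule linear_eq_sum_Basis[OF l[OF S(4)], symmetric])
  finally show ?thesis by simp
qed

context smooth_charts
begin

section \<open>Tangent vectors and brackets in coordinates\<close>

lemma inv_chart: "(U, \<phi>) \<in> A \<Longrightarrow> p \<in> U \<Longrightarrow> inv_into U \<phi> (\<phi> p) = p"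
  using chart_inj inv_into_f_f by metis

lemma coord_vec_tangent: "(U, \<phi>) \<in> A \<Longrightarrow> p \<in> U \<Longrightarrow> coord_vec A (U, \<phi>) p u \<in> tangent_space A p"
  by (force simp: tangent_space_def)

lemma coordinate_germ: "(U, \<phi>) \<in> A \<Longrightarrow> p \<in> U \<Longrightarrow> (\<lambda>q. \<phi> q \<bullet> b) \<in> germs A p"
proof -
  assume c: "(U, \<phi>) \<in> A" "p \<in> U"
  have "smooth_on (\<phi> ` U) ((\<lambda>q. \<phi> q \<bullet> b) \<circ> inv_into U \<phi>)"
    by (rule smooth_on_cong[OF chart_open[OF c(1)] _
        smooth_on_bounded_linear[OF chart_open[OF c(1)] bounded_linear_inner_left smooth_on_id]])
      (simp add: f_inv_into_f)
  then show ?thesis using c chart_open by (intro germsI[of U \<phi> p "\<phi> ` U"]) auto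
qed

lemma coord_vec_coordinate:
  assumes c: "(U, \<phi>) \<in> A" "p \<in> U"
  shows "coord_vec A (U, \<phi>) p u (\<lambda>q. \<phi> q \<bullet> b) = u \<bullet> b"
proof -
  have "der (\<lambda>x. x \<bullet> b) (\<phi> p) =
      der ((\<lambda>q. \<phi> q \<bullet> b) \<circ> inv_into U \<phi>) (\<phi> p)"
    by (rule frechet_derivative_transform_within_open[OF _ chart_open[OF c(1)]])
      (use c in \<open>auto simp: f_inv_into_f intro: bounded_linear_imp_differentiable bounded_linear_inner_left\<close>)
  moreover have "der (\<lambda>x. x \<bullet> b) (\<phi> p) u = u \<bullet> b"
    by (subst frechet_derivative_eqI[OF bounded_linear_imp_has_derivative[OF bounded_linear_inner_left]]) simp
  ultimately show ?thesis using coordinate_germ[OF c] by (simp add: coord_vec_def)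
qed

lemma coord_vec_inj:
  assumes "(U, \<phi>) \<in> A" "p \<in> U" "coord_vec A (U, \<phi>) p u = coord_vec A (U, \<phi>) p v"
  shows "u = v"
  by (rule euclidean_eqI) (metis assms coord_vec_coordinate)

lemma coord_vec_linear:
  assumes "(U, \<phi>) \<in> A" "p \<in> U"
  shows "linear (\<lambda>u. coord_vec A (U, \<phi>) p u f)"
proof (cases "f \<in> germs A p")
  case True
  then have "(f \<circ> inv_into U \<phi>) differentiable (at (\<phi> p))"
    using germ_chart[OF assms True] smooth_on_differentiable by blast
  from linear_frechet_derivative[OF this] show ?thesis using True by (simp add: coord_vec_def)
qed (simp add: coord_vec_def linear_zero)

text \<open>In the commutator the second derivatives of \<open>F\<close> cancel by symmetry, leaving
  the derivatives of the coefficient maps.\<close>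

lemma bracket_coord_vec:
  assumes c: "(U, \<phi>) \<in> A" "p \<in> U" and f: "f \<in> germs A p"
    and X: "\<And>q. q \<in> U \<Longrightarrow> X q = coord_vec A (U, \<phi>) q (\<xi> (\<phi> q))" "X \<in> vfields A" "smooth_on (\<phi> ` U) \<xi>"
    and Y: "\<And>q. q \<in> U \<Longrightarrow> Y q = coord_vec A (U, \<phi>) q (\<eta> (\<phi> q))" "Y \<in> vfields A" "smooth_on (\<phi> ` U) \<eta>"
  shows "bracket A X Y p f = coord_vec A (U, \<phi>) p
    (der \<eta> (\<phi> p) (\<xi> (\<phi> p)) - der \<xi> (\<phi> p) (\<eta> (\<phi> p))) f"
proof -
  define F where "F = f \<circ> inv_into U \<phi>"
  obtain N where N: "open N" "\<phi> p \<in> N" "N \<subseteq> \<phi> ` U" "smooth_on N F"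
    using germ_chart[OF c f] unfolding F_def by blast
  have fN: "f \<in> germs A (inv_into U \<phi> x)" if "x \<in> N" for x
    using c(1) that N(1,3,4) unfolding F_def
    by (intro germsI[of U \<phi> _ N]) (auto simp: inv_into_into f_inv_into_f)
  have *: "X p (\<lambda>q. Y q f) = der F (\<phi> p) (der \<eta> (\<phi> p) (\<xi> (\<phi> p))) +
      der (\<lambda>z. der F z (\<xi> (\<phi> p))) (\<phi> p) (\<eta> (\<phi> p))"
    if X: "\<And>q. q \<in> U \<Longrightarrow> X q = coord_vec A (U, \<phi>) q (\<xi> (\<phi> q))"
      and Y: "\<And>q. q \<in> U \<Longrightarrow> Y q = coord_vec A (U, \<phi>) q (\<eta> (\<phi> q))" "Y \<in> vfields A" "smooth_on (\<phi> ` U) \<eta>"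
    for X Y \<xi> \<eta>
  proof -
    have g: "(\<lambda>q. Y q f) \<in> germs A p" using vfields_germs[OF Y(2) f] .
    have \<eta>: "smooth_on N \<eta>" using smooth_on_subset[OF Y(3) N(3)] .
    have "X p (\<lambda>q. Y q f) = der ((\<lambda>q. Y q f) \<circ> inv_into U \<phi>) (\<phi> p) (\<xi> (\<phi> p))"
      using X[OF c(2)] g by (simp add: coord_vec_def)
    also have "der ((\<lambda>q. Y q f) \<circ> inv_into U \<phi>) (\<phi> p) =
        der (\<lambda>z. der F z (\<eta> z)) (\<phi> p)"
    proof (rule sym, rule frechet_derivative_transform_within_open[OF _ N(1,2)])
      show "(\<lambda>z. der F z (\<eta> z)) differentiable at (\<phi> p)"
        using smooth_on_differentiable[OF smooth_on_frechet_derivative_apply[OF N(1,4) \<eta>] N(2)] .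
      show "der F z (\<eta> z) = ((\<lambda>q. Y q f) \<circ> inv_into U \<phi>) z" if z: "z \<in> N" for z
      proof -
        have "inv_into U \<phi> z \<in> U" "\<phi> (inv_into U \<phi> z) = z"
          using z N(3) by (auto simp: inv_into_into f_inv_into_f)
        then show ?thesis using Y(1) fN[OF z] by (simp add: coord_vec_def F_def)
      qed
    qed
    finally show ?thesis using frechet_derivative_apply[OF N(1,4) \<eta> N(2)] by simp
  qed
  have dF: "linear (der F (\<phi> p))"
    using linear_frechet_derivative smooth_on_differentiable N by blast
  show ?thesis
    using f *[OF X(1) Y] *[OF Y(1) X]
      symmetric_second_derivative[OF N(1,4,2), of "\<xi> (\<phi> p)" "\<eta> (\<phi> p)"]
    by (simp add: bracket_def coord_vec_def linear_diff[OF dF] flip: F_def)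
qed

end

section \<open>Complex atlases\<close>

lemma mult_i_linear: "linear (mult_i :: complex^'n \<Rightarrow> complex^'n)"
  by (rule linearI) (simp_all add: mult_i_def vec_eq_iff algebra_simps)

lemma mult_i_mult_i: "mult_i (mult_i x) = - x"
  by (simp add: mult_i_def vec_eq_iff)

lemma complex_atlasD:
  assumes "complex_atlas A"
  shows "pts A = UNIV"
    and "(U, \<phi>) \<in> A \<Longrightarrow> open U" "(U, \<phi>) \<in> A \<Longrightarrow> open (\<phi> ` U)" "(U, \<phi>) \<in> A \<Longrightarrow> inj_on \<phi> U"
    and "(U, \<phi>) \<in> A \<Longrightarrow> homeomorphism U (\<phi> ` U) \<phi> (inv_into U \<phi>)"
    and "(U, \<phi>) \<in> A \<Longrightarrow> (V, \<psi>) \<in> A \<Longrightarrow>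
      holo_on mult_i mult_i (\<phi> ` (U \<inter> V)) (\<psi> \<circ> inv_into U \<phi>)"
  using assms unfolding complex_atlas_def by fast+

lemma open_chart_image:
  assumes A: "complex_atlas A" and c: "(U, \<phi>) \<in> A" and W: "open W" "W \<subseteq> U"
  shows "open (\<phi> ` W)"
proof -
  have "openin (top_of_set U) W" using W by (simp add: open_subset)
  from homeomorphism_imp_open_map[OF complex_atlasD(5)[OF A c] this] show ?thesis
    using complex_atlasD(3)[OF A c] openin_open_eq by blast
qed

lemma smooth_charts_complex_atlas:
  assumes A: "complex_atlas A"
  shows "smooth_charts A"
proof
  show "(U, \<phi>) \<in> A \<Longrightarrow> open (\<phi> ` U)" "(U, \<phi>) \<in> A \<Longrightarrow> inj_on \<phi> U" for U \<phi>
    using complex_atlasD[OF A] by blast+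
  fix U \<phi> p f assume c: "(U, \<phi>) \<in> A" "p \<in> U" and f: "f \<in> germs A p"
  obtain V \<psi> N where d: "(V, \<psi>) \<in> A" "p \<in> V" and N: "open N" "\<psi> p \<in> N" "N \<subseteq> \<psi> ` V"
    "smooth_on N (f \<circ> inv_into V \<psi>)" using f by (auto simp: germs_def)
  define \<tau> where "\<tau> = \<psi> \<circ> inv_into U \<phi>"
  have inv: "inv_into U \<phi> (\<phi> q) = q" if "q \<in> U" for q
    using complex_atlasD(4)[OF A c(1)] that by simp
  have invV: "inv_into V \<psi> (\<psi> q) = q" if "q \<in> V" for q
    using complex_atlasD(4)[OF A d(1)] that by simp
  have op: "open (\<phi> ` (U \<inter> V))"
    by (rule open_chart_image[OF A c(1)]) (use complex_atlasD(2)[OF A] c d in auto)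
  have sm: "smooth_on (\<phi> ` (U \<inter> V)) \<tau>"
    using complex_atlasD(6)[OF A c(1) d(1)] by (simp add: holo_on_def \<tau>_def)
  define N' where "N' = {x \<in> \<phi> ` (U \<inter> V). \<tau> x \<in> N}"
  have "N' = \<phi> ` (U \<inter> V) \<inter> \<tau> -` N" by (auto simp: N'_def)
  then have oN': "open N'"
    using continuous_open_preimage[OF smooth_on_continuous[OF sm] op N(1)] by simp
  have "smooth_on N' (\<lambda>x. (f \<circ> inv_into V \<psi>) (\<tau> x))"
    by (rule smooth_on_compose[OF N(4) smooth_on_subset[OF sm] oN' N(1)]) (auto simp: N'_def)
  then have "smooth_on N' (f \<circ> inv_into U \<phi>)"
    by (rule smooth_on_cong[OF oN', rotated]) (auto simp: N'_def \<tau>_def inv invV)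
  moreover have "\<phi> p \<in> N'" using c d N by (auto simp: N'_def \<tau>_def inv)
  ultimately show "\<exists>N. open N \<and> \<phi> p \<in> N \<and> N \<subseteq> \<phi> ` U \<and> smooth_on N (f \<circ> inv_into U \<phi>)"
    using oN' by (intro exI[of _ N']) (auto simp: N'_def)
qed

text \<open>A chart around the unit is fixed once and for all. It identifies the Lie algebra with
  \<open>complex^'n\<close>, so that frame, bracket and metric become data on that type.\<close>

locale complex_lie_frame =
  fixes G :: "('a::topological_space, 'b) monoid_scheme" (structure)
    and A :: "('a, complex^'n) chart set" and V0 :: "'a set" and \<psi>0 :: "'a \<Rightarrow> complex^'n"
  assumes lie: "complex_lie_group G A" and unit_chart: "(V0, \<psi>0) \<in> A" "\<one> \<in> V0"
begin

lemma atlas: "complex_atlas A" and group: "group G" and carrier: "carrier G = UNIV"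
  using lie by (auto simp: complex_lie_group_def)

sublocale smooth_charts A
  using smooth_charts_complex_atlas[OF atlas] .

lemma pts_UNIV [simp]: "pts A = UNIV"
  using complex_atlasD(1)[OF atlas] .

lemma gr [simp]: "\<one> \<otimes> a = a" "a \<otimes> \<one> = a" "inv a \<otimes> a = \<one>" "a \<otimes> inv a = \<one>"
  and assoc: "a \<otimes> b \<otimes> d = a \<otimes> (b \<otimes> d)"
  and inv_cancel [simp]: "inv a \<otimes> (a \<otimes> b) = b" "a \<otimes> (inv a \<otimes> b) = b"
proof -
  interpret group G by (rule group)
  show "\<one> \<otimes> a = a" "a \<otimes> \<one> = a" "inv a \<otimes> a = \<one>" "a \<otimes> inv a = \<one>"
    "a \<otimes> b \<otimes> d = a \<otimes> (b \<otimes> d)"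
    by (simp_all add: carrier m_assoc)
  show "inv a \<otimes> (a \<otimes> b) = b" "a \<otimes> (inv a \<otimes> b) = b"
    by (simp_all add: carrier flip: m_assoc)
qed

lemma ex_chart: "\<exists>U \<phi>. (U, \<phi>) \<in> A \<and> a \<in> U"
  using pts_chart[of a] by simp

text \<open>\<open>mdom\<close> and \<open>mmap\<close> are the domain and the coordinate expression
  of the multiplication, the third chart receiving the product.\<close>

definition mdom :: "('a, complex^'n) chart \<Rightarrow> ('a, complex^'n) chart \<Rightarrow> ('a, complex^'n) chart \<Rightarrow>
    ((complex^'n) \<times> (complex^'n)) set" where
  "mdom c d e = {(x, y). x \<in> snd c ` fst c \<and> y \<in> snd d ` fst d \<and>
     inv_into (fst c) (snd c) x \<otimes> inv_into (fst d) (snd d) y \<in> fst e}"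

definition mmap :: "('a, complex^'n) chart \<Rightarrow> ('a, complex^'n) chart \<Rightarrow> ('a, complex^'n) chart \<Rightarrow>
    (complex^'n) \<times> (complex^'n) \<Rightarrow> complex^'n" where
  "mmap c d e = (\<lambda>(x, y). snd e (inv_into (fst c) (snd c) x \<otimes> inv_into (fst d) (snd d) y))"

lemma mmap_holo:
  assumes "c \<in> A" "d \<in> A" "e \<in> A"
  shows "open (mdom c d e)" "holo_on (map_prod mult_i mult_i) mult_i (mdom c d e) (mmap c d e)"
proof -
  have "\<forall>(U, \<phi>)\<in>A. \<forall>(V, \<psi>)\<in>A. \<forall>(W, \<theta>)\<in>A.
        (let N = {(x, y). x \<in> \<phi> ` U \<and> y \<in> \<psi> ` V \<and> inv_into U \<phi> x \<otimes>\<^bsub>G\<^esub> inv_into V \<psi> y \<in> W}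
        in open N \<and> holo_on (map_prod mult_i mult_i) mult_i N
             (\<lambda>(x, y). \<theta> (inv_into U \<phi> x \<otimes>\<^bsub>G\<^esub> inv_into V \<psi> y)))"
    using lie unfolding complex_lie_group_def by blast
  from bspec[OF bspec[OF bspec[OF this assms(1), unfolded case_prod_beta] assms(2),
        unfolded case_prod_beta] assms(3), unfolded case_prod_beta Let_def]
  show "open (mdom c d e)" "holo_on (map_prod mult_i mult_i) mult_i (mdom c d e) (mmap c d e)"
    unfolding mdom_def mmap_def case_prod_beta by blast+
qed

lemma mdomI:
  "c \<in> A \<Longrightarrow> d \<in> A \<Longrightarrow> a \<in> fst c \<Longrightarrow> b \<in> fst d \<Longrightarrow> a \<otimes> b \<in> fst e \<Longrightarrow> (snd c a, snd d b) \<in> mdom c d e"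
  using inv_chart[of "fst c" "snd c"] inv_chart[of "fst d" "snd d"] by (simp add: mdom_def)

lemma mult_germ:
  assumes f: "f \<in> germs A (a \<otimes> b)" and c: "(U, \<phi>) \<in> A" "a \<in> U" and d: "(V, \<psi>) \<in> A" "b \<in> V"
  shows "\<exists>N. open N \<and> (\<phi> a, \<psi> b) \<in> N \<and> N \<subseteq> \<phi> ` U \<times> \<psi> ` V \<and>
    smooth_on N (\<lambda>(x, y). f (inv_into U \<phi> x \<otimes> inv_into V \<psi> y))"
proof -
  obtain W \<theta> where e: "(W, \<theta>) \<in> A" "a \<otimes> b \<in> W" using ex_chart by blast
  obtain N where N: "open N" "\<theta> (a \<otimes> b) \<in> N" "N \<subseteq> \<theta> ` W" "smooth_on N (f \<circ> inv_into W \<theta>)"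
    using germ_chart[OF e f] by blast
  let ?D = "mdom (U, \<phi>) (V, \<psi>) (W, \<theta>)" and ?m = "mmap (U, \<phi>) (V, \<psi>) (W, \<theta>)"
  have D: "open ?D" and m: "smooth_on ?D ?m"
    using mmap_holo[OF c(1) d(1) e(1)] by (auto simp: holo_on_def)
  define N' where "N' = ?D \<inter> ?m -` N"
  have oN': "open N'"
    unfolding N'_def by (rule continuous_open_preimage[OF smooth_on_continuous[OF m] D N(1)])
  have "smooth_on N' (\<lambda>z. (f \<circ> inv_into W \<theta>) (?m z))"
    by (rule smooth_on_compose[OF N(4) smooth_on_subset[OF m] oN' N(1)]) (auto simp: N'_def)
  then have "smooth_on N' (\<lambda>(x, y). f (inv_into U \<phi> x \<otimes> inv_into V \<psi> y))"
    by (rule smooth_on_cong[OF oN', rotated])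
      (auto simp: N'_def mdom_def mmap_def inv_chart[OF e(1)])
  moreover have "(\<phi> a, \<psi> b) \<in> N'"
    using mdomI[OF c(1) d(1), of a b "(W, \<theta>)"] c d e N(2)
    by (simp add: N'_def mmap_def inv_chart[OF c] inv_chart[OF d])
  ultimately show ?thesis using oN' by (intro exI[of _ N']) (auto simp: N'_def mdom_def)
qed

lemma left_mult_germ:
  assumes f: "f \<in> germs A (a \<otimes> b)"
  shows "(\<lambda>x. f (a \<otimes> x)) \<in> germs A b"
proof -
  obtain U \<phi> where c: "(U, \<phi>) \<in> A" "a \<in> U" using ex_chart by blast
  obtain V \<psi> where d: "(V, \<psi>) \<in> A" "b \<in> V" using ex_chart by blast
  obtain N where N: "open N" "(\<phi> a, \<psi> b) \<in> N" "N \<subseteq> \<phi> ` U \<times> \<psi> ` V"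
    "smooth_on N (\<lambda>(x, y). f (inv_into U \<phi> x \<otimes> inv_into V \<psi> y))"
    using mult_germ[OF f c d] by blast
  let ?N = "(\<lambda>y. (\<phi> a, y)) -` N"
  have oN: "open ?N" by (rule open_vimage[OF N(1)]) (intro continuous_intros)
  have "smooth_on ?N (\<lambda>y. (\<lambda>(x, y). f (inv_into U \<phi> x \<otimes> inv_into V \<psi> y)) (\<phi> a, y))"
    by (rule smooth_on_compose[OF N(4) smooth_on_Pair[OF oN smooth_on_const smooth_on_id] oN N(1)]) auto
  then have "smooth_on ?N ((\<lambda>x. f (a \<otimes> x)) \<circ> inv_into V \<psi>)"
    by (simp add: o_def inv_chart[OF c])
  then show ?thesis using N d oN by (intro germsI[of V \<psi> b ?N]) auto
qed

lemma left_mult_germ_iff: "(\<lambda>x. f (a \<otimes> x)) \<in> germs A b \<longleftrightarrow> f \<in> germs A (a \<otimes> b)"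
  using left_mult_germ[of f a b] left_mult_germ[of "\<lambda>x. f (a \<otimes> x)" "inv a" "a \<otimes> b"] by auto

section \<open>Left-invariant fields from vectors at the unit\<close>

definition \<iota>0 :: "complex^'n \<Rightarrow> 'a" where
  "\<iota>0 = inv_into V0 \<psi>0"

definition y0 :: "complex^'n" where
  "y0 = \<psi>0 \<one>"

lemma \<iota>0_y0 [simp]: "\<iota>0 y0 = \<one>"
  by (simp add: \<iota>0_def y0_def inv_chart[OF unit_chart])

definition L :: "complex^'n \<Rightarrow> 'a field" where
  "L u a = left_diff G A a \<one> (coord_vec A (V0, \<psi>0) \<one> u)"

lemma L_apply:
  "L u a f = (if f \<in> germs A a then der (\<lambda>y. f (a \<otimes> \<iota>0 y)) y0 u else 0)"
  using left_mult_germ[of f a \<one>]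
  by (auto simp: L_def differential_def coord_vec_def o_def \<iota>0_def y0_def)

lemma L_at_unit: "L u \<one> = coord_vec A (V0, \<psi>0) \<one> u"
  by (rule ext) (simp add: L_apply coord_vec_def \<iota>0_def y0_def o_def)

lemma left_diff_L: "left_diff G A a b (L u b) = L u (a \<otimes> b)"
  by (rule ext) (auto simp: differential_def L_apply left_mult_germ o_def assoc)

text \<open>The coordinate vector of \<open>L u\<close> in the chart \<open>c\<close>, see
  \<open>L_coord_vec\<close>. Writing it as a partial derivative of the multiplication in both
  variables makes smoothness in \<open>x\<close> and complex linearity in \<open>u\<close>
  consequences of holomorphy.\<close>

definition lam :: "('a, complex^'n) chart \<Rightarrow> complex^'n \<Rightarrow> complex^'n \<Rightarrow> complex^'n" where
  "lam c u x = der (mmap c (V0, \<psi>0) c) (x, y0) (0, u)"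

lemma lam_dom:
  assumes c: "(U, \<phi>) \<in> A" "x \<in> \<phi> ` U"
  shows "(x, y0) \<in> mdom (U, \<phi>) (V0, \<psi>0) (U, \<phi>)"
proof -
  obtain a where a: "a \<in> U" "x = \<phi> a" using c by blast
  show ?thesis using mdomI[OF c(1) unit_chart(1), of a \<one> "(U, \<phi>)"] a unit_chart by (simp add: y0_def)
qed

lemma mmap_smooth: "c \<in> A \<Longrightarrow> d \<in> A \<Longrightarrow> e \<in> A \<Longrightarrow> smooth_on (mdom c d e) (mmap c d e)"
  using mmap_holo by (auto simp: holo_on_def)

lemma lam_smooth:
  assumes c: "(U, \<phi>) \<in> A"
  shows "smooth_on (\<phi> ` U) (lam (U, \<phi>) u)"
proof -
  let ?c = "(U, \<phi>)" and ?d = "(V0, \<psi>0)"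
  have "smooth_on (\<phi> ` U) (\<lambda>x. (\<lambda>z. der (mmap ?c ?d ?c) z (0, u)) (x, y0))"
    by (rule smooth_on_compose[OF smooth_on_frechet_derivative[OF mmap_smooth[OF c unit_chart(1) c]]
          smooth_on_Pair[OF chart_open[OF c] smooth_on_id smooth_on_const] chart_open[OF c]
          mmap_holo(1)[OF c unit_chart(1) c]])
      (use lam_dom[OF c] in auto)
  then show ?thesis by (simp add: lam_def[abs_def])
qed

lemma lam_linear:
  assumes c: "(U, \<phi>) \<in> A" "x \<in> \<phi> ` U"
  shows "linear (\<lambda>u. lam (U, \<phi>) u x)"
proof -
  have "mmap (U, \<phi>) (V0, \<psi>0) (U, \<phi>) differentiable (at (x, y0))"
    using smooth_on_differentiable[OF mmap_smooth[OF c(1) unit_chart(1) c(1)] lam_dom[OF c]] .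
  from linear_frechet_derivative[OF this] have l: "linear (der (mmap (U, \<phi>) (V0, \<psi>0) (U, \<phi>)) (x, y0))" .
  show ?thesis
    by (rule linearI) (simp_all add: lam_def flip: linear_add[OF l] linear_cmul[OF l])
qed

lemma lam_mult_i:
  assumes c: "(U, \<phi>) \<in> A" "x \<in> \<phi> ` U"
  shows "lam (U, \<phi>) (mult_i u) x = mult_i (lam (U, \<phi>) u x)"
proof -
  have "(0, mult_i u) = map_prod mult_i mult_i (0, u)"
    using linear_0[OF mult_i_linear] by simp
  then show ?thesis
    using mmap_holo(2)[OF c(1) unit_chart(1) c(1)] lam_dom[OF c]
    unfolding lam_def holo_on_def by metis
qed

lemma L_coord_vec:
  assumes c: "(U, \<phi>) \<in> A" "a \<in> U"
  shows "L u a = coord_vec A (U, \<phi>) a (lam (U, \<phi>) u (\<phi> a))"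
proof
  fix f
  let ?m = "mmap (U, \<phi>) (V0, \<psi>0) (U, \<phi>)" and ?D = "mdom (U, \<phi>) (V0, \<psi>0) (U, \<phi>)"
  show "L u a f = coord_vec A (U, \<phi>) a (lam (U, \<phi>) u (\<phi> a)) f"
  proof (cases "f \<in> germs A a")
    case f: True
    have d: "(\<phi> a, y0) \<in> ?D" using lam_dom[OF c(1)] c(2) by blast
    have m: "?m differentiable (at (\<phi> a, y0))"
      using smooth_on_differentiable[OF mmap_smooth[OF c(1) unit_chart(1) c(1)] d] .
    have m0: "?m (\<phi> a, y0) = \<phi> a"
      using \<iota>0_y0 by (simp add: mmap_def inv_chart[OF c] flip: \<iota>0_def)
    have F: "(f \<circ> inv_into U \<phi>) differentiable (at (?m (\<phi> a, y0)))"
      unfolding m0 using germ_chart[OF c f] smooth_on_differentiable by blast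
    have 1: "der (\<lambda>y. ?m (\<phi> a, y)) y0 u = lam (U, \<phi>) u (\<phi> a)"
      using frechet_derivative_partial(1)[OF m] by (simp add: lam_def)
    have m': "(\<lambda>y. ?m (\<phi> a, y)) differentiable (at y0)"
    proof -
      have "(\<lambda>y. (\<phi> a, y)) differentiable (at y0)"
        by (auto simp: differentiable_def intro!: derivative_eq_intros exI)
      then show ?thesis using differentiable_compose[of ?m "\<lambda>y. (\<phi> a, y)" y0 UNIV] m by simp
    qed
    have "der (\<lambda>y. f (a \<otimes> \<iota>0 y)) y0 =
        der (\<lambda>y. (f \<circ> inv_into U \<phi>) (?m (\<phi> a, y))) y0"
    proof (rule sym, rule frechet_derivative_transform_within_open)
      show "(\<lambda>y. (f \<circ> inv_into U \<phi>) (?m (\<phi> a, y))) differentiable (at y0)"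
        using differentiable_compose[of "f \<circ> inv_into U \<phi>" "\<lambda>y. ?m (\<phi> a, y)" y0 UNIV] F m' by simp
      show "open ((\<lambda>y. (\<phi> a, y)) -` ?D)"
        by (rule open_vimage[OF mmap_holo(1)[OF c(1) unit_chart(1) c(1)]]) (intro continuous_intros)
      show "y0 \<in> (\<lambda>y. (\<phi> a, y)) -` ?D" using d by simp
      show "(f \<circ> inv_into U \<phi>) (?m (\<phi> a, y)) = f (a \<otimes> \<iota>0 y)" if "y \<in> (\<lambda>y. (\<phi> a, y)) -` ?D" for y
        using that by (simp add: mmap_def mdom_def inv_chart[OF c] inv_chart[OF c(1)] \<iota>0_def)
    qed
    then have "L u a f = der (\<lambda>y. (f \<circ> inv_into U \<phi>) (?m (\<phi> a, y))) y0 u"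
      using f by (simp add: L_apply)
    also have "\<dots> = der (f \<circ> inv_into U \<phi>) (\<phi> a) (lam (U, \<phi>) u (\<phi> a))"
      using frechet_derivative_compose_eq[of "f \<circ> inv_into U \<phi>" "\<lambda>y. ?m (\<phi> a, y)", OF F m'] m0 1 by simp
    finally show ?thesis using f by (simp add: coord_vec_def)
  qed (simp add: L_apply coord_vec_def)
qed

lemma L_tangent: "L u a \<in> tangent_space A a"
  using ex_chart[of a] L_coord_vec coord_vec_tangent by metis

lemma L_field: "L u \<in> vfields A"
proof -
  have "(\<lambda>q. L u q f) \<in> germs A a" if f: "f \<in> germs A a" for f a
  proof -
    obtain U \<phi> where c: "(U, \<phi>) \<in> A" "a \<in> U" using ex_chart by blast
    obtain N where N: "open N" "\<phi> a \<in> N" "N \<subseteq> \<phi> ` U" "smooth_on N (f \<circ> inv_into U \<phi>)"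
      using germ_chart[OF c f] by blast
    have sm: "smooth_on N (\<lambda>x. der (f \<circ> inv_into U \<phi>) x (lam (U, \<phi>) u x))"
      by (rule smooth_on_frechet_derivative_apply[OF N(1,4) smooth_on_subset[OF lam_smooth[OF c(1)] N(3)]])
    have eq: "der (f \<circ> inv_into U \<phi>) x (lam (U, \<phi>) u x) = ((\<lambda>q. L u q f) \<circ> inv_into U \<phi>) x"
      if x: "x \<in> N" for x
    proof -
      have q: "inv_into U \<phi> x \<in> U" "\<phi> (inv_into U \<phi> x) = x"
        using x N(3) by (auto simp: inv_into_into f_inv_into_f)
      have "f \<in> germs A (inv_into U \<phi> x)"
        using c(1) q N x by (intro germsI[of U \<phi> _ N]) auto
      then show ?thesis using L_coord_vec[OF c(1) q(1), of u] q by (simp add: coord_vec_def)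
    qed
    have "smooth_on N ((\<lambda>q. L u q f) \<circ> inv_into U \<phi>)"
      by (rule smooth_on_cong[OF N(1) eq sm])
    then show ?thesis by (rule germsI[OF c N(1-3)])
  qed
  then show ?thesis using L_tangent by (auto simp: vfields_def)
qed

lemma L_linear: "linear (\<lambda>u. L u a f)"
proof -
  obtain U \<phi> where c: "(U, \<phi>) \<in> A" "a \<in> U" using ex_chart by blast
  note l = lam_linear[OF c(1) imageI[OF c(2)]] and l' = coord_vec_linear[OF c, of f]
  show ?thesis
    by (rule linearI)
      (simp_all add: L_coord_vec[OF c] linear_add[OF l] linear_cmul[OF l] linear_add[OF l'] linear_cmul[OF l'])
qed

lemma L_inj:
  assumes "L u a = L v a"
  shows "u = v"
proof -
  have "L u (inv a \<otimes> a) = L v (inv a \<otimes> a)" using assms left_diff_L by metis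
  then show ?thesis using coord_vec_inj[OF unit_chart] by (simp add: L_at_unit)
qed

text \<open>In a chart at \<open>a\<close>, the assignment of \<open>L u a\<close> to
  \<open>u\<close> is an injective linear endomorphism of a finite-dimensional space.\<close>

lemma L_surj:
  assumes "t \<in> tangent_space A a"
  shows "\<exists>u. t = L u a"
proof -
  obtain U \<phi> w where c: "(U, \<phi>) \<in> A" "a \<in> U" and t: "t = coord_vec A (U, \<phi>) a w"
    using assms by (auto simp: tangent_space_def)
  have l: "linear (\<lambda>u. lam (U, \<phi>) u (\<phi> a))" using lam_linear[OF c(1)] c(2) by blast
  have "inj (\<lambda>u. lam (U, \<phi>) u (\<phi> a))"
    by (rule injI) (metis L_coord_vec[OF c] L_inj)
  from linear_injective_imp_surjective[OF l this] obtain u where "w = lam (U, \<phi>) u (\<phi> a)"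
    unfolding surj_def by blast
  then show ?thesis using t L_coord_vec[OF c] by metis
qed

lemma lie_algebra_eq: "lie_algebra G A = range L"
proof
  show "range L \<subseteq> lie_algebra G A"
    by (auto simp: lie_algebra_def L_field left_diff_L)
  show "lie_algebra G A \<subseteq> range L"
  proof
    fix X assume X: "X \<in> lie_algebra G A"
    then have Xi: "left_diff G A a b (X b) = X (a \<otimes> b)" for a b by (simp add: lie_algebra_def)
    have "X \<one> \<in> tangent_space A \<one>" using X vfields_tangent by (simp add: lie_algebra_def)
    then obtain u where u: "X \<one> = L u \<one>" using L_surj by blast
    have "X a = L u a" for a
      using Xi[of a \<one>] left_diff_L[of a \<one> u] by (simp add: u)
    then show "X \<in> range L" by blast
  qed
qed

end

context complex_lie_frame
begin

text \<open>The mixed second derivative of the multiplication at the unit. It is complex bilinear because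
  the multiplication is holomorphic, and the Lie bracket is its antisymmetrization.\<close>

definition mixed :: "complex^'n \<Rightarrow> complex^'n \<Rightarrow> complex^'n" where
  "mixed u v = der (\<lambda>z. der (mmap (V0, \<psi>0) (V0, \<psi>0) (V0, \<psi>0)) z (0, v))
     (y0, y0) (u, 0)"

definition lbr :: "complex^'n \<Rightarrow> complex^'n \<Rightarrow> complex^'n" where
  "lbr u v = mixed u v - mixed v u"

context
  fixes m D
  defines "m \<equiv> mmap (V0, \<psi>0) (V0, \<psi>0) (V0, \<psi>0)"
    and "D \<equiv> mdom (V0, \<psi>0) (V0, \<psi>0) (V0, \<psi>0)"
begin

lemma m_holo:
  "z \<in> D \<Longrightarrow> der m z (map_prod mult_i mult_i w) = mult_i (der m z w)"
  using mmap_holo(2)[OF unit_chart(1) unit_chart(1) unit_chart(1)]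
  unfolding holo_on_def m_def D_def by blast

lemma m_smooth: "open D" "smooth_on D m" "(y0, y0) \<in> D"
  using mmap_holo[OF unit_chart(1) unit_chart(1) unit_chart(1)]
    mdomI[OF unit_chart(1) unit_chart(1), of \<one> \<one> "(V0, \<psi>0)"] unit_chart
  by (auto simp: holo_on_def y0_def m_def D_def)

lemma Dm_diff: "(\<lambda>z. der m z w) differentiable (at (y0, y0))"
  using smooth_on_differentiable smooth_on_frechet_derivative m_smooth by blast

text \<open>With either slot differentiated last, the Cauchy-Riemann equation for the multiplication
  gives complex linearity of \<open>mixed\<close> in both arguments.\<close>

lemma mixed_sym: "mixed u v = der (\<lambda>z. der m z (u, 0)) (y0, y0) (0, v)"
  unfolding mixed_def m_def[symmetric] by (rule symmetric_second_derivative[OF m_smooth(1-3)])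

lemma lam_derivative: "der (lam (V0, \<psi>0) v) y0 u = mixed u v"
  using frechet_derivative_partial(2)[OF Dm_diff, of "(0, v)" u]
  by (simp add: mixed_def lam_def[abs_def] m_def)

text \<open>The Cauchy-Riemann equation, differentiated once more in a fixed direction.\<close>

lemma Dm_mult_i:
  "der (\<lambda>z. der m z (map_prod mult_i mult_i w)) (y0, y0) w' =
    mult_i (der (\<lambda>z. der m z w) (y0, y0) w')"
proof -
  have bl: "bounded_linear (mult_i :: complex^'n \<Rightarrow> _)"
    using mult_i_linear linear_conv_bounded_linear by blast
  have "der (\<lambda>z. der m z (map_prod mult_i mult_i w)) (y0, y0) =
      der (\<lambda>z. mult_i (der m z w)) (y0, y0)"
    by (rule frechet_derivative_transform_within_open[OF Dm_diff m_smooth(1,3)]) (rule m_holo)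
  then show ?thesis using frechet_derivative_bounded_linear[OF bl Dm_diff] by simp
qed

lemma mixed_mult_i: "mixed (mult_i u) v = mult_i (mixed u v)" "mixed u (mult_i v) = mult_i (mixed u v)"
proof -
  show "mixed (mult_i u) v = mult_i (mixed u v)"
    unfolding mixed_sym using Dm_mult_i[of "(u, 0)" "(0, v)"] by (simp add: linear_0[OF mult_i_linear])
  show "mixed u (mult_i v) = mult_i (mixed u v)"
    unfolding mixed_def m_def[symmetric]
    using Dm_mult_i[of "(0, v)" "(u, 0)"] by (simp add: linear_0[OF mult_i_linear])
qed

lemma mixed_bilinear: "bilinear mixed"
  unfolding bilinear_def
proof (intro conjI allI)
  note l = linear_frechet_derivative[OF Dm_diff]
  show "linear (mixed u)" for u
    unfolding mixed_sym
    by (rule linearI) (simp_all flip: linear_add[OF l] linear_cmul[OF l])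
  show "linear (\<lambda>u. mixed u v)" for v
    unfolding mixed_def m_def[symmetric]
    by (rule linearI) (simp_all flip: linear_add[OF l] linear_cmul[OF l])
qed

end

lemma lbr_bilinear: "bilinear lbr"
  unfolding bilinear_def lbr_def
  by (auto intro!: linearI simp: bilinear_ladd[OF mixed_bilinear] bilinear_radd[OF mixed_bilinear]
      bilinear_lmul[OF mixed_bilinear] bilinear_rmul[OF mixed_bilinear] algebra_simps)

lemma lbr_skew: "lbr x y = - lbr y x"
  by (simp add: lbr_def)

lemma lbr_mult_i: "lbr (mult_i x) y = mult_i (lbr x y)"
  by (simp add: lbr_def mixed_mult_i linear_diff[OF mult_i_linear])

text \<open>Left invariance moves both fields and the test function to the unit. There the
  coefficient map of \<open>L w\<close> is \<open>lam\<close>, with value \<open>w\<close> at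
  \<open>y0\<close> and derivative given by \<open>mixed\<close>, and the coordinate formula
  produces \<open>lbr\<close>.\<close>

lemma bracket_L: "bracket A (L u) (L v) = L (lbr u v)"
proof (intro ext)
  fix a f
  show "bracket A (L u) (L v) a f = L (lbr u v) a f"
  proof (cases "f \<in> germs A a")
    case f: True
    have fa: "(\<lambda>x. f (a \<otimes> x)) \<in> germs A \<one>" using f by (simp add: left_mult_germ_iff)
    have tr: "L u a g = L u \<one> (\<lambda>x. g (a \<otimes> x))" for u g
      by (simp add: L_apply left_mult_germ_iff)
    have tr': "L v (a \<otimes> x) f = L v x (\<lambda>x. f (a \<otimes> x))" for v x
      by (simp add: L_apply left_mult_germ_iff assoc)
    have "lam (V0, \<psi>0) w y0 = w" for w
    proof (rule coord_vec_inj[OF unit_chart])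
      show "coord_vec A (V0, \<psi>0) \<one> (lam (V0, \<psi>0) w y0) = coord_vec A (V0, \<psi>0) \<one> w"
        using L_coord_vec[OF unit_chart, of w] by (simp add: L_at_unit y0_def)
    qed
    then have "bracket A (L u) (L v) \<one> (\<lambda>x. f (a \<otimes> x)) = L (lbr u v) \<one> (\<lambda>x. f (a \<otimes> x))"
      using bracket_coord_vec[OF unit_chart fa L_coord_vec[OF unit_chart(1)] L_field lam_smooth[OF unit_chart(1)]
          L_coord_vec[OF unit_chart(1)] L_field lam_smooth[OF unit_chart(1)], of u v]
      by (simp add: L_at_unit lbr_def lam_derivative flip: y0_def)
    then show ?thesis using f fa by (simp add: bracket_def tr[of _ f] tr[of u] tr[of v] tr')
  qed (simp add: bracket_def L_apply)
qed

lemma coord_vec_change: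
  assumes c: "(U, \<phi>) \<in> A" "p \<in> U" and d: "(V, \<psi>) \<in> A" "p \<in> V"
  shows "coord_vec A (V, \<psi>) p w = coord_vec A (U, \<phi>) p (der (\<phi> \<circ> inv_into V \<psi>) (\<psi> p) w)"
    and "der (\<phi> \<circ> inv_into V \<psi>) (\<psi> p) (mult_i w) =
      mult_i (der (\<phi> \<circ> inv_into V \<psi>) (\<psi> p) w)"
proof -
  let ?\<tau> = "\<phi> \<circ> inv_into V \<psi>" and ?S = "\<psi> ` (V \<inter> U)"
  have op: "open ?S"
    by (rule open_chart_image[OF atlas d(1)]) (use complex_atlasD(2)[OF atlas] c d in auto)
  have p: "\<psi> p \<in> ?S" using c d by blast
  have h: "holo_on mult_i mult_i ?S ?\<tau>" using complex_atlasD(6)[OF atlas d(1) c(1)] .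
  then show "der ?\<tau> (\<psi> p) (mult_i w) = mult_i (der ?\<tau> (\<psi> p) w)"
    using p unfolding holo_on_def by blast
  have \<tau>: "?\<tau> differentiable (at (\<psi> p))"
    using h p smooth_on_differentiable unfolding holo_on_def by blast
  have \<tau>p: "?\<tau> (\<psi> p) = \<phi> p" by (simp add: inv_chart[OF d])
  show "coord_vec A (V, \<psi>) p w = coord_vec A (U, \<phi>) p (der ?\<tau> (\<psi> p) w)"
  proof
    fix f
    show "coord_vec A (V, \<psi>) p w f = coord_vec A (U, \<phi>) p (der ?\<tau> (\<psi> p) w) f"
    proof (cases "f \<in> germs A p")
      case f: True
      have F: "(f \<circ> inv_into U \<phi>) differentiable (at (?\<tau> (\<psi> p)))"
        unfolding \<tau>p using germ_chart[OF c f] smooth_on_differentiable by blast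
      have F': "(f \<circ> inv_into V \<psi>) differentiable (at (\<psi> p))"
        using germ_chart[OF d f] smooth_on_differentiable by blast
      have "der (f \<circ> inv_into V \<psi>) (\<psi> p) =
          der (\<lambda>x. (f \<circ> inv_into U \<phi>) (?\<tau> x)) (\<psi> p)"
        by (rule frechet_derivative_transform_within_open[OF F' op p])
          (auto simp: inv_chart[OF d(1)] inv_chart[OF c(1)])
      then show ?thesis
        using f frechet_derivative_compose_eq[OF F \<tau>] \<tau>p by (simp add: coord_vec_def)
    qed (simp add: coord_vec_def)
  qed
qed

text \<open>Holomorphy of the transition maps makes the vector described by \<open>THE\<close> the
  same in every chart.\<close>

lemma complex_structure_L: "complex_structure A a (L u a) = L (mult_i u) a"
proof -
  obtain U \<phi> where c: "(U, \<phi>) \<in> A" "a \<in> U" using ex_chart by blast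
  show ?thesis
    unfolding complex_structure_def
  proof (rule the_equality)
    have "L (mult_i u) a = coord_vec A (U, \<phi>) a (mult_i (lam (U, \<phi>) u (\<phi> a)))"
      using L_coord_vec[OF c] lam_mult_i[OF c(1)] c(2) by simp
    then show "\<exists>c\<in>A. \<exists>w. a \<in> fst c \<and> L u a = coord_vec A c a w \<and> L (mult_i u) a = coord_vec A c a (mult_i w)"
      using c L_coord_vec[OF c] by (intro bexI[of _ "(U, \<phi>)"] exI[of _ "lam (U, \<phi>) u (\<phi> a)"]) auto
    fix t assume "\<exists>c\<in>A. \<exists>w. a \<in> fst c \<and> L u a = coord_vec A c a w \<and> t = coord_vec A c a (mult_i w)"
    then obtain V \<psi> w where d: "(V, \<psi>) \<in> A" "a \<in> V" and w: "L u a = coord_vec A (V, \<psi>) a w"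
      "t = coord_vec A (V, \<psi>) a (mult_i w)" by auto
    have "lam (U, \<phi>) u (\<phi> a) = der (\<phi> \<circ> inv_into V \<psi>) (\<psi> a) w"
      by (rule coord_vec_inj[OF c]) (metis L_coord_vec[OF c] w(1) coord_vec_change(1)[OF c d])
    then have "t = coord_vec A (U, \<phi>) a (mult_i (lam (U, \<phi>) u (\<phi> a)))"
      using w(2) coord_vec_change[OF c d] by simp
    then show "t = L (mult_i u) a"
      using L_coord_vec[OF c] lam_mult_i[OF c(1)] c(2) by simp
  qed
qed

definition inner0 :: "'a metr \<Rightarrow> complex^'n \<Rightarrow> complex^'n \<Rightarrow> real" where
  "inner0 h u v = h \<one> (L u \<one>) (L v \<one>)"

context
  fixes h :: "'a metr"
  assumes h: "left_invariant_hermitian G A h"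
begin

lemma h_L: "h a (L u a) (L v a) = inner0 h u v"
proof -
  have "h (a \<otimes> \<one>) (left_diff G A a \<one> (L u \<one>)) (left_diff G A a \<one> (L v \<one>)) = h \<one> (L u \<one>) (L v \<one>)"
    using h L_tangent unfolding left_invariant_hermitian_def by blast
  then show ?thesis unfolding left_diff_L inner0_def by simp
qed

lemma h_riemannian: "riemannian A h" "isometric_endo A h (complex_structure A)"
  using h by (auto simp: left_invariant_hermitian_def)

lemma inner0_sym: "inner0 h u v = inner0 h v u"
  using h_riemannian(1) L_tangent unfolding riemannian_def inner0_def by simp

lemma inner0_bilinear: "bilinear (inner0 h)"
proof -
  have *: "inner0 h (a *\<^sub>R u + b *\<^sub>R v) w = a * inner0 h u w + b * inner0 h v w" for a b u v w
  proof -
    have "L (a *\<^sub>R u + b *\<^sub>R v) \<one> = (\<lambda>f. a * L u \<one> f + b * L v \<one> f)"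
      by (rule ext) (simp add: linear_add[OF L_linear] linear_cmul[OF L_linear])
    then show ?thesis
      using h_riemannian(1) L_tangent unfolding riemannian_def inner0_def by simp
  qed
  have "inner0 h (u + v) w = inner0 h u w + inner0 h v w" "inner0 h (r *\<^sub>R u) w = r * inner0 h u w" for r u v w
    using *[of 1 u 1 v w] *[of r u 0 0 w] by simp_all
  then show ?thesis
    unfolding bilinear_def using inner0_sym by (auto intro!: linearI)
qed

lemma inner0_pos: "u \<noteq> 0 \<Longrightarrow> inner0 h u u > 0"
proof -
  assume "u \<noteq> 0"
  then have "L u \<one> \<noteq> L 0 \<one>" using L_inj by blast
  moreover have "L 0 \<one> = (\<lambda>f. 0)" using linear_0[OF L_linear] by auto
  moreover have "\<one> \<in> pts A" by simp
  ultimately show ?thesis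
    using h_riemannian(1) L_tangent[of u \<one>] unfolding riemannian_def inner0_def by metis
qed

lemma inner0_mult_i: "inner0 h (mult_i u) (mult_i v) = inner0 h u v"
  using h_riemannian(2) L_tangent[of _ \<one>] unfolding isometric_endo_def inner0_def
  by (simp flip: complex_structure_L)

text \<open>The coordinate functional is \<open>inner0\<close> with a suitable vector
  \<open>w\<close>, so the coefficient is the metric pairing of \<open>X\<close> with the
  left-invariant field \<open>L w\<close>, and \<open>riemannian\<close> makes such pairings
  smooth.\<close>

lemma coefficient_smooth_G:
  assumes X: "X \<in> vfields A" and x: "\<And>a. X a = L (x a) a"
  shows "(\<lambda>a. x a \<bullet> b) \<in> smooth_funs A"
proof -
  have "linear (\<lambda>z. b \<bullet> z)" by (rule linearI) (auto simp: inner_add_right)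
  then obtain w where w: "\<And>z. inner0 h w z = b \<bullet> z"
    using bilinear_form_representation[OF inner0_bilinear inner0_pos] by blast
  have "(\<lambda>a. h a (X a) (L w a)) \<in> smooth_funs A"
    using h_riemannian(1) X L_field unfolding riemannian_def by blast
  moreover have "h a (X a) (L w a) = x a \<bullet> b" for a
    using w[of "x a"] inner0_sym x h_L by (simp add: inner_commute)
  ultimately show ?thesis by simp
qed

end

end

section \<open>The quotient by a discrete subgroup\<close>

lemma mem_pts_iff: "p \<in> pts A \<longleftrightarrow> (\<exists>U \<phi>. (U, \<phi>) \<in> A \<and> p \<in> U)"
  by (auto simp: pts_def)

context complex_lie_frame
begin

section \<open>Continuity of the group operations in the topology of the type\<close>

lemma open_chart_preimage: "(U, \<phi>) \<in> A \<Longrightarrow> open P \<Longrightarrow> open (U \<inter> \<phi> -` P)"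
  using complex_atlasD(2,5)[OF atlas] by (meson continuous_open_preimage homeomorphism_cont1)

lemma mult_continuous:
  assumes "open W'" "a \<otimes> b \<in> W'"
  shows "\<exists>P Q. open P \<and> a \<in> P \<and> open Q \<and> b \<in> Q \<and> (\<forall>x\<in>P. \<forall>y\<in>Q. x \<otimes> y \<in> W')"
proof -
  obtain U \<phi> where c: "(U, \<phi>) \<in> A" "a \<in> U" using ex_chart by blast
  obtain V \<psi> where d: "(V, \<psi>) \<in> A" "b \<in> V" using ex_chart by blast
  obtain W \<theta> where e: "(W, \<theta>) \<in> A" "a \<otimes> b \<in> W" using ex_chart by blast
  let ?D = "mdom (U, \<phi>) (V, \<psi>) (W, \<theta>)" and ?m = "mmap (U, \<phi>) (V, \<psi>) (W, \<theta>)"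
  have o: "open (\<theta> ` (W' \<inter> W))"
    by (rule open_chart_image[OF atlas e(1)]) (use assms(1) complex_atlasD(2)[OF atlas e(1)] in auto)
  have "open (?D \<inter> ?m -` (\<theta> ` (W' \<inter> W)))"
    by (rule continuous_open_preimage[OF smooth_on_continuous[OF mmap_smooth[OF c(1) d(1) e(1)]]
          mmap_holo(1)[OF c(1) d(1) e(1)] o])
  moreover have "(\<phi> a, \<psi> b) \<in> ?D \<inter> ?m -` (\<theta> ` (W' \<inter> W))"
    using mdomI[OF c(1) d(1), of a b "(W, \<theta>)"] c d e assms(2)
    by (simp add: mmap_def inv_chart[OF c] inv_chart[OF d])
  ultimately obtain P Q where PQ: "open P" "open Q" "(\<phi> a, \<psi> b) \<in> P \<times> Q"
    "P \<times> Q \<subseteq> ?D \<inter> ?m -` (\<theta> ` (W' \<inter> W))"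
    by (rule open_prod_elim)
  have "x \<otimes> y \<in> W'" if xy: "x \<in> U \<inter> \<phi> -` P" "y \<in> V \<inter> \<psi> -` Q" for x y
  proof -
    have "(\<phi> x, \<psi> y) \<in> ?D \<inter> ?m -` (\<theta> ` (W' \<inter> W))" using PQ(4) xy by blast
    then have "x \<otimes> y \<in> W" "\<theta> (x \<otimes> y) \<in> \<theta> ` (W' \<inter> W)"
      using xy by (auto simp: mdom_def mmap_def inv_chart[OF c(1)] inv_chart[OF d(1)])
    then show ?thesis using chart_inj[OF e(1)] by (auto dest: inj_onD)
  qed
  then show ?thesis
    using open_chart_preimage[OF c(1) PQ(1)] open_chart_preimage[OF d(1) PQ(2)] PQ(3) c d
    by (intro exI[of _ "U \<inter> \<phi> -` P"] exI[of _ "V \<inter> \<psi> -` Q"]) auto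
qed

lemma inv_continuous:
  assumes "open W'" "inv a \<in> W'"
  shows "\<exists>P. open P \<and> a \<in> P \<and> (\<forall>x\<in>P. inv x \<in> W')"
proof -
  obtain U \<phi> where c: "(U, \<phi>) \<in> A" "a \<in> U" using ex_chart by blast
  obtain V \<psi> where d: "(V, \<psi>) \<in> A" "inv a \<in> V" using ex_chart by blast
  define D where "D = {x. x \<in> \<phi> ` U \<and> inv (inv_into U \<phi> x) \<in> V}"
  define m where "m x = \<psi> (inv (inv_into U \<phi> x))" for x
  have D: "open D" "holo_on mult_i mult_i D m"
    using lie c(1) d(1) unfolding complex_lie_group_def D_def m_def[abs_def] Let_def by blast+
  have o: "open (\<psi> ` (W' \<inter> V))"
    by (rule open_chart_image[OF atlas d(1)]) (use assms(1) complex_atlasD(2)[OF atlas d(1)] in auto)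
  have "open (D \<inter> m -` (\<psi> ` (W' \<inter> V)))"
    using continuous_open_preimage[OF smooth_on_continuous D(1) o] D(2) by (simp add: holo_on_def)
  from open_chart_preimage[OF c(1) this]
  have op: "open (U \<inter> \<phi> -` (D \<inter> m -` (\<psi> ` (W' \<inter> V))))" .
  have "inv x \<in> W'" if x: "x \<in> U \<inter> \<phi> -` (D \<inter> m -` (\<psi> ` (W' \<inter> V)))" for x
  proof -
    have "inv x \<in> V" "\<psi> (inv x) \<in> \<psi> ` (W' \<inter> V)"
      using x inv_chart[OF c(1), of x] by (simp_all add: D_def m_def)
    then show ?thesis using chart_inj[OF d(1)] by (auto dest: inj_onD)
  qed
  moreover have "a \<in> U \<inter> \<phi> -` (D \<inter> m -` (\<psi> ` (W' \<inter> V)))"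
    using c d assms(2) by (simp add: D_def m_def inv_chart[OF c])
  ultimately show ?thesis using op by blast
qed

lemma L_zero: "L 0 = zero_field"
  by (intro ext) (simp add: zero_field_def linear_0[OF L_linear])

lemma L_eq_zero: "L u = zero_field \<longleftrightarrow> u = 0"
  using L_inj L_zero by metis

lemma two_step_nilpotent_iff: "two_step_nilpotent G A \<longleftrightarrow> (\<forall>x y z. lbr x (lbr y z) = 0)"
  by (simp add: two_step_nilpotent_def lie_algebra_eq bracket_L L_eq_zero)

text \<open>The frame carries the decomposition at the unit to every point;
  \<open>cproj_unique\<close> makes it unique, and with it the value of \<open>THE\<close>.\<close>

lemma J_minus_L:
  assumes h: "left_invariant_hermitian G A h"
    and alg: "metric_complex_lie_algebra lbr mult_i (inner0 h)"
  shows "J_minus G A h a (L u a) = L (metric_complex_lie_algebra.Kminus lbr mult_i (inner0 h) u) a"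
proof -
  interpret metric_complex_lie_algebra lbr mult_i "inner0 h" by (rule alg)
  have z: "lie_center G A = L ` centre"
    by (auto simp: lie_center_def lie_algebra_eq bracket_L L_eq_zero centre_def)
  have p: "center_perp G A h = L ` {y. \<forall>x\<in>centre. inner0 h x y = 0}"
    unfolding center_perp_def z lie_algebra_eq by (auto simp: inner0_def)
  have sum: "(\<lambda>f. L x a f + L y a f) = L (x + y) a" "(\<lambda>f. L x a f - L y a f) = L (x - y) a" for x y
    by (auto simp: fun_eq_iff linear_add[OF L_linear] linear_diff[OF L_linear])
  show ?thesis
    unfolding J_minus_def z p
  proof (rule the_equality)
    show "\<exists>X\<in>L ` centre. \<exists>Y\<in>L ` {y. \<forall>x\<in>centre. inner0 h x y = 0}. L u a = (\<lambda>f. X a f + Y a f) \<and>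
        L (Kminus u) a = (\<lambda>f. complex_structure A a (X a) f - complex_structure A a (Y a) f)"
      by (rule bexI[of _ "L (cproj u)"], rule bexI[of _ "L (u - cproj u)"])
        (use cproj(1)[of u] cproj(2)[of _ u] in \<open>auto simp: sum complex_structure_L Kminus_def simp del: h_simps\<close>)
    fix w assume "\<exists>X\<in>L ` centre. \<exists>Y\<in>L ` {y. \<forall>x\<in>centre. inner0 h x y = 0}. L u a = (\<lambda>f. X a f + Y a f) \<and>
        w = (\<lambda>f. complex_structure A a (X a) f - complex_structure A a (Y a) f)"
    then obtain x y where x: "x \<in> centre" and y: "\<And>t. t \<in> centre \<Longrightarrow> inner0 h t y = 0"
      and u: "L u a = L (x + y) a" and w: "w = L (mult_i x - mult_i y) a"
      by (auto simp: sum complex_structure_L)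
    have "u = x + y" using L_inj[OF u] .
    moreover have "cproj (x + y) = x" by (rule cproj_unique[OF x]) (simp add: y)
    ultimately show "w = L (Kminus u) a" by (simp add: w Kminus_def)
  qed
qed

end

locale lie_quotient = complex_lie_frame G A V0 \<psi>0
  for G :: "('a::topological_space, 'b) monoid_scheme" (structure)
    and A :: "('a, complex^'n) chart set" and V0 \<psi>0 +
  fixes \<Gamma> :: "'a set"
  assumes subgroup: "subgroup \<Gamma> G" and discrete: "\<exists>N. open N \<and> N \<inter> \<Gamma> = {\<one>}"
begin

abbreviation "M \<equiv> quot_atlas G \<Gamma> A"

definition \<pi> :: "'a \<Rightarrow> 'a set" where
  "\<pi> = coset_proj G \<Gamma>"

section \<open>Cosets, quotient charts and germs on the quotient\<close>

lemma \<pi>_eq_iff: "\<pi> a = \<pi> b \<longleftrightarrow> (\<exists>\<gamma>\<in>\<Gamma>. a = \<gamma> \<otimes> b)"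
proof -
  have one: "\<one> \<in> \<Gamma>" and m: "\<And>x y. x \<in> \<Gamma> \<Longrightarrow> y \<in> \<Gamma> \<Longrightarrow> x \<otimes> y \<in> \<Gamma>" and i: "\<And>x. x \<in> \<Gamma> \<Longrightarrow> inv x \<in> \<Gamma>"
    using subgroup by (auto simp: subgroup_def)
  have set: "\<pi> x = {\<gamma> \<otimes> x |\<gamma>. \<gamma> \<in> \<Gamma>}" for x
    by (auto simp: \<pi>_def coset_proj_def r_coset_def)
  show ?thesis
  proof
    assume "\<pi> a = \<pi> b"
    moreover have "a \<in> \<pi> a" unfolding set using one by force
    ultimately show "\<exists>\<gamma>\<in>\<Gamma>. a = \<gamma> \<otimes> b" by (auto simp: set)
  next
    assume "\<exists>\<gamma>\<in>\<Gamma>. a = \<gamma> \<otimes> b"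
    then obtain \<gamma> where g: "\<gamma> \<in> \<Gamma>" "a = \<gamma> \<otimes> b" by blast
    have "\<delta> \<otimes> a \<in> \<pi> b" if "\<delta> \<in> \<Gamma>" for \<delta>
      unfolding set using g that m by (auto simp flip: assoc)
    moreover have "\<delta> \<otimes> b \<in> \<pi> a" if "\<delta> \<in> \<Gamma>" for \<delta>
    proof -
      have "\<delta> \<otimes> b = (\<delta> \<otimes> inv \<gamma>) \<otimes> a" by (simp add: g(2) assoc)
      then show ?thesis unfolding set using m[OF that i[OF g(1)]] by blast
    qed
    ultimately show "\<pi> a = \<pi> b" unfolding set by blast
  qed
qed

lemma mem_\<pi>: "a \<in> \<pi> b \<longleftrightarrow> \<pi> a = \<pi> b"
  unfolding \<pi>_eq_iff by (auto simp: \<pi>_def coset_proj_def r_coset_def)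

text \<open>If \<open>x\<close> and \<open>y\<close> are close to \<open>a\<close> and lie in one
  coset, then \<open>x \<otimes> inv y\<close> is an element of \<open>\<Gamma>\<close> close to the
  unit, hence the unit.\<close>

lemma locally_injective:
  assumes "open U" "a \<in> U"
  shows "\<exists>V. open V \<and> a \<in> V \<and> V \<subseteq> U \<and> inj_on \<pi> V"
proof -
  obtain N where N: "open N" "N \<inter> \<Gamma> = {\<one>}" using discrete by blast
  have "a \<otimes> inv a \<in> N" using N(2) by auto
  then obtain P Q where PQ: "open P" "a \<in> P" "open Q" "inv a \<in> Q" "\<And>x y. x \<in> P \<Longrightarrow> y \<in> Q \<Longrightarrow> x \<otimes> y \<in> N"
    using mult_continuous[OF N(1)] by metis
  obtain P' where P': "open P'" "a \<in> P'" "\<And>x. x \<in> P' \<Longrightarrow> inv x \<in> Q"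
    using inv_continuous[OF PQ(3,4)] by metis
  have "inj_on \<pi> (P \<inter> P' \<inter> U)"
  proof (rule inj_onI)
    fix x y assume x: "x \<in> P \<inter> P' \<inter> U" and y: "y \<in> P \<inter> P' \<inter> U" and "\<pi> x = \<pi> y"
    then obtain \<gamma> where g: "\<gamma> \<in> \<Gamma>" "x = \<gamma> \<otimes> y" by (auto simp: \<pi>_eq_iff)
    have "x \<otimes> inv y \<in> N" using x y PQ(5) P'(3) by blast
    then have "\<gamma> \<in> N \<inter> \<Gamma>" using g by (simp add: assoc)
    then show "x = y" using N(2) g by simp
  qed
  then show ?thesis using assms PQ P' by (intro exI[of _ "P \<inter> P' \<inter> U"]) auto
qed

lemma ex_quot_chart:
  "\<exists>U \<phi> V. (U, \<phi>) \<in> A \<and> open V \<and> V \<subseteq> U \<and> inj_on \<pi> V \<and> a \<in> V"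
proof -
  obtain U \<phi> where c: "(U, \<phi>) \<in> A" "a \<in> U" using ex_chart by blast
  then show ?thesis using locally_injective[OF complex_atlasD(2)[OF atlas c(1)] c(2)] by blast
qed

lemma quot_atlas_iff:
  "(P, \<kappa>) \<in> M \<longleftrightarrow> (\<exists>V U \<phi>. P = \<pi> ` V \<and> \<kappa> = \<phi> \<circ> inv_into V \<pi> \<and> (U, \<phi>) \<in> A \<and> open V \<and> V \<subseteq> U \<and> inj_on \<pi> V)"
  by (simp add: quot_atlas_def \<pi>_def)

lemma quot_chart:
  assumes c: "(U, \<phi>) \<in> A" "open V" "V \<subseteq> U" "inj_on \<pi> V"
  shows "a \<in> V \<Longrightarrow> (\<phi> \<circ> inv_into V \<pi>) (\<pi> a) = \<phi> a"
    and "(\<phi> \<circ> inv_into V \<pi>) ` \<pi> ` V = \<phi> ` V"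
    and "inj_on (\<phi> \<circ> inv_into V \<pi>) (\<pi> ` V)"
    and "x \<in> \<phi> ` V \<Longrightarrow> inv_into (\<pi> ` V) (\<phi> \<circ> inv_into V \<pi>) x = \<pi> (inv_into U \<phi> x)"
    and "open (\<phi> ` V)"
proof -
  show e: "(\<phi> \<circ> inv_into V \<pi>) (\<pi> a) = \<phi> a" if "a \<in> V" for a
    using that c(4) by simp
  then show "(\<phi> \<circ> inv_into V \<pi>) ` \<pi> ` V = \<phi> ` V"
    unfolding image_image by (intro image_cong) auto
  show i: "inj_on (\<phi> \<circ> inv_into V \<pi>) (\<pi> ` V)"
  proof (rule inj_onI)
    fix p q assume pq: "p \<in> \<pi> ` V" "q \<in> \<pi> ` V" "(\<phi> \<circ> inv_into V \<pi>) p = (\<phi> \<circ> inv_into V \<pi>) q"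
    then obtain a b where ab: "a \<in> V" "p = \<pi> a" "b \<in> V" "q = \<pi> b" by blast
    then have "\<phi> a = \<phi> b" using pq(3) e by simp
    then have "a = b" using ab c(3) chart_inj[OF c(1)] by (meson inj_onD subsetD)
    then show "p = q" using ab by simp
  qed
  show "inv_into (\<pi> ` V) (\<phi> \<circ> inv_into V \<pi>) x = \<pi> (inv_into U \<phi> x)" if x: "x \<in> \<phi> ` V"
  proof -
    obtain a where a: "a \<in> V" "x = \<phi> a" using x by blast
    then show ?thesis
      using inv_into_f_f[OF i, of "\<pi> a"] e[OF a(1)] inv_chart[OF c(1), of a] c(3) by auto
  qed
  show "open (\<phi> ` V)" using open_chart_image[OF atlas c(1,2,3)] .
qed

lemma pts_M: "pts M = range \<pi>"
proof
  show "pts M \<subseteq> range \<pi>" by (auto simp: mem_pts_iff quot_atlas_iff)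
  show "range \<pi> \<subseteq> pts M"
  proof
    fix p assume "p \<in> range \<pi>"
    then obtain a where a: "p = \<pi> a" by blast
    obtain U \<phi> V where "(U, \<phi>) \<in> A" "open V" "V \<subseteq> U" "inj_on \<pi> V" "a \<in> V" using ex_quot_chart by blast
    then have "(\<pi> ` V, \<phi> \<circ> inv_into V \<pi>) \<in> M" "p \<in> \<pi> ` V" by (auto simp: quot_atlas_iff a)
    then show "p \<in> pts M" unfolding mem_pts_iff by blast
  qed
qed

text \<open>Elements of \<open>\<Gamma>\<close> act by left translations, which preserve
  germs.\<close>

lemma invariant_germ: "\<pi> a = \<pi> b \<Longrightarrow> (\<lambda>x. f (\<pi> x)) \<in> germs A a \<Longrightarrow> (\<lambda>x. f (\<pi> x)) \<in> germs A b"
proof -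
  assume eq: "\<pi> a = \<pi> b" and f: "(\<lambda>x. f (\<pi> x)) \<in> germs A a"
  obtain \<gamma> where g: "\<gamma> \<in> \<Gamma>" "a = \<gamma> \<otimes> b" using eq \<pi>_eq_iff by blast
  have "\<pi> (\<gamma> \<otimes> x) = \<pi> x" for x using g(1) \<pi>_eq_iff by blast
  then show ?thesis using left_mult_germ[of "\<lambda>x. f (\<pi> x)" \<gamma> b] f by (simp add: g(2))
qed

text \<open>The projection is a local diffeomorphism. A chart of the quotient may pass through
  another representative \<open>b\<close> of the coset, and \<open>invariant_germ\<close> moves the
  statement back to \<open>a\<close>.\<close>

lemma germs_M_iff: "f \<in> germs M (\<pi> a) \<longleftrightarrow> (\<lambda>x. f (\<pi> x)) \<in> germs A a"
proof
  assume "f \<in> germs M (\<pi> a)"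
  then obtain P \<kappa> N where "(P, \<kappa>) \<in> M" "\<pi> a \<in> P" and N: "open N" "\<kappa> (\<pi> a) \<in> N" "N \<subseteq> \<kappa> ` P"
    "smooth_on N (f \<circ> inv_into P \<kappa>)" by (auto simp: germs_def)
  then obtain V U \<phi> where P: "P = \<pi> ` V" "\<kappa> = \<phi> \<circ> inv_into V \<pi>" and c: "(U, \<phi>) \<in> A" "open V" "V \<subseteq> U" "inj_on \<pi> V"
    by (auto simp: quot_atlas_iff)
  obtain b where b: "b \<in> V" "\<pi> a = \<pi> b" using \<open>\<pi> a \<in> P\<close> P by blast
  have NV: "N \<subseteq> \<phi> ` V" using N(3) quot_chart(2)[OF c] by (simp add: P)
  have "smooth_on N ((\<lambda>x. f (\<pi> x)) \<circ> inv_into U \<phi>)"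
    by (rule smooth_on_cong[OF N(1) _ N(4)])
      (use NV quot_chart(4)[OF c] in \<open>auto simp: P subset_iff\<close>)
  moreover have "\<phi> b \<in> N" using N(2) quot_chart(1)[OF c b(1)] by (simp add: P b)
  ultimately have "(\<lambda>x. f (\<pi> x)) \<in> germs A b"
    using c b NV N(1) image_mono[OF c(3), of \<phi>] by (intro germsI[of U \<phi> b N]) auto
  then show "(\<lambda>x. f (\<pi> x)) \<in> germs A a" using invariant_germ b(2) by metis
next
  assume f: "(\<lambda>x. f (\<pi> x)) \<in> germs A a"
  obtain U \<phi> V where c: "(U, \<phi>) \<in> A" "open V" "V \<subseteq> U" "inj_on \<pi> V" and a: "a \<in> V" using ex_quot_chart by blast
  obtain N where N: "open N" "\<phi> a \<in> N" "N \<subseteq> \<phi> ` U" "smooth_on N ((\<lambda>x. f (\<pi> x)) \<circ> inv_into U \<phi>)"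
    using germ_chart[OF c(1) _ f] a c(3) by blast
  let ?\<kappa> = "\<phi> \<circ> inv_into V \<pi>" and ?N = "N \<inter> \<phi> ` V"
  have "open ?N" using N(1) quot_chart(5)[OF c] by blast
  moreover have "?N \<subseteq> ?\<kappa> ` \<pi> ` V" unfolding quot_chart(2)[OF c] by blast
  moreover have "smooth_on ?N (f \<circ> inv_into (\<pi> ` V) ?\<kappa>)"
    by (rule smooth_on_cong[OF \<open>open ?N\<close> _ smooth_on_subset[OF N(4)]])
      (use quot_chart(4)[OF c] in auto)
  moreover have "?\<kappa> (\<pi> a) \<in> ?N" unfolding quot_chart(1)[OF c a] using N(2) a by blast
  moreover have "(\<pi> ` V, ?\<kappa>) \<in> M" "\<pi> a \<in> \<pi> ` V" using c a by (auto simp: quot_atlas_iff)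
  ultimately show "f \<in> germs M (\<pi> a)" unfolding germs_def by blast
qed

text \<open>Chart independence is inherited from the group: by \<open>germs_M_iff\<close> a germ
  pulls back to one on the group, where it may be read in any chart, and each quotient chart is a
  local section followed by such a chart.\<close>

lemma smooth_charts_M: "smooth_charts M"
proof
  fix P \<kappa> assume "(P, \<kappa>) \<in> M"
  then obtain V U \<phi> where P: "P = \<pi> ` V" "\<kappa> = \<phi> \<circ> inv_into V \<pi>" and c: "(U, \<phi>) \<in> A" "open V" "V \<subseteq> U" "inj_on \<pi> V"
    by (auto simp: quot_atlas_iff)
  show "open (\<kappa> ` P)" "inj_on \<kappa> P" using quot_chart(2,3,5)[OF c] by (simp_all add: P)
  fix p f assume p: "p \<in> P" and f: "f \<in> germs M p"
  then obtain a where a: "a \<in> V" "p = \<pi> a" using P by blast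
  obtain N where N: "open N" "\<phi> a \<in> N" "N \<subseteq> \<phi> ` U" "smooth_on N ((\<lambda>x. f (\<pi> x)) \<circ> inv_into U \<phi>)"
    using germ_chart[OF c(1), of a "\<lambda>x. f (\<pi> x)"] f a c(3) by (auto simp: germs_M_iff)
  let ?N = "N \<inter> \<phi> ` V"
  have oN: "open ?N" using N(1) quot_chart(5)[OF c] by blast
  have "smooth_on ?N (f \<circ> inv_into P \<kappa>)"
    unfolding P by (rule smooth_on_cong[OF oN _ smooth_on_subset[OF N(4)]])
      (use quot_chart(4)[OF c] in auto)
  moreover have "\<kappa> p \<in> ?N" "?N \<subseteq> \<kappa> ` P"
    unfolding P a(2) quot_chart(2)[OF c] quot_chart(1)[OF c a(1)] using N(2) a by blast+
  ultimately show "\<exists>N. open N \<and> \<kappa> p \<in> N \<and> N \<subseteq> \<kappa> ` P \<and> smooth_on N (f \<circ> inv_into P \<kappa>)"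
    using oN by blast
qed

sublocale M: smooth_charts M
  by (rule smooth_charts_M)

section \<open>Tangent vectors of the quotient and the descended frame\<close>

lemma coord_vec_M:
  assumes c: "(U, \<phi>) \<in> A" "open V" "V \<subseteq> U" "inj_on \<pi> V" and a: "a \<in> V"
  shows "coord_vec M (\<pi> ` V, \<phi> \<circ> inv_into V \<pi>) (\<pi> a) u f = coord_vec A (U, \<phi>) a u (\<lambda>x. f (\<pi> x))"
proof (cases "f \<in> germs M (\<pi> a)")
  case True
  then have f: "(\<lambda>x. f (\<pi> x)) \<in> germs A a" by (simp add: germs_M_iff)
  have "((\<lambda>x. f (\<pi> x)) \<circ> inv_into U \<phi>) differentiable (at (\<phi> a))"
    using germ_chart[OF c(1) _ f] a c(3) smooth_on_differentiable by blast
  then have "der ((\<lambda>x. f (\<pi> x)) \<circ> inv_into U \<phi>) (\<phi> a) =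
      der (f \<circ> inv_into (\<pi> ` V) (\<phi> \<circ> inv_into V \<pi>)) (\<phi> a)"
    by (rule frechet_derivative_transform_within_open[OF _ quot_chart(5)[OF c]])
      (use a quot_chart(4)[OF c] in auto)
  then show ?thesis using True f quot_chart(1)[OF c a] by (simp add: coord_vec_def)
next
  case False
  then show ?thesis by (simp add: coord_vec_def germs_M_iff)
qed

text \<open>The choice of a representative is harmless by left invariance, see
  \<open>E_\<pi>\<close>.\<close>

definition E :: "complex^'n \<Rightarrow> 'a set field" where
  "E u p f = (if p \<in> range \<pi> then L u (SOME a. \<pi> a = p) (\<lambda>x. f (\<pi> x)) else 0)"

lemma E_\<pi>: "E u (\<pi> a) f = L u a (\<lambda>x. f (\<pi> x))"
proof -
  have "\<pi> (SOME b. \<pi> b = \<pi> a) = \<pi> a" by (rule someI) (rule refl)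
  then obtain \<gamma> where g: "\<gamma> \<in> \<Gamma>" "(SOME b. \<pi> b = \<pi> a) = \<gamma> \<otimes> a" by (auto simp: \<pi>_eq_iff)
  have "\<pi> (\<gamma> \<otimes> x) = \<pi> x" for x using g(1) \<pi>_eq_iff by blast
  then have "L u (\<gamma> \<otimes> a) (\<lambda>x. f (\<pi> x)) = L u a (\<lambda>x. f (\<pi> x))"
    using left_mult_germ_iff[of "\<lambda>x. f (\<pi> x)" \<gamma> a] by (simp add: L_apply assoc)
  then show ?thesis by (simp add: E_def g(2))
qed

lemma differential_\<pi>: "differential M \<pi> a (L u a) = E u (\<pi> a)"
  by (rule ext) (auto simp: differential_def E_\<pi> germs_M_iff L_apply o_def)

text \<open>Vectors on the quotient test pulled-back functions only, whereas equality of vectors on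
  the group requires all germs. A local section shows that near \<open>a\<close> every germ is a
  pull-back.\<close>

lemma descend_germ:
  assumes k: "k \<in> germs A a"
  obtains f where "f \<in> germs M (\<pi> a)" "near a (\<lambda>x. k x = f (\<pi> x))"
proof -
  obtain U \<phi> V where c: "(U, \<phi>) \<in> A" "open V" "V \<subseteq> U" "inj_on \<pi> V" and a: "a \<in> V" using ex_quot_chart by blast
  define f where "f p = k (inv_into V \<pi> p)" for p
  have "k (inv_into U \<phi> x) = f (\<pi> (inv_into U \<phi> x))" if "x \<in> \<phi> ` V" for x
    using that c(3,4) inv_chart[OF c(1)] by (auto simp: f_def)
  then have n: "near a (\<lambda>x. k x = f (\<pi> x))"
    unfolding near_def using c a quot_chart(5)[OF c]
    by (intro exI[of _ U] exI[of _ \<phi>] exI[of _ "\<phi> ` V"]) auto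
  then have "f \<in> germs M (\<pi> a)" unfolding germs_M_iff by (rule germs_cong_near[OF k])
  then show thesis using n that by blast
qed

lemma tangent_M_iff: "t \<in> tangent_space M (\<pi> a) \<longleftrightarrow> (\<exists>u. t = E u (\<pi> a))"
proof
  assume "t \<in> tangent_space M (\<pi> a)"
  then obtain P \<kappa> w where "(P, \<kappa>) \<in> M" and p: "\<pi> a \<in> P" and t: "t = coord_vec M (P, \<kappa>) (\<pi> a) w"
    by (auto simp: tangent_space_def)
  then obtain V U \<phi> where P: "P = \<pi> ` V" "\<kappa> = \<phi> \<circ> inv_into V \<pi>" and c: "(U, \<phi>) \<in> A" "open V" "V \<subseteq> U" "inj_on \<pi> V"
    by (auto simp: quot_atlas_iff)
  obtain b where b: "b \<in> V" "\<pi> a = \<pi> b" using p P by blast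
  have bU: "b \<in> U" using b c by blast
  obtain u where "coord_vec A (U, \<phi>) b w = L u b"
    using L_surj[OF coord_vec_tangent[OF c(1) bU]] by blast
  then have "t = E u (\<pi> b)"
    unfolding t P b(2) by (intro ext) (simp add: coord_vec_M[OF c b(1)] E_\<pi>)
  then show "\<exists>u. t = E u (\<pi> a)" using b(2) by auto
next
  assume "\<exists>u. t = E u (\<pi> a)"
  then obtain u where t: "t = E u (\<pi> a)" by blast
  obtain U \<phi> V where c: "(U, \<phi>) \<in> A" "open V" "V \<subseteq> U" "inj_on \<pi> V" and a: "a \<in> V" using ex_quot_chart by blast
  have "t = coord_vec M (\<pi> ` V, \<phi> \<circ> inv_into V \<pi>) (\<pi> a) (lam (U, \<phi>) u (\<phi> a))"
    unfolding t by (rule ext) (use c a in \<open>simp add: coord_vec_M[OF c a] E_\<pi> L_coord_vec subset_iff\<close>)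
  moreover have "(\<pi> ` V, \<phi> \<circ> inv_into V \<pi>) \<in> M" "\<pi> a \<in> \<pi> ` V" using c a by (auto simp: quot_atlas_iff)
  ultimately show "t \<in> tangent_space M (\<pi> a)" by (auto simp: tangent_space_def)
qed

lemma E_off: "p \<notin> pts M \<Longrightarrow> E u p f = 0"
  by (simp add: E_def pts_M)

lemma E_M_field: "E u \<in> vfields M"
proof -
  have "(\<lambda>q. E u q f) \<in> germs M (\<pi> a)" if "f \<in> germs M (\<pi> a)" for f a
    using that vfields_germs[OF L_field, of "\<lambda>x. f (\<pi> x)" a u] by (simp add: germs_M_iff E_\<pi>)
  then show ?thesis
    using tangent_M_iff E_off by (auto simp: vfields_def pts_M fun_eq_iff)
qed

lemma E_M_inj:
  assumes "E u (\<pi> a) = E v (\<pi> a)"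
  shows "u = v"
proof (rule L_inj, rule ext)
  fix k
  show "L u a k = L v a k"
  proof (cases "k \<in> germs A a")
    case True
    then obtain f where f: "f \<in> germs M (\<pi> a)" "near a (\<lambda>x. k x = f (\<pi> x))" by (rule descend_germ)
    have "L w a k = E w (\<pi> a) f" for w
      unfolding E_\<pi> by (rule tangent_cong_near[OF L_tangent True f(2)])
    then show ?thesis using assms by simp
  qed (simp add: L_apply)
qed

lemma smooth_funs_M_iff: "f \<in> smooth_funs M \<longleftrightarrow> (\<lambda>x. f (\<pi> x)) \<in> smooth_funs A"
  by (auto simp: smooth_funs_def pts_M germs_M_iff)

lemma bracket_E: "bracket M (E u) (E v) = E (lbr u v)"
proof (intro ext)
  fix p f
  show "bracket M (E u) (E v) p f = E (lbr u v) p f"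
  proof (cases "f \<in> germs M p")
    case True
    then obtain a where p: "p = \<pi> a" using M.germs_pts pts_M by blast
    have f: "(\<lambda>x. f (\<pi> x)) \<in> germs A a" using True by (simp add: p germs_M_iff)
    show ?thesis
      unfolding p E_\<pi> bracket_L[symmetric] using True f by (simp add: bracket_def p E_\<pi>)
  next
    case False
    then show ?thesis using M.vfields_not_germ[OF E_M_field False] by (simp add: bracket_def)
  qed
qed

context
  fixes h :: "'a metr"
  assumes h: "left_invariant_hermitian G A h"
begin

text \<open>The coefficients pull back to those of a field on the group, where
  \<open>coefficient_smooth_G\<close> applies; the work lies in the smoothness of this pulled-back
  field.\<close>

lemma coefficient_smooth_M:
  assumes X: "X \<in> vfields M" and x: "\<And>p. p \<in> pts M \<Longrightarrow> X p = E (x p) p"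
  shows "(\<lambda>p. x p \<bullet> b) \<in> smooth_funs M"
proof -
  let ?X = "\<lambda>a. L (x (\<pi> a)) a"
  have "(\<lambda>q. ?X q k) \<in> germs A a" if k: "k \<in> germs A a" for k a
  proof -
    obtain f where f: "f \<in> germs M (\<pi> a)" "near a (\<lambda>x. k x = f (\<pi> x))" using descend_germ[OF k] by blast
    have g: "(\<lambda>q. X (\<pi> q) f) \<in> germs A a"
      using M.vfields_germs[OF X f(1)] by (simp add: germs_M_iff)
    obtain U \<phi> N where c: "(U, \<phi>) \<in> A" "a \<in> U" and N: "open N" "\<phi> a \<in> N" "N \<subseteq> \<phi> ` U"
      and kf: "\<And>x. x \<in> N \<Longrightarrow> k (inv_into U \<phi> x) = f (\<pi> (inv_into U \<phi> x))"
      using f(2) unfolding near_def by blast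
    obtain N' where N': "open N'" "\<phi> a \<in> N'" "N' \<subseteq> \<phi> ` U" "smooth_on N' (k \<circ> inv_into U \<phi>)"
      using germ_chart[OF c k] by blast
    \<comment> \<open>Near \<open>a\<close> the germ \<open>k\<close> is the pull-back of
      \<open>f\<close>, so its derivative along \<open>?X\<close> is there the pull-back of the
      derivative of \<open>f\<close> along \<open>X\<close>.\<close>
    have "near a (\<lambda>q. X (\<pi> q) f = ?X q k)"
      unfolding near_def
    proof (intro exI conjI ballI)
      show "(U, \<phi>) \<in> A" "a \<in> U" "open (N \<inter> N')" "\<phi> a \<in> N \<inter> N'" "N \<inter> N' \<subseteq> \<phi> ` U"
        using c N N' by auto
      fix y assume y: "y \<in> N \<inter> N'"
      let ?q = "inv_into U \<phi> y"
      have q: "?q \<in> U" "\<phi> ?q = y" using y N(3) by (auto simp: inv_into_into f_inv_into_f)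
      have kq: "k \<in> germs A ?q" using c(1) q N' y by (intro germsI[of U \<phi> ?q N']) auto
      have nq: "near ?q (\<lambda>x. k x = f (\<pi> x))"
        unfolding near_def using c(1) q N kf y by (intro exI[of _ U] exI[of _ \<phi>] exI[of _ N]) auto
      have "L w ?q k = L w ?q (\<lambda>x. f (\<pi> x))" for w
        by (rule tangent_cong_near[OF L_tangent kq nq])
      then show "X (\<pi> ?q) f = ?X ?q k"
        using x[of "\<pi> ?q"] by (simp add: pts_M E_\<pi>)
    qed
    then show ?thesis by (rule germs_cong_near[OF g])
  qed
  then have "?X \<in> vfields A" using L_tangent by (auto simp: vfields_def)
  then show ?thesis unfolding smooth_funs_M_iff by (rule coefficient_smooth_G[OF h]) simp
qed

lemma framed_manifold_M: "framed_manifold M E lbr"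
proof (intro framed_manifold.intro framed_manifold_axioms.intro smooth_charts_M)
  show "E u \<in> vfields M" for u by (rule E_M_field)
  show "linear (\<lambda>u. E u p f)" if "p \<in> pts M" for p f
    using that L_linear by (auto simp: pts_M E_\<pi>)
  show "u = v" if "p \<in> pts M" "E u p = E v p" for p u v
    using that E_M_inj by (auto simp: pts_M)
  show "\<exists>u. t = E u p" if "t \<in> tangent_space M p" "p \<in> pts M" for t p
    using that tangent_M_iff by (auto simp: pts_M)
  show "(\<lambda>p. x p \<bullet> b) \<in> smooth_funs M"
    if "X \<in> vfields M" "\<And>p. p \<in> pts M \<Longrightarrow> X p = E (x p) p" for X x b
    using coefficient_smooth_M that by blast
  show "bracket M (E u) (E v) = E (lbr u v)" for u v by (rule bracket_E)
  show "bilinear lbr" by (rule lbr_bilinear)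
qed

lemma lie_algebra_M: "metric_complex_lie_algebra lbr mult_i (inner0 h)"
proof (rule metric_complex_lie_algebra.intro)
  interpret framed_manifold M E lbr by (rule framed_manifold_M)
  show "bilinear lbr" by (rule lbr_bilinear)
  show "lbr x y = - lbr y x" for x y by (rule lbr_skew)
  show "lbr x (lbr y z) = lbr (lbr x y) z + lbr y (lbr x z)" for x y z
    by (rule c_jacobi) (simp add: pts_M)
  show "linear (mult_i :: complex^'n \<Rightarrow> _)" by (rule mult_i_linear)
  show "mult_i (mult_i x) = - x" for x :: "complex^'n" by (rule mult_i_mult_i)
  show "lbr (mult_i x) y = mult_i (lbr x y)" for x y by (rule lbr_mult_i)
  show "bilinear (inner0 h)" by (rule inner0_bilinear[OF h])
  show "inner0 h x y = inner0 h y x" for x y by (rule inner0_sym[OF h])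
  show "x \<noteq> 0 \<Longrightarrow> inner0 h x x > 0" for x by (rule inner0_pos[OF h])
  show "inner0 h (mult_i x) (mult_i y) = inner0 h x y" for x y by (rule inner0_mult_i[OF h])
qed

text \<open>Lifts of the same vector have the same frame coordinates by \<open>E_M_inj\<close>, and
  \<open>h\<close> is constant in the frame, so \<open>THE\<close> denotes a single value.\<close>

lemma quot_metric_E: "quot_metric G \<Gamma> A h (\<pi> a) (E u (\<pi> a)) (E v (\<pi> a)) = inner0 h u v"
  unfolding quot_metric_def \<pi>_def[symmetric]
proof (rule the_equality)
  show "\<exists>b\<in>\<pi> a. \<exists>v'\<in>tangent_space A b. \<exists>w'\<in>tangent_space A b.
      E u (\<pi> a) = differential M \<pi> b v' \<and> E v (\<pi> a) = differential M \<pi> b w' \<and> inner0 h u v = h b v' w'"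
    by (rule bexI[of _ a], rule bexI[of _ "L u a"], rule bexI[of _ "L v a"])
      (simp_all add: differential_\<pi> h_L[OF h] L_tangent mem_\<pi>)
  fix r assume "\<exists>b\<in>\<pi> a. \<exists>v'\<in>tangent_space A b. \<exists>w'\<in>tangent_space A b.
      E u (\<pi> a) = differential M \<pi> b v' \<and> E v (\<pi> a) = differential M \<pi> b w' \<and> r = h b v' w'"
  then obtain b v' w' where b: "\<pi> b = \<pi> a" and t: "v' \<in> tangent_space A b" "w' \<in> tangent_space A b"
    and e: "E u (\<pi> a) = differential M \<pi> b v'" "E v (\<pi> a) = differential M \<pi> b w'" "r = h b v' w'"
    using mem_\<pi> by blast
  obtain u' v'' where L: "v' = L u' b" "w' = L v'' b" using L_surj t by metis
  then have "u = u'" "v = v''" using e b E_M_inj differential_\<pi> by metis+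
  then show "r = inner0 h u v" using e(3) L h_L[OF h] by simp
qed

lemma quot_endo_E:
  assumes "\<And>a u. I a (L u a) = L (K u) a"
  shows "quot_endo G \<Gamma> A I (\<pi> a) (E u (\<pi> a)) = E (K u) (\<pi> a)"
  unfolding quot_endo_def \<pi>_def[symmetric]
proof (rule the_equality)
  show "\<exists>b\<in>\<pi> a. \<exists>v'\<in>tangent_space A b. E u (\<pi> a) = differential M \<pi> b v' \<and>
      E (K u) (\<pi> a) = differential M \<pi> b (I b v')"
    by (rule bexI[of _ a], rule bexI[of _ "L u a"]) (simp_all add: differential_\<pi> assms L_tangent mem_\<pi>)
  fix w assume "\<exists>b\<in>\<pi> a. \<exists>v'\<in>tangent_space A b. E u (\<pi> a) = differential M \<pi> b v' \<and>
      w = differential M \<pi> b (I b v')"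
  then obtain b v' where b: "\<pi> b = \<pi> a" and t: "v' \<in> tangent_space A b"
    and e: "E u (\<pi> a) = differential M \<pi> b v'" "w = differential M \<pi> b (I b v')"
    using mem_\<pi> by blast
  obtain u' where L: "v' = L u' b" using L_surj t by metis
  then have "u = u'" using e b E_M_inj differential_\<pi> by metis
  then show "w = E (K u) (\<pi> a)" using e(2) L assms b by (simp add: differential_\<pi>)
qed

lemma hermitian_frame_M: "hermitian_frame M E lbr mult_i (inner0 h) (quot_metric G \<Gamma> A h)"
proof -
  interpret framed_manifold M E lbr by (rule framed_manifold_M)
  interpret metric_complex_lie_algebra lbr mult_i "inner0 h" by (rule lie_algebra_M)
  show ?thesis
    by unfold_locales (auto simp: pts_M quot_metric_E)
qed

text \<open>Two-step nilpotency does not mention \<open>h\<close>, so the Gray identity for one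
  invariant Hermitian metric yields it for all of them.\<close>

lemma quot_equivalences:
  shows "second_gray M (quot_metric G \<Gamma> A h) (quot_endo G \<Gamma> A (complex_structure A)) \<longleftrightarrow> two_step_nilpotent G A"
    and "quasi_kaehler M (quot_metric G \<Gamma> A h) (quot_endo G \<Gamma> A (J_minus G A h)) \<longleftrightarrow> two_step_nilpotent G A"
    and "chern_flat M (quot_metric G \<Gamma> A h) (quot_endo G \<Gamma> A (complex_structure A))"
    and "chern_flat M (quot_metric G \<Gamma> A h) (quot_endo G \<Gamma> A (J_minus G A h))"
proof -
  interpret hermitian_frame M E lbr mult_i "inner0 h" "quot_metric G \<Gamma> A h" by (rule hermitian_frame_M)
  have J: "endo (quot_endo G \<Gamma> A (complex_structure A)) mult_i"
    unfolding endo_J using quot_endo_E[of "complex_structure A" mult_i, OF complex_structure_L] by (auto simp: pts_M)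
  have K: "endo (quot_endo G \<Gamma> A (J_minus G A h)) Kminus"
    unfolding endo_Kminus using quot_endo_E[of "J_minus G A h" Kminus, OF J_minus_L[OF h lie_algebra_M]] by (auto simp: pts_M)
  show "second_gray M (quot_metric G \<Gamma> A h) (quot_endo G \<Gamma> A (complex_structure A)) \<longleftrightarrow> two_step_nilpotent G A"
    unfolding two_step_nilpotent_iff by (rule second_gray_iff[OF J])
  show "quasi_kaehler M (quot_metric G \<Gamma> A h) (quot_endo G \<Gamma> A (J_minus G A h)) \<longleftrightarrow> two_step_nilpotent G A"
    unfolding two_step_nilpotent_iff by (rule quasi_kaehler_iff[OF K])
  show "chern_flat M (quot_metric G \<Gamma> A h) (quot_endo G \<Gamma> A (complex_structure A))"
    by (rule chern_flat_J[OF J])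
  show "chern_flat M (quot_metric G \<Gamma> A h) (quot_endo G \<Gamma> A (J_minus G A h))"
    by (rule chern_flat_Kminus[OF K])
qed

end

end

theorem theorem1p1:
  fixes G :: "('a::{t2_space, second_countable_topology}, 'b) monoid_scheme"
    and A :: "('a, complex^'n) chart set"
    and g :: "'a metr"
    and \<Gamma> :: "'a set"
  assumes "complex_lie_group G A"
    and "left_invariant_hermitian G A g"
    and "lattice_in G \<Gamma>"
  shows
    "let M = quot_atlas G \<Gamma> A;
         gM = quot_metric G \<Gamma> A g;
         J = quot_endo G \<Gamma> A (complex_structure A);
         Jm = quot_endo G \<Gamma> A (J_minus G A g);
         cond1 = second_gray M gM J;
         cond2 = (\<forall>h. left_invariant_hermitian G A h \<longrightarrow> second_gray M (quot_metric G \<Gamma> A h) J);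
         cond3 = quasi_kaehler M gM Jm;
         cond4 = two_step_nilpotent G A
     in (cond1 \<longleftrightarrow> cond2) \<and> (cond1 \<longleftrightarrow> cond3) \<and> (cond1 \<longleftrightarrow> cond4) \<and>
        (cond1 \<or> cond2 \<or> cond3 \<or> cond4 \<longrightarrow> chern_flat M gM J \<and> chern_flat M gM Jm)"
proof -
  have "pts A = UNIV"
    using assms(1) complex_atlasD(1) by (auto simp: complex_lie_group_def)
  then have "\<one>\<^bsub>G\<^esub> \<in> pts A" by simp
  then obtain V0 \<psi>0 where "(V0, \<psi>0) \<in> A" "\<one>\<^bsub>G\<^esub> \<in> V0" by (auto simp: pts_def)
  then interpret lie_quotient G A V0 \<psi>0 \<Gamma>
    using assms(1,3)
    by (intro lie_quotient.intro complex_lie_frame.intro lie_quotient_axioms.intro)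
      (simp_all add: lattice_in_def)
  show ?thesis
    using quot_equivalences assms(2) by (auto simp: Let_def)
qed

end
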